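(* Let $G\subset\mathbb{C}$ be a bounded domain with boundary $\Gamma\in C^{1,\alpha}$, $0<\alpha<1$, and let $a\in G$. Let $A,B\in S_1(G,a)$ and put $\mu=\|A\|_{S_1(G,a)}+\|B\|_{S_1(G,a)}$. Let $q$ satisfy $2<q<\frac{2}{1-8\mu}$ if $\mu<\frac18$ and $q>2$ if $\mu\ge\frac18$, let $\max\{0,1-8\mu\}<\beta<\frac2q$, and let $F\in S_\beta(G,a)$. Then every solution $V\in W^1_q(G)\cap C_{\beta-1}(\overline{G},a)$ of $$\partial_{\bar z}V+A(z)V+B(z)\overline{V}=F(z)\quad\text{in }G$$ has the integral representation $$V(z)=-(P_{G,a}V)(z)+(K_{\Gamma,a}V)(z)+(T_{G,a}F)(z),\qquad z\in G.$$
   Context: For real $\nu$, $S_\nu(G,a)$ is the class of measurable functions $f$ on $G$ for which $f(z)|z-a|^\nu$ is essentially bounded, with norm $\|f\|_{S_\nu(G,a)}=\operatorname{ess\,sup}_{z\in G}|z-a|^\nu|f(z)|$. $C_\nu(\overline{G},a)$ is the class of functions $f$ for which $f(z)|z-a|^\nu\in C(\overline{G})$, with norm $\max|z-a|^\nu|f(z)|$. $W^1_q(G)$ is the Sobolev space. $\partial_{\bar z}=\frac12\left(\frac{\partial}{\partial x}+i\frac{\partial}{\partial y}\right)$. The operators are $$(T_Gf)(z)=-\frac1\pi\iint_G\frac{f(\zeta)}{\zeta-z}\,d\xi\,d\eta\quad(\zeta=\xi+i\eta),\qquad (T_{G,a}f)(z)=(T_Gf)(z)-(T_Gf)(a),$$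 $$(P_{G,a}f)(z)=(T_{G,a}f^* )(z),\qquad f^*(z)=A(z)f(z)+B(z)\overline{f(z)},$$ $$(K_\Gamma f)(z)=\frac{1}{2\pi i}\int_\Gamma\frac{f(t)}{t-z}\,dt,\qquad (K_{\Gamma,a}f)(z)=(K_\Gamma f)(z)-(K_\Gamma f)(a),$$ where $\Gamma$ is positively oriented with respect to $G$. *)

theory Defs
  imports
    "HOL-Complex_Analysis.Complex_Analysis"
    "HOL-Probability.Essential_Supremum"
begin

section \<open>Function spaces\<close>

text \<open>The factor \<open>cmod (z - a) powr \<nu>\<close> is \<open>0\<close> at \<open>z = a\<close> in HOL, also for \<open>\<nu> \<le> 0\<close>. This is
  immaterial in the two definitions below, since a point is a null set.\<close>

definition S_space :: "real \<Rightarrow> complex set \<Rightarrow> complex \<Rightarrow> (complex \<Rightarrow> complex) set" where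
  "S_space \<nu> G a = {f. f \<in> borel_measurable (lebesgue_on G) \<and>
     (\<exists>C. AE z in lebesgue_on G. cmod (z - a) powr \<nu> * cmod (f z) \<le> C)}"

definition S_norm :: "real \<Rightarrow> complex set \<Rightarrow> complex \<Rightarrow> (complex \<Rightarrow> complex) \<Rightarrow> real" where
  "S_norm \<nu> G a f =
     real_of_ereal (esssup (lebesgue_on G) (\<lambda>z. ereal (cmod (z - a) powr \<nu> * cmod (f z))))"

text \<open>\<open>f(z) |z - a|\<^sup>\<nu>\<close> extends from the closure of \<open>G\<close> without \<open>a\<close> to a continuous function \<open>g\<close>
  on the closure. For \<open>\<nu> > 0\<close> the value of \<open>f\<close> at \<open>a\<close> is irrelevant. For \<open>\<nu> \<le> 0\<close> the equation
  \<open>f(z) = |z - a|\<^sup>-\<^sup>\<nu> g(z)\<close> makes \<open>f\<close> a continuous function on the whole closure, which fixes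
  \<open>f(a)\<close>; in particular \<open>f(a) = 0\<close> for \<open>\<nu> < 0\<close>.\<close>

definition C_space :: "real \<Rightarrow> complex set \<Rightarrow> complex \<Rightarrow> (complex \<Rightarrow> complex) set" where
  "C_space \<nu> G a = {f.
     (\<exists>g. continuous_on (closure G) g \<and>
          (\<forall>z\<in>closure G - {a}. g z = of_real (cmod (z - a) powr \<nu>) * f z)) \<and>
     (\<nu> \<le> 0 \<longrightarrow> continuous_on (closure G) f)}"

definition Lq_space :: "real \<Rightarrow> complex set \<Rightarrow> (complex \<Rightarrow> complex) set" where
  "Lq_space q G = {f. f \<in> borel_measurable (lebesgue_on G) \<and>
     integrable (lebesgue_on G) (\<lambda>z. cmod (f z) powr q)}"


section \<open>Weak derivatives and Sobolev spaces\<close>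

text \<open>Differentiability is meant in the real sense, on the plane.\<close>

primrec Ck :: "nat \<Rightarrow> (complex \<Rightarrow> complex) \<Rightarrow> bool" where
  "Ck 0 \<phi> \<longleftrightarrow> continuous_on UNIV \<phi>"
| "Ck (Suc k) \<phi> \<longleftrightarrow> (\<forall>z. \<phi> differentiable (at z)) \<and>
     (\<forall>v. Ck k (\<lambda>z. frechet_derivative \<phi> (at z) v))"

definition test_functions :: "complex set \<Rightarrow> (complex \<Rightarrow> complex) set" where
  "test_functions G = {\<phi>. (\<forall>k. Ck k \<phi>) \<and> (\<exists>K. compact K \<and> K \<subseteq> G \<and> (\<forall>z. z \<notin> K \<longrightarrow> \<phi> z = 0))}"

definition locally_integrable :: "complex set \<Rightarrow> (complex \<Rightarrow> complex) \<Rightarrow> bool" where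
  "locally_integrable G f \<longleftrightarrow> (\<forall>K. compact K \<and> K \<subseteq> G \<longrightarrow> integrable (lebesgue_on K) f)"

text \<open>\<open>g\<close> is the weak derivative of \<open>f\<close> in the direction \<open>v\<close>; the directions \<open>1\<close> and \<open>\<i>\<close> give
  the partial derivatives with respect to \<open>x\<close> and \<open>y\<close>.\<close>

definition has_weak_derivative ::
    "complex set \<Rightarrow> complex \<Rightarrow> (complex \<Rightarrow> complex) \<Rightarrow> (complex \<Rightarrow> complex) \<Rightarrow> bool" where
  "has_weak_derivative G v f g \<longleftrightarrow> locally_integrable G f \<and> locally_integrable G g \<and>
     (\<forall>\<phi>\<in>test_functions G.
        (LINT z|lebesgue_on G. f z * frechet_derivative \<phi> (at z) v) =
        - (LINT z|lebesgue_on G. g z * \<phi> z))"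

definition Sobolev_W1 :: "real \<Rightarrow> complex set \<Rightarrow> (complex \<Rightarrow> complex) set" where
  "Sobolev_W1 q G = {f. f \<in> Lq_space q G \<and>
     (\<exists>fx\<in>Lq_space q G. has_weak_derivative G 1 f fx) \<and>
     (\<exists>fy\<in>Lq_space q G. has_weak_derivative G \<i> f fy)}"

definition has_weak_dbar ::
    "complex set \<Rightarrow> (complex \<Rightarrow> complex) \<Rightarrow> (complex \<Rightarrow> complex) \<Rightarrow> bool" where
  "has_weak_dbar G f h \<longleftrightarrow> (\<exists>fx fy. has_weak_derivative G 1 f fx \<and> has_weak_derivative G \<i> f fy \<and>
     (\<forall>z. h z = (fx z + \<i> * fy z) / 2))"


section \<open>Domains with oriented \<open>C\<^sup>1\<^sup>,\<^sup>\<alpha>\<close> boundary\<close>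

definition closed_C1_Holder_curve :: "real \<Rightarrow> (real \<Rightarrow> complex) \<Rightarrow> bool" where
  "closed_C1_Holder_curve \<alpha> \<gamma> \<longleftrightarrow>
     simple_path \<gamma> \<and> pathfinish \<gamma> = pathstart \<gamma> \<and>
     (\<forall>t\<in>{0..1}. \<gamma> differentiable (at t within {0..1}) \<and>
                 vector_derivative \<gamma> (at t within {0..1}) \<noteq> 0) \<and>
     (\<exists>C. \<forall>s\<in>{0..1}. \<forall>t\<in>{0..1}.
        dist (vector_derivative \<gamma> (at s within {0..1})) (vector_derivative \<gamma> (at t within {0..1}))
          \<le> C * \<bar>s - t\<bar> powr \<alpha>) \<and>
     vector_derivative \<gamma> (at 0 within {0..1}) = vector_derivative \<gamma> (at 1 within {0..1})"

text \<open>The domain need not be simply connected: its boundary is the union of finitely many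
  disjoint closed curves. Positive orientation means that \<open>G\<close> lies to the left of each curve,
  i.e. the normal \<open>\<i> \<gamma>'(t)\<close> points into \<open>G\<close>.\<close>

definition positively_oriented_C1_Holder_boundary ::
    "real \<Rightarrow> complex set \<Rightarrow> (real \<Rightarrow> complex) set \<Rightarrow> bool" where
  "positively_oriented_C1_Holder_boundary \<alpha> G \<Gamma> \<longleftrightarrow>
     finite \<Gamma> \<and> (\<forall>\<gamma>\<in>\<Gamma>. closed_C1_Holder_curve \<alpha> \<gamma>) \<and>
     disjoint_family_on path_image \<Gamma> \<and> (\<Union>\<gamma>\<in>\<Gamma>. path_image \<gamma>) = frontier G \<and>
     (\<forall>\<gamma>\<in>\<Gamma>. \<forall>t\<in>{0..1}. \<forall>\<^sub>F \<epsilon> in at_right 0.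
        \<gamma> t + of_real \<epsilon> * (\<i> * vector_derivative \<gamma> (at t within {0..1})) \<in> G)"


section \<open>The integral operators\<close>

definition T_op :: "complex set \<Rightarrow> (complex \<Rightarrow> complex) \<Rightarrow> complex \<Rightarrow> complex" where
  "T_op G f z = - (1 / of_real pi) * (LINT \<zeta>|lebesgue_on G. f \<zeta> / (\<zeta> - z))"

definition T_op_at :: "complex set \<Rightarrow> complex \<Rightarrow> (complex \<Rightarrow> complex) \<Rightarrow> complex \<Rightarrow> complex" where
  "T_op_at G a f z = T_op G f z - T_op G f a"

definition P_op_at :: "(complex \<Rightarrow> complex) \<Rightarrow> (complex \<Rightarrow> complex) \<Rightarrow> complex set \<Rightarrow> complex \<Rightarrow>
    (complex \<Rightarrow> complex) \<Rightarrow> complex \<Rightarrow> complex" where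
  "P_op_at A B G a f = T_op_at G a (\<lambda>z. A z * f z + B z * cnj (f z))"

definition K_op :: "(real \<Rightarrow> complex) set \<Rightarrow> (complex \<Rightarrow> complex) \<Rightarrow> complex \<Rightarrow> complex" where
  "K_op \<Gamma> f z =
     1 / (2 * of_real pi * \<i>) * (\<Sum>\<gamma>\<in>\<Gamma>. contour_integral \<gamma> (\<lambda>t. f t / (t - z)))"

definition K_op_at :: "(real \<Rightarrow> complex) set \<Rightarrow> complex \<Rightarrow> (complex \<Rightarrow> complex) \<Rightarrow> complex \<Rightarrow> complex" where
  "K_op_at \<Gamma> a f z = K_op \<Gamma> f z - K_op \<Gamma> f a"

end

theory Submission
  imports Defs
begin

text \<open>
  Put \<open>h = F - A V - B cnj V\<close>, so that \<open>V\<close> has the weak Cauchy-Riemann derivative \<open>h\<close>. The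
  hypotheses bound \<open>|h|\<close> by a multiple of \<open>|z - a|\<^sup>-\<^sup>\<beta>\<close> with \<open>0 < \<beta> < 1\<close>, and \<open>V(a) = 0\<close>;
  so the claim is the difference of the formulas \<open>V = K V + T h\<close> at \<open>z\<close> and at \<open>a\<close>.

  Testing the weak equation with a bump function times \<open>cnj \<zeta> / (|\<zeta>|\<^sup>2 + \<delta>\<^sup>2)\<close>, translated to
  \<open>z\<close>, and letting \<open>\<delta>\<close> tend to \<open>0\<close> shows that \<open>u = V - T h\<close> is holomorphic in \<open>G\<close>. By Fubini,
  \<open>K (T h) = 0\<close> in \<open>G\<close>, since each boundary curve has constant winding number on \<open>G\<close>. There
  remains \<open>K u = u\<close>, which follows from the homology form of Cauchy's formula by pushing the
  boundary curves into \<open>G\<close> along a smooth approximation of the inner normal, once the winding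
  numbers of the boundary sum up to \<open>1\<close> on \<open>G\<close> and to \<open>0\<close> outside. For the latter, the winding
  number jumps by \<open>1\<close> when a curve is crossed from right to left, and by Janiszewski's theorem a
  point off the boundary lies in \<open>G\<close> if it is on the same side of each boundary curve as \<open>G\<close>.
\<close>

section \<open>Domains bounded by disjoint Jordan curves\<close>

text \<open>\<open>V\<close> has only weak derivatives, with no pointwise control near the boundary,
  so Green's formula is not applied to it. Subtracting \<open>T h\<close> moves the whole
  non-holomorphic part into a function that is continuous on the entire plane; what remains is
  holomorphic in \<open>G\<close> and continuous up to the boundary. The exponents fit as follows:
  \<open>A\<close> and \<open>B\<close> have order \<open>|z - a|^(-1)\<close> and \<open>V\<close>
  has order \<open>|z - a|^(1 - \<beta>)\<close>, so the products have the order
  \<open>|z - a|^(-\<beta>)\<close> of \<open>F\<close>. Since \<open>\<beta> < 2/q < 1\<close>, the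
  Cauchy kernel times \<open>h\<close> has total singular order \<open>1 + \<beta> < 2\<close>,
  which is integrable in the plane even when the pole is \<open>a\<close>. Orientation is given
  pointwise, by the direction of the normal, whereas Cauchy's formula asks for winding numbers. The
  bridge is a uniform statement about the curve: every short, nearly normal displacement leaves it.
  This serves both for locating the points at which the jump of the winding number is evaluated and
  for pushing the curves into \<open>G\<close>.\<close>

lemma connected_component_Compl_UN_disjoint:
  fixes K :: "'i \<Rightarrow> complex set"
  assumes "finite I" "\<And>i. i \<in> I \<Longrightarrow> compact (K i)" "disjoint_family_on K I"
    and "\<And>i. i \<in> I \<Longrightarrow> connected_component (- K i) a b"
  shows "connected_component (- (\<Union>i\<in>I. K i)) a b"
  using assms
proof (induction I rule: finite_induct)
  case empty
  then show ?case by (simp add: connected_component_def) (metis UNIV_I connected_UNIV)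
next
  case (insert i I)
  have "disjoint_family_on K I"
    using insert.prems(2) by (auto simp: disjoint_family_on_def)
  then have IH: "connected_component (- (\<Union>i\<in>I. K i)) a b"
    using insert by auto
  have "K i \<inter> (\<Union>i\<in>I. K i) = {}"
    using insert.prems(2) insert.hyps(2) by (fastforce simp: disjoint_family_on_def)
  \<comment> \<open>Janiszewski: if neither of two closed sets, one of them compact, separates two
    points and their intersection is connected (here empty), then their union does not separate them
    either.\<close>
  then have "connected_component (- (K i \<union> (\<Union>i\<in>I. K i))) a b"
    using insert IH by (intro Janiszewski) (auto intro!: closed_UN compact_imp_closed)
  then show ?case by simp
qed

lemma Jordan_connected_component:
  fixes c :: "real \<Rightarrow> complex"
  assumes "simple_path c" "pathfinish c = pathstart c"
    and "a \<in> inside (path_image c) \<and> b \<in> inside (path_image c) \<or>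
         a \<in> outside (path_image c) \<and> b \<in> outside (path_image c)"
  shows "connected_component (- path_image c) a b"
  using assms Jordan_inside_outside[OF assms(1,2)] unfolding connected_component_def
  by (metis inside_no_overlap outside_no_overlap disjoint_eq_subset_Compl)

lemma Jordan_partition:
  fixes c :: "real \<Rightarrow> complex"
  assumes "simple_path c" "pathfinish c = pathstart c"
  shows "inside (path_image c) \<inter> outside (path_image c) = {}"
    and "inside (path_image c) \<inter> path_image c = {}"
    and "outside (path_image c) \<inter> path_image c = {}"
    and "x \<in> inside (path_image c) \<or> x \<in> outside (path_image c) \<or> x \<in> path_image c"
    and "closure (inside (path_image c)) = inside (path_image c) \<union> path_image c"
    and "closure (outside (path_image c)) = outside (path_image c) \<union> path_image c"
proof -
  show "inside (path_image c) \<inter> outside (path_image c) = {}" "inside (path_image c) \<inter> path_image c = {}"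
    "outside (path_image c) \<inter> path_image c = {}"
    by (auto simp: inside_Int_outside inside_no_overlap outside_no_overlap)
  show "x \<in> inside (path_image c) \<or> x \<in> outside (path_image c) \<or> x \<in> path_image c"
    using inside_Un_outside[of "path_image c"] by blast
  show "closure (inside (path_image c)) = inside (path_image c) \<union> path_image c"
    "closure (outside (path_image c)) = outside (path_image c) \<union> path_image c"
    using Jordan_inside_outside[OF assms] by (simp_all add: closure_Un_frontier)
qed

text \<open>The complement of \<open>inside (path_image c)\<close> is the closure of the outside,
  hence connected and unbounded. It misses \<open>path_image d\<close>, so it lies on one side of
  \<open>d\<close>, and being unbounded it lies on the outer side.\<close>

lemma Jordan_subset_inside:
  fixes c d :: "real \<Rightarrow> complex"
  assumes c: "simple_path c" "pathfinish c = pathstart c"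
    and d: "simple_path d" "pathfinish d = pathstart d"
    and sub: "path_image d \<subseteq> inside (path_image c)"
  shows "inside (path_image d) \<subseteq> inside (path_image c)" "path_image c \<subseteq> outside (path_image d)"
proof -
  note Jc = Jordan_inside_outside[OF c] and Jd = Jordan_inside_outside[OF d]
  let ?X = "- inside (path_image c)"
  note pc = Jordan_partition[OF c] and pd = Jordan_partition[OF d]
  have X: "?X = closure (outside (path_image c))"
    using pc by blast
  have con: "connected ?X" unfolding X using Jc by (intro connected_imp_connected_closure) auto
  have unb: "\<not> bounded ?X" unfolding X using Jc bounded_subset[OF _ closure_subset] by blast
  have "?X \<inter> path_image d = {}" using sub by auto
  then have sub': "?X \<subseteq> inside (path_image d) \<union> outside (path_image d)" using pd(4) by blast
  have "?X \<inter> inside (path_image d) = {}"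
  proof (rule ccontr)
    assume "?X \<inter> inside (path_image d) \<noteq> {}"
    moreover have "inside (path_image d) \<inter> ?X = {} \<or> outside (path_image d) \<inter> ?X = {}"
      by (rule connectedD[OF con]) (use Jd pd(1) sub' in auto)
    ultimately have "?X \<subseteq> inside (path_image d)" using sub' by blast
    then show False using unb Jd bounded_subset by blast
  qed
  then show "inside (path_image d) \<subseteq> inside (path_image c)" "path_image c \<subseteq> outside (path_image d)"
    using sub' pc(2) pd(1,2) by blast+
qed

text \<open>The closed inside of \<open>c\<close> is connected and misses
  \<open>path_image d\<close>. It contains \<open>path_image c\<close>, which is outside
  \<open>d\<close>, so all of it is outside \<open>d\<close>.\<close>

lemma Jordan_disjoint_insides:
  fixes c d :: "real \<Rightarrow> complex"
  assumes c: "simple_path c" "pathfinish c = pathstart c"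
    and d: "simple_path d" "pathfinish d = pathstart d"
    and sub: "path_image d \<subseteq> outside (path_image c)" "path_image c \<subseteq> outside (path_image d)"
  shows "inside (path_image c) \<inter> inside (path_image d) = {}"
proof -
  note Jc = Jordan_inside_outside[OF c] and Jd = Jordan_inside_outside[OF d]
  let ?X = "closure (inside (path_image c))"
  note pc = Jordan_partition[OF c] and pd = Jordan_partition[OF d]
  have X: "?X = inside (path_image c) \<union> path_image c"
    by (rule pc)
  have con: "connected ?X" using Jc by (intro connected_imp_connected_closure) auto
  have "?X \<inter> path_image d = {}" using sub pc(1,3) X by blast
  then have sub': "?X \<subseteq> inside (path_image d) \<union> outside (path_image d)" using pd(4) by blast
  have "path_image c \<noteq> {}" by simp
  then have "?X \<inter> outside (path_image d) \<noteq> {}" using sub X by blast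
  moreover have "inside (path_image d) \<inter> ?X = {} \<or> outside (path_image d) \<inter> ?X = {}"
    by (rule connectedD[OF con]) (use Jd pd(1) sub' in auto)
  ultimately have "?X \<inter> inside (path_image d) = {}" by blast
  then show ?thesis using X by auto
qed

text \<open>Exactly one curve has \<open>G\<close> in its inside, for two such curves would each lie
  inside the other; it contributes \<open>1\<close> on \<open>G\<close> and the others contribute
  \<open>0\<close>. The others bound holes with pairwise disjoint insides within that curve. A point
  off \<open>closure G\<close> is either outside the outer curve, where all terms vanish, or in
  exactly one hole, where the sum is \<open>1 - 1\<close>.\<close>

proposition sum_winding_number_Jordan_boundary:
  fixes G :: "complex set" and \<Gamma> :: "(real \<Rightarrow> complex) set"
  assumes G: "open G" "connected G" "bounded G" "G \<noteq> {}"
    and fin: "finite \<Gamma>"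
    and J: "\<And>\<gamma>. \<gamma> \<in> \<Gamma> \<Longrightarrow> simple_path \<gamma>" "\<And>\<gamma>. \<gamma> \<in> \<Gamma> \<Longrightarrow> pathfinish \<gamma> = pathstart \<gamma>"
    and disj: "disjoint_family_on path_image \<Gamma>"
    and fr: "(\<Union>\<gamma>\<in>\<Gamma>. path_image \<gamma>) = frontier G"
    and orient: "\<And>\<gamma>. \<gamma> \<in> \<Gamma> \<Longrightarrow>
      G \<subseteq> inside (path_image \<gamma>) \<and> (\<forall>w\<in>inside (path_image \<gamma>). winding_number \<gamma> w = 1) \<or>
      G \<subseteq> outside (path_image \<gamma>) \<and> (\<forall>w\<in>inside (path_image \<gamma>). winding_number \<gamma> w = - 1)"
  shows "w \<in> G \<Longrightarrow> (\<Sum>\<gamma>\<in>\<Gamma>. winding_number \<gamma> w) = 1"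
    and "w \<notin> closure G \<Longrightarrow> (\<Sum>\<gamma>\<in>\<Gamma>. winding_number \<gamma> w) = 0"
proof -
  let ?S = "path_image :: (real \<Rightarrow> complex) \<Rightarrow> complex set"
  obtain a where a: "a \<in> G" using G by auto
  note JJ = Jordan_inside_outside[OF J] and part = Jordan_partition[OF J]
  have inout: "x \<in> inside (?S \<gamma>) \<or> x \<in> outside (?S \<gamma>) \<or> x \<in> ?S \<gamma>" if "\<gamma> \<in> \<Gamma>" for \<gamma> x
    using part(4)[OF that that] by blast
  have zero: "winding_number \<gamma> x = 0" if "\<gamma> \<in> \<Gamma>" "x \<in> outside (?S \<gamma>)" for \<gamma> x
    using that J by (intro winding_number_zero_in_outside) (auto simp: simple_path_imp_path)
  have Scl: "?S \<gamma> \<subseteq> closure G" if "\<gamma> \<in> \<Gamma>" for \<gamma>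
    using fr that by (auto simp: frontier_def)
  have char: "b \<in> G" if b: "b \<notin> frontier G"
    and side: "\<And>\<gamma>. \<gamma> \<in> \<Gamma> \<Longrightarrow> a \<in> inside (?S \<gamma>) \<and> b \<in> inside (?S \<gamma>) \<or> a \<in> outside (?S \<gamma>) \<and> b \<in> outside (?S \<gamma>)" for b
  proof -
    have "connected_component (- (\<Union>\<gamma>\<in>\<Gamma>. ?S \<gamma>)) a b"
      using fin disj J side
      by (intro connected_component_Compl_UN_disjoint Jordan_connected_component)
         (auto simp: compact_simple_path_image)
    then obtain C where C: "connected C" "C \<subseteq> - frontier G" "a \<in> C" "b \<in> C"
      unfolding fr connected_component_def by auto
    then show ?thesis using connected_Int_frontier[of C G] a by blast
  qed
  define outer where "outer \<gamma> \<longleftrightarrow> G \<subseteq> inside (?S \<gamma>)" for \<gamma>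
  have hole: "G \<subseteq> outside (?S \<gamma>)" "\<And>w. w \<in> inside (?S \<gamma>) \<Longrightarrow> winding_number \<gamma> w = - 1"
    if "\<gamma> \<in> \<Gamma>" "\<not> outer \<gamma>" for \<gamma>
    using orient[OF that(1)] that(2) by (auto simp: outer_def)
  have one: "winding_number \<gamma> w = 1" if "\<gamma> \<in> \<Gamma>" "outer \<gamma>" "w \<in> inside (?S \<gamma>)" for \<gamma> w
    using orient[OF that(1)] that(2,3) a part(1)[OF that(1) that(1)] unfolding outer_def by blast
  have outer_S: "?S \<delta> \<subseteq> inside (?S \<gamma>)" if "\<gamma> \<in> \<Gamma>" "\<delta> \<in> \<Gamma>" "\<gamma> \<noteq> \<delta>" "outer \<gamma>" for \<gamma> \<delta>
  proof -
    have "closure G \<subseteq> inside (?S \<gamma>) \<union> ?S \<gamma>"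
      using closure_mono[of G "inside (?S \<gamma>)"] that part(5)[OF that(1) that(1)]
      unfolding outer_def by blast
    moreover have "?S \<delta> \<inter> ?S \<gamma> = {}" using disj that by (auto simp: disjoint_family_on_def)
    ultimately show ?thesis using Scl[OF that(2)] by blast
  qed
  have hole_S: "?S \<delta> \<subseteq> outside (?S \<gamma>)" if "\<gamma> \<in> \<Gamma>" "\<delta> \<in> \<Gamma>" "\<gamma> \<noteq> \<delta>" "\<not> outer \<gamma>" for \<gamma> \<delta>
  proof -
    have "closure G \<subseteq> outside (?S \<gamma>) \<union> ?S \<gamma>"
      using closure_mono[OF hole(1)[OF that(1,4)]] part(6)[OF that(1) that(1)]
      by blast
    moreover have "?S \<delta> \<inter> ?S \<gamma> = {}" using disj that by (auto simp: disjoint_family_on_def)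
    ultimately show ?thesis using Scl[OF that(2)] by blast
  qed
  obtain \<gamma>0 where \<gamma>0: "\<gamma>0 \<in> \<Gamma>" "outer \<gamma>0"
  proof -
    \<comment> \<open>If all curves were holes, a point \<open>b\<close> far away would be outside
      every curve, as \<open>a\<close> is, and \<open>char\<close> would put it into
      \<open>G\<close>.\<close>
    have "bounded (closure G \<union> (\<Union>\<gamma>\<in>\<Gamma>. inside (?S \<gamma>)))"
      using G fin JJ by (auto intro!: bounded_UN)
    then obtain b where b: "b \<notin> closure G \<union> (\<Union>\<gamma>\<in>\<Gamma>. inside (?S \<gamma>))"
      using not_bounded_UNIV by (metis UNIV_I subsetI bounded_subset)
    then have bf: "b \<notin> frontier G" "b \<notin> G" using closure_subset by (auto simp: frontier_def)
    then have bo: "b \<in> outside (?S \<gamma>)" if "\<gamma> \<in> \<Gamma>" for \<gamma>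
    proof -
      have "b \<notin> ?S \<gamma>" "b \<notin> inside (?S \<gamma>)" using that b bf(1) fr by auto
      then show ?thesis using inout[OF that, of b] by auto
    qed
    have "\<exists>\<gamma>\<in>\<Gamma>. outer \<gamma>"
    proof (rule ccontr)
      assume "\<not> ?thesis"
      then have "b \<in> G" using bo hole(1) a bf(1) by (intro char) (auto dest!: bspec)
      with bf show False by simp
    qed
    then show ?thesis using that by auto
  qed
  have uniq: "\<not> outer \<gamma>" if "\<gamma> \<in> \<Gamma>" "\<gamma> \<noteq> \<gamma>0" for \<gamma>
  proof
    assume o: "outer \<gamma>"
    have "?S \<gamma>0 \<subseteq> outside (?S \<gamma>)"
      by (rule Jordan_subset_inside(2)) (use J \<gamma>0 that outer_S[of \<gamma>0 \<gamma>] in auto)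
    moreover have "?S \<gamma>0 \<subseteq> inside (?S \<gamma>)"
      using o \<gamma>0 that outer_S[of \<gamma> \<gamma>0] by auto
    ultimately show False using part(1)[OF that(1) that(1)] path_image_nonempty[of \<gamma>0] by blast
  qed
  have in0: "inside (?S \<gamma>) \<subseteq> inside (?S \<gamma>0)" if "\<gamma> \<in> \<Gamma>" for \<gamma>
  proof (cases "\<gamma> = \<gamma>0")
    case False
    then show ?thesis
      by (intro Jordan_subset_inside(1)) (use J \<gamma>0 that outer_S[of \<gamma>0 \<gamma>] in auto)
  qed auto
  have sum0: "(\<Sum>\<gamma>\<in>\<Gamma>. winding_number \<gamma> w) = winding_number \<gamma>0 w + (\<Sum>\<gamma>\<in>\<Gamma> - {\<gamma>0}. winding_number \<gamma> w)" for w
    using fin \<gamma>0 by (simp add: sum.remove)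
  show "(\<Sum>\<gamma>\<in>\<Gamma>. winding_number \<gamma> w) = 1" if w: "w \<in> G"
  proof -
    have "(\<Sum>\<gamma>\<in>\<Gamma> - {\<gamma>0}. winding_number \<gamma> w) = 0"
      using hole(1) uniq w by (intro sum.neutral) (auto intro!: zero)
    moreover have "winding_number \<gamma>0 w = 1" using one \<gamma>0 w by (auto simp: outer_def)
    ultimately show ?thesis unfolding sum0 by simp
  qed
  show "(\<Sum>\<gamma>\<in>\<Gamma>. winding_number \<gamma> w) = 0" if w: "w \<notin> closure G"
  proof -
    have wf: "w \<notin> frontier G" "w \<notin> G" using w closure_subset by (auto simp: frontier_def)
    then have wS: "w \<notin> ?S \<gamma>" if "\<gamma> \<in> \<Gamma>" for \<gamma> using fr that by auto
    show ?thesis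
    proof (cases "w \<in> inside (?S \<gamma>0)")
      case False
      then have "w \<in> outside (?S \<gamma>)" if "\<gamma> \<in> \<Gamma>" for \<gamma>
        using in0 wS inout that by blast
      then show ?thesis by (intro sum.neutral) (auto intro!: zero)
    next
      case True
      obtain \<gamma> where \<gamma>: "\<gamma> \<in> \<Gamma>" "\<gamma> \<noteq> \<gamma>0" "w \<in> inside (?S \<gamma>)"
      proof -
        \<comment> \<open>A point inside the outer curve and in no hole is on the same side of every
          curve as \<open>a\<close>, so it would belong to \<open>G\<close>.\<close>
        have "\<exists>\<gamma>\<in>\<Gamma>. \<gamma> \<noteq> \<gamma>0 \<and> w \<in> inside (?S \<gamma>)"
        proof (rule ccontr)
          assume n: "\<not> ?thesis"
          have "w \<in> G"
          proof (rule char[OF wf(1)])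
            fix \<gamma> assume g: "\<gamma> \<in> \<Gamma>"
            show "a \<in> inside (?S \<gamma>) \<and> w \<in> inside (?S \<gamma>) \<or> a \<in> outside (?S \<gamma>) \<and> w \<in> outside (?S \<gamma>)"
            proof (cases "\<gamma> = \<gamma>0")
              case False
              then show ?thesis using n g hole(1) uniq a inout wS by blast
            qed (use True a \<gamma>0 in \<open>auto simp: outer_def\<close>)
          qed
          with wf show False by simp
        qed
        then show ?thesis using that by auto
      qed
      have "w \<in> outside (?S \<delta>)" if "\<delta> \<in> \<Gamma> - {\<gamma>0} - {\<gamma>}" for \<delta>
      proof -
        have "inside (?S \<gamma>) \<inter> inside (?S \<delta>) = {}"
          by (rule Jordan_disjoint_insides) (use \<gamma> that J hole_S[of \<gamma> \<delta>] hole_S[of \<delta> \<gamma>] uniq in auto)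
        then show ?thesis using \<gamma> that wS inout by blast
      qed
      then have "(\<Sum>\<gamma>\<in>\<Gamma> - {\<gamma>0} - {\<gamma>}. winding_number \<gamma> w) = 0"
        by (intro sum.neutral) (auto intro!: zero)
      moreover have "(\<Sum>\<gamma>\<in>\<Gamma> - {\<gamma>0}. winding_number \<gamma> w)
          = winding_number \<gamma> w + (\<Sum>\<gamma>\<in>\<Gamma> - {\<gamma>0} - {\<gamma>}. winding_number \<gamma> w)"
        using fin \<gamma> by (intro sum.remove) auto
      ultimately show ?thesis unfolding sum0
        using one \<gamma>0 True hole(2) \<gamma> uniq by simp
    qed
  qed
qed

section \<open>Regular closed curves\<close>

text \<open>The contour integral is expressed by the two-sided derivative \<open>at t\<close>, while
  the curves here are differentiable within \<open>{0..1}\<close>. Both derivatives agree except at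
  the end points, a null set.\<close>

lemma contour_integral_has_vector_derivative:
  assumes "\<And>t. t \<in> {0..1} \<Longrightarrow> (c has_vector_derivative c' t) (at t within {0..1})"
  shows "contour_integral c f = integral {0..1} (\<lambda>t. f (c t) * c' t)"
  unfolding contour_integral_integral
proof (rule integral_spike[of "{0,1}"])
  fix t :: real assume t: "t \<in> {0..1} - {0,1}"
  have "at t within {0..1} = at t" using t by (intro at_within_interior) auto
  then have "vector_derivative c (at t) = c' t"
    using assms[of t] t by (intro vector_derivative_at) auto
  then show "f (c t) * c' t = f (c t) * vector_derivative c (at t)" by simp
qed simp

section \<open>Local geometry of a regular closed curve\<close>

locale C1_Jordan_curve =
  fixes \<gamma> \<gamma>' :: "real \<Rightarrow> complex"
  assumes simple: "simple_path \<gamma>" and loop: "pathfinish \<gamma> = pathstart \<gamma>"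
    and deriv: "\<And>t. t \<in> {0..1} \<Longrightarrow> (\<gamma> has_vector_derivative \<gamma>' t) (at t within {0..1})"
    and cont_deriv: "continuous_on {0..1} \<gamma>'"
    and deriv_nz: "\<And>t. t \<in> {0..1} \<Longrightarrow> \<gamma>' t \<noteq> 0"
    and deriv_loop: "\<gamma>' 1 = \<gamma>' 0"
begin

lemma continuous: "continuous_on {0..1} \<gamma>"
  using simple simple_path_imp_path path_def by blast

lemma ends: "\<gamma> 1 = \<gamma> 0"
  using loop by (simp add: pathfinish_def pathstart_def)

lemma derivative_bounds:
  obtains m M where "0 < m" "\<And>t. t \<in> {0..1} \<Longrightarrow> m \<le> cmod (\<gamma>' t)" "\<And>t. t \<in> {0..1} \<Longrightarrow> cmod (\<gamma>' t) \<le> M"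
proof -
  have c: "continuous_on {0..1} (\<lambda>t. cmod (\<gamma>' t))" by (intro continuous_intros cont_deriv)
  obtain s where s: "s \<in> {0..1}" "\<forall>t\<in>{0..1}. cmod (\<gamma>' s) \<le> cmod (\<gamma>' t)"
    using continuous_attains_inf[OF _ _ c] by auto
  obtain u where "u \<in> {0..1}" "\<forall>t\<in>{0..1}. cmod (\<gamma>' t) \<le> cmod (\<gamma>' u)"
    using continuous_attains_sup[OF _ _ c] by auto
  then show ?thesis using s deriv_nz that[of "cmod (\<gamma>' s)" "cmod (\<gamma>' u)"] by auto
qed

lemma valid_path: "valid_path \<gamma>"
proof -
  have d: "(\<gamma> has_vector_derivative \<gamma>' t) (at t)" if "t \<in> {0..1} - {0,1}" for t
  proof -
    have "at t within {0..1} = at t" using that by (intro at_within_interior) auto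
    then show ?thesis using deriv[of t] that by auto
  qed
  have "\<gamma> C1_differentiable_on ({0..1} - {0,1})"
    unfolding C1_differentiable_on_def
    by (intro exI[of _ \<gamma>'] conjI ballI d continuous_on_subset[OF cont_deriv]) auto
  then show ?thesis
    unfolding valid_path_def piecewise_C1_differentiable_on_def
    by (intro conjI continuous exI[of _ "{0,1}"]) auto
qed

lemma contour_integral_eq: "contour_integral \<gamma> f = integral {0..1} (\<lambda>t. f (\<gamma> t) * \<gamma>' t)"
  by (rule contour_integral_has_vector_derivative[OF deriv])

text \<open>Uniform continuity of \<open>\<gamma>'\<close> on the compact interval gives one
  \<open>\<delta>\<close> for all base points; the second estimate is then the mean value inequality
  for \<open>\<gamma>\<close> minus its linear part.\<close>

lemma local_linearization:
  assumes "0 < \<kappa>"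
  obtains \<delta> where "0 < \<delta>"
    "\<And>s t. \<lbrakk>s \<in> {0..1}; t \<in> {0..1}; \<bar>s - t\<bar> < \<delta>\<rbrakk> \<Longrightarrow> cmod (\<gamma>' s - \<gamma>' t) \<le> \<kappa>"
    "\<And>s t. \<lbrakk>s \<in> {0..1}; t \<in> {0..1}; \<bar>s - t\<bar> < \<delta>\<rbrakk> \<Longrightarrow>
       cmod (\<gamma> s - \<gamma> t - of_real (s - t) * \<gamma>' t) \<le> \<kappa> * \<bar>s - t\<bar>"
proof -
  have "uniformly_continuous_on {0..1} \<gamma>'"
    by (rule compact_uniformly_continuous[OF cont_deriv]) auto
  then obtain \<delta> where \<delta>: "0 < \<delta>" "\<And>s t. \<lbrakk>s \<in> {0..1}; t \<in> {0..1}; dist s t < \<delta>\<rbrakk> \<Longrightarrow> dist (\<gamma>' s) (\<gamma>' t) < \<kappa>"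
    using assms unfolding uniformly_continuous_on_def by metis
  have "cmod (\<gamma> s - \<gamma> t - of_real (s - t) * \<gamma>' t) \<le> \<kappa> * \<bar>s - t\<bar>"
    if st: "s \<in> {0..1}" "t \<in> {0..1}" "\<bar>s - t\<bar> < \<delta>" for s t
  proof -
    have sub: "closed_segment t s \<subseteq> {0..1}" using st by (auto simp: closed_segment_eq_real_ivl)
    have "norm (\<gamma> s - \<gamma> t - (s - t) *\<^sub>R \<gamma>' t) \<le> norm (s - t) * \<kappa>"
    proof (rule vector_differentiable_bound_linearization[where S = "closed_segment t s"])
      fix x assume x: "x \<in> closed_segment t s"
      show "(\<gamma> has_vector_derivative \<gamma>' x) (at x within closed_segment t s)"
        using deriv[of x] sub x has_vector_derivative_within_subset by blast
    next
      fix x assume x: "x \<in> closed_segment t s"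
      show "norm (\<gamma>' x - \<gamma>' t) \<le> \<kappa>"
      proof -
        have "dist x t < \<delta>" using st x by (auto simp: dist_real_def closed_segment_eq_real_ivl split: if_splits)
        then show "norm (\<gamma>' x - \<gamma>' t) \<le> \<kappa>" using \<delta>(2)[of x t] x sub st by (auto simp: dist_norm)
      qed
    qed auto
    then show ?thesis by (simp add: scaleR_conv_of_real mult.commute)
  qed
  moreover have "cmod (\<gamma>' s - \<gamma>' t) \<le> \<kappa>" if "s \<in> {0..1}" "t \<in> {0..1}" "\<bar>s - t\<bar> < \<delta>" for s t
    using \<delta>(2)[of s t] that by (auto simp: dist_norm)
  ultimately show ?thesis using \<delta>(1) that by blast
qed

text \<open>The chord is almost tangential, also when it joins points on the two sides of the base point
  \<open>\<gamma> 0 = \<gamma> 1\<close>; then \<open>\<sigma> = s - t \<plusminus> 1\<close>.\<close>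

lemma chord_linearization:
  assumes \<kappa>: "0 < \<kappa>"
  obtains \<eta> where "0 < \<eta>"
    "\<And>s t. \<lbrakk>s \<in> {0..1}; t \<in> {0..1}; cmod (\<gamma> s - \<gamma> t) < \<eta>\<rbrakk> \<Longrightarrow>
       \<exists>\<sigma>. cmod (\<gamma> s - \<gamma> t - of_real \<sigma> * \<gamma>' t) \<le> \<kappa> * \<bar>\<sigma>\<bar>"
proof -
  obtain \<delta> where \<delta>: "0 < \<delta>"
    "\<And>s t. \<lbrakk>s \<in> {0..1}; t \<in> {0..1}; \<bar>s - t\<bar> < \<delta>\<rbrakk> \<Longrightarrow> cmod (\<gamma>' s - \<gamma>' t) \<le> \<kappa>/2"
    "\<And>s t. \<lbrakk>s \<in> {0..1}; t \<in> {0..1}; \<bar>s - t\<bar> < \<delta>\<rbrakk> \<Longrightarrow>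
       cmod (\<gamma> s - \<gamma> t - of_real (s - t) * \<gamma>' t) \<le> \<kappa>/2 * \<bar>s - t\<bar>"
    using local_linearization[of "\<kappa>/2"] \<kappa> by auto
  \<comment> \<open>Here \<open>s\<close> is near \<open>1\<close> and \<open>t\<close> near
    \<open>0\<close>: the two arcs are linearised separately at \<open>1\<close> and at
    \<open>0\<close>, where the points and the tangents coincide. As \<open>s - 1\<close> and
    \<open>- t\<close> have the same sign, the two errors add up to a multiple of
    \<open>\<bar>s - t - 1\<bar>\<close>.\<close>
  have wrap: "cmod (\<gamma> s - \<gamma> t - of_real (s - t - 1) * \<gamma>' 0) \<le> \<kappa>/2 * \<bar>s - t - 1\<bar>"
    if st: "s \<in> {0..1}" "t \<in> {0..1}" "s - t > 1 - \<delta>" for s t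
  proof -
    have "cmod (\<gamma> s - \<gamma> 1 - of_real (s - 1) * \<gamma>' 1) \<le> \<kappa>/2 * \<bar>s - 1\<bar>"
      "cmod (\<gamma> t - \<gamma> 0 - of_real (t - 0) * \<gamma>' 0) \<le> \<kappa>/2 * \<bar>t - 0\<bar>"
      using st by (intro \<delta>(3); force)+
    moreover have "\<gamma> s - \<gamma> t - of_real (s - t - 1) * \<gamma>' 0
      = (\<gamma> s - \<gamma> 1 - of_real (s - 1) * \<gamma>' 1) - (\<gamma> t - \<gamma> 0 - of_real (t - 0) * \<gamma>' 0)"
      unfolding deriv_loop ends by (simp add: algebra_simps)
    ultimately have "cmod (\<gamma> s - \<gamma> t - of_real (s - t - 1) * \<gamma>' 0) \<le> \<kappa>/2 * \<bar>s - 1\<bar> + \<kappa>/2 * \<bar>t - 0\<bar>"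
      by (metis norm_triangle_le_diff add_mono)
    also have "\<dots> = \<kappa>/2 * \<bar>s - t - 1\<bar>" using st by (simp add: abs_if algebra_simps)
    finally show ?thesis .
  qed
  \<comment> \<open>The parameter pairs that are far apart even when \<open>0\<close> and
    \<open>1\<close> are identified. The curve is injective there, so by compactness the chords have
    a positive minimal length \<open>\<eta>\<close>, and a shorter chord must fall under one of the
    linearised cases.\<close>
  define K where "K = ({0..1} \<times> {0..1}) \<inter> {p. \<delta> \<le> \<bar>fst p - snd p\<bar> \<and> \<bar>fst p - snd p\<bar> \<le> 1 - \<delta>}"
  have "compact K" unfolding K_def
    by (intro compact_Int_closed compact_Times closed_Collect_conj closed_Collect_le continuous_intros compact_Icc)
  have cont: "continuous_on K (\<lambda>p. cmod (\<gamma> (fst p) - \<gamma> (snd p)))"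
    unfolding K_def by (intro continuous_intros continuous_on_compose2[OF continuous]) auto
  have pos: "0 < cmod (\<gamma> (fst p) - \<gamma> (snd p))" if "p \<in> K" for p
    using simple that \<delta>(1) unfolding simple_path_def loop_free_def K_def by fastforce
  obtain \<eta> where \<eta>: "0 < \<eta>" "\<And>p. p \<in> K \<Longrightarrow> \<eta> \<le> cmod (\<gamma> (fst p) - \<gamma> (snd p))"
  proof (cases "K = {}")
    case True then show ?thesis using that[of 1] by auto
  next
    case False
    then obtain p0 where "p0 \<in> K" "\<forall>p\<in>K. cmod (\<gamma> (fst p0) - \<gamma> (snd p0)) \<le> cmod (\<gamma> (fst p) - \<gamma> (snd p))"
      using continuous_attains_inf[OF \<open>compact K\<close> _ cont] by auto
    then show ?thesis using pos that by blast
  qed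
  have "\<exists>\<sigma>. cmod (\<gamma> s - \<gamma> t - of_real \<sigma> * \<gamma>' t) \<le> \<kappa> * \<bar>\<sigma>\<bar>"
    if st: "s \<in> {0..1}" "t \<in> {0..1}" "cmod (\<gamma> s - \<gamma> t) < \<eta>" for s t
  proof -
    have "(s, t) \<notin> K" using \<eta>(2)[of "(s,t)"] st by auto
    then consider "\<bar>s - t\<bar> < \<delta>" | "s - t > 1 - \<delta>" | "t - s > 1 - \<delta>"
      using st unfolding K_def by fastforce
    then show ?thesis
    proof cases
      case 1
      then have "cmod (\<gamma> s - \<gamma> t - of_real (s - t) * \<gamma>' t) \<le> \<kappa>/2 * \<bar>s - t\<bar>" using \<delta> st by auto
      also have "\<dots> \<le> \<kappa> * \<bar>s - t\<bar>" using \<kappa> by (intro mult_right_mono) auto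
      finally show ?thesis by blast
    next
      case 2
      have b: "cmod (\<gamma> s - \<gamma> t - of_real (s - t - 1) * \<gamma>' 0) \<le> \<kappa>/2 * \<bar>s - t - 1\<bar>"
        using wrap st 2 by auto
      have c: "cmod (of_real (s - t - 1) * (\<gamma>' 0 - \<gamma>' t)) \<le> \<bar>s - t - 1\<bar> * (\<kappa>/2)"
        unfolding norm_mult norm_of_real using st 2 by (intro mult_left_mono \<delta>(2)) auto
      have "\<gamma> s - \<gamma> t - of_real (s - t - 1) * \<gamma>' t =
        (\<gamma> s - \<gamma> t - of_real (s - t - 1) * \<gamma>' 0) + of_real (s - t - 1) * (\<gamma>' 0 - \<gamma>' t)"
        by (simp add: algebra_simps)
      then have "cmod (\<gamma> s - \<gamma> t - of_real (s - t - 1) * \<gamma>' t) \<le> \<kappa>/2 * \<bar>s - t - 1\<bar> + \<bar>s - t - 1\<bar> * (\<kappa>/2)"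
        by (metis norm_triangle_le add_mono b c)
      then show ?thesis by (intro exI[of _ "s - t - 1"]) (simp add: field_simps)
    next
      case 3
      have b: "cmod (\<gamma> t - \<gamma> s - of_real (t - s - 1) * \<gamma>' 0) \<le> \<kappa>/2 * \<bar>t - s - 1\<bar>"
        using wrap st 3 by auto
      have c: "cmod (of_real (t - s - 1) * (\<gamma>' 1 - \<gamma>' t)) \<le> \<bar>t - s - 1\<bar> * (\<kappa>/2)"
        unfolding norm_mult norm_of_real using st 3 by (intro mult_left_mono \<delta>(2)) auto
      have "\<gamma> s - \<gamma> t - of_real (s - t + 1) * \<gamma>' t =
        - (\<gamma> t - \<gamma> s - of_real (t - s - 1) * \<gamma>' 0) - of_real (t - s - 1) * (\<gamma>' 1 - \<gamma>' t)"
        by (simp add: algebra_simps deriv_loop)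
      then have "cmod (\<gamma> s - \<gamma> t - of_real (s - t + 1) * \<gamma>' t) \<le> \<kappa>/2 * \<bar>t - s - 1\<bar> + \<bar>t - s - 1\<bar> * (\<kappa>/2)"
        by (metis norm_triangle_le_diff add_mono b c norm_minus_cancel)
      moreover have "\<bar>t - s - 1\<bar> = \<bar>s - t + 1\<bar>" by (simp add: abs_if)
      ultimately show ?thesis by (intro exI[of _ "s - t + 1"]) (simp add: field_simps)
    qed
  qed
  then show ?thesis using \<eta>(1) that by blast
qed

text \<open>A short chord is almost a real multiple \<open>\<sigma>\<close> of the tangent, while
  \<open>\<epsilon> * d\<close> is almost \<open>\<epsilon>\<close> times the normal. If they were
  equal, \<open>\<epsilon> * \<i> - \<sigma>\<close> would be small compared with its own real and
  imaginary parts.\<close>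

lemma transversal_off_curve:
  obtains \<kappa> \<epsilon>\<^sub>0 where "0 < \<kappa>" "0 < \<epsilon>\<^sub>0"
    "\<And>t d \<epsilon>. \<lbrakk>t \<in> {0..1}; cmod (d - \<i> * \<gamma>' t) \<le> \<kappa>; \<epsilon> \<noteq> 0; \<bar>\<epsilon>\<bar> \<le> \<epsilon>\<^sub>0\<rbrakk> \<Longrightarrow>
       \<gamma> t + of_real \<epsilon> * d \<notin> path_image \<gamma>"
proof -
  obtain m M where m: "0 < m" "\<And>t. t \<in> {0..1} \<Longrightarrow> m \<le> cmod (\<gamma>' t)" "\<And>t. t \<in> {0..1} \<Longrightarrow> cmod (\<gamma>' t) \<le> M"
    using derivative_bounds by blast
  \<comment> \<open>With this value both \<open>\<bar>\<epsilon>\<bar>\<close> and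
    \<open>\<bar>\<sigma>\<bar>\<close> turn out to be at most a quarter of their sum, which forces
    \<open>\<epsilon> = 0\<close>.\<close>
  define \<kappa> where "\<kappa> = m / 4"
  have \<kappa>: "0 < \<kappa>" using m by (simp add: \<kappa>_def)
  have M: "0 < M" using m(1) m(2)[of 0] m(3)[of 0] by auto
  obtain \<eta> where \<eta>: "0 < \<eta>"
    "\<And>s t. \<lbrakk>s \<in> {0..1}; t \<in> {0..1}; cmod (\<gamma> s - \<gamma> t) < \<eta>\<rbrakk> \<Longrightarrow>
       \<exists>\<sigma>. cmod (\<gamma> s - \<gamma> t - of_real \<sigma> * \<gamma>' t) \<le> \<kappa> * \<bar>\<sigma>\<bar>"
    using chord_linearization[OF \<kappa>] by blast
  \<comment> \<open>Keeps the displacement below \<open>\<eta> / 2\<close>, so that the chord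
    linearisation applies.\<close>
  define \<epsilon>\<^sub>0 where "\<epsilon>\<^sub>0 = \<eta> / (2 * (M + \<kappa>))"
  have \<epsilon>0: "0 < \<epsilon>\<^sub>0" using \<eta> M \<kappa> by (simp add: \<epsilon>\<^sub>0_def)
  have "\<gamma> t + of_real \<epsilon> * d \<notin> path_image \<gamma>"
    if t: "t \<in> {0..1}" and d: "cmod (d - \<i> * \<gamma>' t) \<le> \<kappa>" and \<epsilon>: "\<epsilon> \<noteq> 0" "\<bar>\<epsilon>\<bar> \<le> \<epsilon>\<^sub>0" for t d \<epsilon>
  proof
    assume "\<gamma> t + of_real \<epsilon> * d \<in> path_image \<gamma>"
    then obtain s where s: "s \<in> {0..1}" "\<gamma> s = \<gamma> t + of_real \<epsilon> * d" by (auto simp: path_image_def)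
    have "cmod d \<le> cmod (\<i> * \<gamma>' t) + \<kappa>" using d norm_triangle_sub[of d "\<i> * \<gamma>' t"] by linarith
    then have "cmod d \<le> M + \<kappa>" using m(3)[OF t] by (simp add: norm_mult)
    then have "\<bar>\<epsilon>\<bar> * cmod d \<le> \<epsilon>\<^sub>0 * (M + \<kappa>)" using \<epsilon> by (intro mult_mono) auto
    also have "\<dots> = \<eta> / 2"
    proof -
      have "M + \<kappa> \<noteq> 0" using M \<kappa> by simp
      then show ?thesis unfolding \<epsilon>\<^sub>0_def by (simp add: divide_simps)
    qed
    also have "\<dots> < \<eta>" using \<eta>(1) by simp
    finally have "cmod (\<gamma> s - \<gamma> t) < \<eta>" using s by (simp add: norm_mult)
    then obtain \<sigma> where \<sigma>: "cmod (\<gamma> s - \<gamma> t - of_real \<sigma> * \<gamma>' t) \<le> \<kappa> * \<bar>\<sigma>\<bar>" using \<eta>(2) s t by blast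
    have "(of_real \<epsilon> * \<i> - of_real \<sigma>) * \<gamma>' t = (\<gamma> s - \<gamma> t - of_real \<sigma> * \<gamma>' t) - of_real \<epsilon> * (d - \<i> * \<gamma>' t)"
      using s by (simp add: algebra_simps)
    then have "cmod ((of_real \<epsilon> * \<i> - of_real \<sigma>) * \<gamma>' t) \<le> \<kappa> * \<bar>\<sigma>\<bar> + \<bar>\<epsilon>\<bar> * \<kappa>"
      using \<sigma> d by (smt (verit) norm_triangle_ineq4 norm_mult norm_of_real mult_left_mono abs_ge_zero)
    also have "\<dots> = m * ((\<bar>\<epsilon>\<bar> + \<bar>\<sigma>\<bar>) / 4)" by (simp add: \<kappa>_def algebra_simps)
    also have "\<dots> \<le> cmod (\<gamma>' t) * ((\<bar>\<epsilon>\<bar> + \<bar>\<sigma>\<bar>) / 4)" by (intro mult_right_mono m t) auto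
    finally have "cmod (of_real \<epsilon> * \<i> - of_real \<sigma>) \<le> (\<bar>\<epsilon>\<bar> + \<bar>\<sigma>\<bar>) / 4"
      using deriv_nz[OF t] by (simp add: norm_mult)
    moreover have "\<bar>\<epsilon>\<bar> \<le> cmod (of_real \<epsilon> * \<i> - of_real \<sigma>)"
      using abs_Im_le_cmod[of "of_real \<epsilon> * \<i> - of_real \<sigma>"] by simp
    moreover have "\<bar>\<sigma>\<bar> \<le> cmod (of_real \<epsilon> * \<i> - of_real \<sigma>)"
      using abs_Re_le_cmod[of "of_real \<epsilon> * \<i> - of_real \<sigma>"] by simp
    moreover have "0 < \<bar>\<epsilon>\<bar>" using \<epsilon> by simp
    moreover have "0 \<le> \<bar>\<sigma>\<bar>" by simp
    ultimately show False by argo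
  qed
  then show ?thesis using \<kappa> \<epsilon>0 that by blast
qed

end

text \<open>For \<open>x\<close> in the right half plane the arguments of \<open>\<i> * x\<close>
  and \<open>- (\<i> * x)\<close> are \<open>Arg x + pi/2\<close> and \<open>Arg x - pi/2\<close>,
  both within the principal range. This is where the jump of the winding number originates.\<close>

lemma Ln_ii_diff:
  assumes "0 < Re x"
  shows "Ln (\<i> * x) - Ln (- (\<i> * x)) = \<i> * of_real pi"
proof -
  have nz: "x \<noteq> 0" using assms by auto
  have "Ln (\<i> * (- (\<i> * x))) = Ln (- (\<i> * x)) + \<i> * of_real pi / 2"
    using assms nz by (subst Ln_times_ii) auto
  moreover have "Ln (\<i> * x) = Ln x + \<i> * of_real pi / 2"
    using assms nz by (subst Ln_times_ii) auto
  moreover have "\<i> * (- (\<i> * x)) = x" by simp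
  ultimately have "Ln (\<i> * x) - Ln (- (\<i> * x)) = \<i> * of_real pi / 2 + \<i> * of_real pi / 2" by simp
  then show ?thesis by simp
qed

section \<open>The jump of the winding number across the curve\<close>

context C1_Jordan_curve
begin

text \<open>Near \<open>w\<close> the curve stays in a cone around its tangent, so that the difference of the two Cauchy
  kernels has there the primitive \<open>Ln (\<epsilon> + \<i> \<sigma>) - Ln (\<epsilon> - \<i> \<sigma>)\<close> with \<open>\<sigma> = (\<gamma> - w) / v\<close>;
  away from \<open>w\<close> the difference tends to \<open>0\<close>.\<close>

lemma winding_number_jump_tendsto:
  defines "w \<equiv> \<gamma> (1/2)" and "v \<equiv> \<gamma>' (1/2)"
  shows "((\<lambda>\<epsilon>. winding_number \<gamma> (w + of_real \<epsilon> * (\<i> * v)) - winding_number \<gamma> (w - of_real \<epsilon> * (\<i> * v)))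
    \<longlongrightarrow> 1) (at_right 0)"
proof -
  let ?p = "\<lambda>\<epsilon>. w + of_real \<epsilon> * (\<i> * v)" and ?m = "\<lambda>\<epsilon>. w - of_real \<epsilon> * (\<i> * v)"
  \<comment> \<open>The parameter \<open>1/2\<close> is interior, so an arc around \<open>w\<close>
    is parametrised without crossing the base point.\<close>
  have half: "1/2 \<in> {0..1::real}" by simp
  have v: "v \<noteq> 0" unfolding v_def by (rule deriv_nz) simp
  obtain m M where m: "0 < m" "\<And>t. t \<in> {0..1} \<Longrightarrow> m \<le> cmod (\<gamma>' t)" "\<And>t. t \<in> {0..1} \<Longrightarrow> cmod (\<gamma>' t) \<le> M"
    using derivative_bounds by blast
  obtain \<kappa> \<epsilon>0 where \<kappa>: "0 < \<kappa>" "0 < \<epsilon>0"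
    "\<And>t d \<epsilon>. \<lbrakk>t \<in> {0..1}; cmod (d - \<i> * \<gamma>' t) \<le> \<kappa>; \<epsilon> \<noteq> 0; \<bar>\<epsilon>\<bar> \<le> \<epsilon>0\<rbrakk> \<Longrightarrow>
       \<gamma> t + of_real \<epsilon> * d \<notin> path_image \<gamma>"
    using transversal_off_curve by blast
  have offp: "?p \<epsilon> \<notin> path_image \<gamma>" if "0 < \<epsilon>" "\<epsilon> \<le> \<epsilon>0" for \<epsilon>
    using \<kappa>(3)[of "1/2" "\<i> * v" \<epsilon>] that \<kappa>(1) by (simp add: w_def v_def)
  have offm: "?m \<epsilon> \<notin> path_image \<gamma>" if "0 < \<epsilon>" "\<epsilon> \<le> \<epsilon>0" for \<epsilon>
    using \<kappa>(3)[of "1/2" "\<i> * v" "- \<epsilon>"] that \<kappa>(1) by (simp add: w_def v_def)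
  \<comment> \<open>After division by \<open>v\<close> this tolerance makes
    \<open>Re (\<sigma> t)\<close> differ from \<open>t - 1/2\<close> by at most a quarter of
    \<open>\<bar>t - 1/2\<bar>\<close>, so that both have the same sign.\<close>
  have "0 < cmod v / 4" using v by simp
  then obtain \<delta> where \<delta>: "0 < \<delta>"
    "\<And>s t. \<lbrakk>s \<in> {0..1}; t \<in> {0..1}; \<bar>s - t\<bar> < \<delta>\<rbrakk> \<Longrightarrow>
       cmod (\<gamma> s - \<gamma> t - of_real (s - t) * \<gamma>' t) \<le> cmod v / 4 * \<bar>s - t\<bar>"
    using local_linearization by metis
  define \<eta> where "\<eta> = min (\<delta>/2) (1/4)"
  have \<eta>: "0 < \<eta>" "\<eta> < \<delta>" "\<eta> \<le> 1/4" using \<delta>(1) by (auto simp: \<eta>_def)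
  define a b where "a = 1/2 - \<eta>" and "b = 1/2 + \<eta>"
  have ab: "0 \<le> a" "a < 1/2" "1/2 < b" "b \<le> 1" "a \<le> b" using \<eta> by (auto simp: a_def b_def)
  define \<sigma> where "\<sigma> t = (\<gamma> t - w) / v" for t
  have \<sigma>: "cmod (\<sigma> t - of_real (t - 1/2)) \<le> \<bar>t - 1/2\<bar> / 4" if t: "t \<in> {a..b}" for t
  proof -
    have "cmod (\<gamma> t - \<gamma> (1/2) - of_real (t - 1/2) * \<gamma>' (1/2)) \<le> cmod v / 4 * \<bar>t - 1/2\<bar>"
      using t ab \<eta> by (intro \<delta>(2)) (auto simp: a_def b_def abs_if)
    moreover have "\<gamma> t - \<gamma> (1/2) - of_real (t - 1/2) * \<gamma>' (1/2) = v * (\<sigma> t - of_real (t - 1/2))"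
    proof -
      have "v * \<sigma> t = \<gamma> t - w" using v by (simp add: \<sigma>_def)
      then show ?thesis unfolding w_def[symmetric] v_def[symmetric] by (simp only: right_diff_distrib mult.commute)
    qed
    ultimately have "cmod v * cmod (\<sigma> t - of_real (t - 1/2)) \<le> cmod v * (\<bar>t - 1/2\<bar> / 4)"
      by (simp add: norm_mult)
    then show ?thesis using v by simp
  qed
  have Re\<sigma>: "\<bar>Re (\<sigma> t) - (t - 1/2)\<bar> \<le> \<bar>t - 1/2\<bar> / 4" if "t \<in> {a..b}" for t
    using \<sigma>[OF that] abs_Re_le_cmod[of "\<sigma> t - of_real (t - 1/2)"] by simp
  \<comment> \<open>Consequence for the logarithms: the imaginary part of
    \<open>\<epsilon> \<plusminus> \<i> * \<sigma> t\<close> vanishes only where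
    \<open>\<sigma> t = 0\<close>, and there the value is \<open>\<epsilon> > 0\<close>. So the
    branch cut is never met along the arc.\<close>
  have \<sigma>0: "\<sigma> t = 0" if "t \<in> {a..b}" "Re (\<sigma> t) = 0" for t
  proof -
    have "t = 1/2" using Re\<sigma>[OF that(1)] that(2) by (auto simp: abs_if split: if_splits)
    then show ?thesis unfolding \<sigma>_def w_def by (simp only: diff_self div_0)
  qed
  define g where "g \<epsilon> t = \<gamma>' t / (\<gamma> t - ?p \<epsilon>) - \<gamma>' t / (\<gamma> t - ?m \<epsilon>)" for \<epsilon> t
  have off: "\<gamma> t \<noteq> ?p \<epsilon>" "\<gamma> t \<noteq> ?m \<epsilon>"
    if "0 < \<epsilon>" "\<epsilon> \<le> \<epsilon>0" "t \<in> {0..1}" for \<epsilon> t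
    using offp[OF that(1,2)] offm[OF that(1,2)] that(3) unfolding path_image_def by (metis imageI)+
  have cont1: "continuous_on {0..1} (\<lambda>t. \<gamma>' t / (\<gamma> t - ?p \<epsilon>))"
    and cont2: "continuous_on {0..1} (\<lambda>t. \<gamma>' t / (\<gamma> t - ?m \<epsilon>))"
    if "0 < \<epsilon>" "\<epsilon> \<le> \<epsilon>0" for \<epsilon>
    using off[OF that] by (auto intro!: continuous_intros cont_deriv continuous)
  have intg: "g \<epsilon> integrable_on {0..1}" if "0 < \<epsilon>" "\<epsilon> \<le> \<epsilon>0" for \<epsilon>
    unfolding g_def by (intro integrable_diff integrable_continuous_interval cont1 cont2 that)
  have wn: "winding_number \<gamma> (?p \<epsilon>) - winding_number \<gamma> (?m \<epsilon>)
      = 1 / (2 * pi * \<i>) * (integral {0..a} (g \<epsilon>) + integral {a..b} (g \<epsilon>) + integral {b..1} (g \<epsilon>))"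
    if e: "0 < \<epsilon>" "\<epsilon> \<le> \<epsilon>0" for \<epsilon>
  proof -
    have "integral {0..1} (g \<epsilon>) = integral {0..1} (\<lambda>t. \<gamma>' t / (\<gamma> t - ?p \<epsilon>))
       - integral {0..1} (\<lambda>t. \<gamma>' t / (\<gamma> t - ?m \<epsilon>))"
      unfolding g_def by (intro integral_diff integrable_continuous_interval cont1 cont2 e)
    moreover have "integral {0..a} (g \<epsilon>) + integral {a..1} (g \<epsilon>) = integral {0..1} (g \<epsilon>)"
      using ab intg[OF e] by (intro Henstock_Kurzweil_Integration.integral_combine) auto
    moreover have "integral {a..b} (g \<epsilon>) + integral {b..1} (g \<epsilon>) = integral {a..1} (g \<epsilon>)"
      using ab integrable_on_subinterval[OF intg[OF e], of a 1]
      by (intro Henstock_Kurzweil_Integration.integral_combine) auto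
    ultimately show ?thesis
      by (simp add: winding_number_valid_path[OF valid_path] offp[OF e] offm[OF e] contour_integral_eq
          diff_divide_distrib add.assoc flip: right_diff_distrib)
  qed
  \<comment> \<open>On \<open>{p..q}\<close> the curve keeps a distance \<open>c\<close> from
    \<open>w\<close>. With \<open>A = \<gamma> t - w\<close> and poles at \<open>w + u\<close> and
    \<open>w - u\<close>, the difference of the kernels is
    \<open>2 * u / ((A - u) * (A + u))\<close> times \<open>\<gamma>' t\<close>, hence of order
    \<open>\<epsilon>\<close>.\<close>
  have far: "((\<lambda>\<epsilon>. integral {p..q} (g \<epsilon>)) \<longlongrightarrow> 0) (at_right 0)"
    if pq: "0 \<le> p" "p \<le> q" "q \<le> 1" "1/2 \<notin> {p..q}" for p q
  proof -
    have nz: "0 < cmod (\<gamma> t - w)" if t: "t \<in> {p..q}" for t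
    proof -
      have "t \<noteq> 1/2" "t \<in> {0..1}" using t pq by auto
      then have "\<gamma> t \<noteq> \<gamma> (1/2)"
        using simple half unfolding simple_path_def loop_free_def by fastforce
      then show ?thesis by (simp add: w_def)
    qed
    have "continuous_on {p..q} (\<lambda>t. cmod (\<gamma> t - w))"
      using pq by (intro continuous_intros continuous_on_subset[OF continuous]) auto
    then obtain t0 where "t0 \<in> {p..q}" "\<forall>t\<in>{p..q}. cmod (\<gamma> t0 - w) \<le> cmod (\<gamma> t - w)"
      using continuous_attains_inf[of "{p..q}" "\<lambda>t. cmod (\<gamma> t - w)"] pq(2) by auto
    then obtain c where c: "0 < c" "\<And>t. t \<in> {p..q} \<Longrightarrow> c \<le> cmod (\<gamma> t - w)"
      using nz by blast
    \<comment> \<open>Ensures \<open>cmod u \<le> c/2\<close>, so that both poles stay at distance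
      at least \<open>c/2\<close> from this part of the curve.\<close>
    define \<epsilon>1 where "\<epsilon>1 = min \<epsilon>0 (c / (2 * cmod v))"
    have \<epsilon>1: "0 < \<epsilon>1" using \<kappa> c v by (simp add: \<epsilon>1_def)
    have bnd: "norm (integral {p..q} (g \<epsilon>)) \<le> (M * (2 * (\<epsilon> * cmod v)) * (4 / c\<^sup>2)) * (q - p)"
      if e: "0 < \<epsilon>" "\<epsilon> < \<epsilon>1" for \<epsilon>
    proof (rule integral_bound[OF pq(2)])
      have e': "0 < \<epsilon>" "\<epsilon> \<le> \<epsilon>0" using e by (auto simp: \<epsilon>1_def)
      show "continuous_on {p..q} (g \<epsilon>)"
        unfolding g_def using pq
        by (intro continuous_on_diff continuous_on_subset[OF cont1[OF e']] continuous_on_subset[OF cont2[OF e']]) auto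
      fix t assume t: "t \<in> {p..q}"
      then have t01: "t \<in> {0..1}" using pq by auto
      define u where "u = of_real \<epsilon> * (\<i> * v)"
      define A where "A = \<gamma> t - w"
      have u: "cmod u = \<epsilon> * cmod v" using e by (simp add: u_def norm_mult)
      have "\<epsilon> * cmod v \<le> c / (2 * cmod v) * cmod v" using e by (intro mult_right_mono) (auto simp: \<epsilon>1_def)
      then have "cmod u \<le> c/2" using v u by simp
      then have A: "c/2 \<le> cmod (A - u)" "c/2 \<le> cmod (A + u)"
        using c(2)[OF t] norm_triangle_ineq2[of A u] norm_diff_ineq[of A u] by (auto simp: A_def)
      then have nz: "A - u \<noteq> 0" "A + u \<noteq> 0" using c(1) by auto
      have "g \<epsilon> t = \<gamma>' t / (A - u) - \<gamma>' t / (A + u)"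
        unfolding g_def u_def A_def by (simp add: algebra_simps)
      also have "\<dots> = \<gamma>' t * (2 * u) * (1 / ((A - u) * (A + u)))" using nz by (simp add: field_simps)
      finally have "cmod (g \<epsilon> t) = cmod (\<gamma>' t) * (2 * (\<epsilon> * cmod v)) * (1 / (cmod (A - u) * cmod (A + u)))"
        by (simp add: norm_mult norm_divide u)
      also have "\<dots> \<le> M * (2 * (\<epsilon> * cmod v)) * (1 / (c/2 * (c/2)))"
        using m(3)[OF t01] A c e by (intro mult_mono divide_left_mono mult_pos_pos mult_nonneg_nonneg) (auto intro: order_trans[OF norm_ge_zero])
      finally show "norm (g \<epsilon> t) \<le> M * (2 * (\<epsilon> * cmod v)) * (4 / c\<^sup>2)"
        by (simp add: power2_eq_square)
    qed
    show ?thesis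
    proof (rule Lim_null_comparison)
      show "\<forall>\<^sub>F \<epsilon> in at_right 0. norm (integral {p..q} (g \<epsilon>)) \<le> (M * (2 * (\<epsilon> * cmod v)) * (4 / c\<^sup>2)) * (q - p)"
        using eventually_at_right_real[OF \<epsilon>1] by eventually_elim (use bnd in auto)
      have "((\<lambda>\<epsilon>. (M * (2 * (\<epsilon> * cmod v)) * (4 / c\<^sup>2)) * (q - p)) \<longlongrightarrow> (M * (2 * (0 * cmod v)) * (4 / c\<^sup>2)) * (q - p)) (at_right 0)"
        by (intro tendsto_intros)
      then show "((\<lambda>\<epsilon>. (M * (2 * (\<epsilon> * cmod v)) * (4 / c\<^sup>2)) * (q - p)) \<longlongrightarrow> 0) (at_right 0)" by simp
    qed
  qed
  define L where "L \<epsilon> t = Ln (of_real \<epsilon> + \<i> * \<sigma> t) - Ln (of_real \<epsilon> - \<i> * \<sigma> t)" for \<epsilon> t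
  have arc: "integral {a..b} (g \<epsilon>) = L \<epsilon> b - L \<epsilon> a" if e: "0 < \<epsilon>" "\<epsilon> \<le> \<epsilon>0" for \<epsilon>
  proof (rule integral_unique, rule fundamental_theorem_of_calculus[OF ab(5)])
    fix t assume t: "t \<in> {a..b}"
    then have t01: "t \<in> {0..1}" using ab by auto
    have d\<gamma>: "(\<gamma> has_vector_derivative \<gamma>' t) (at t within {a..b})"
      using deriv[OF t01] ab by (auto intro: has_vector_derivative_within_subset)
    have "(of_real \<epsilon> + \<i> * \<sigma> t) \<notin> \<real>\<^sub>\<le>\<^sub>0"
      using \<sigma>0[OF t] e by (auto simp: complex_nonpos_Reals_iff)
    then have D1: "((Ln \<circ> (\<lambda>t. of_real \<epsilon> + \<i> * \<sigma> t)) has_vector_derivative (\<i> * (\<gamma>' t / v)) * inverse (of_real \<epsilon> + \<i> * \<sigma> t)) (at t within {a..b})"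
      unfolding \<sigma>_def using v
      by (intro field_vector_diff_chain_within) (auto intro!: derivative_eq_intros d\<gamma> has_field_derivative_at_within[OF has_field_derivative_Ln])
    have "(of_real \<epsilon> - \<i> * \<sigma> t) \<notin> \<real>\<^sub>\<le>\<^sub>0"
      using \<sigma>0[OF t] e by (auto simp: complex_nonpos_Reals_iff)
    then have D2: "((Ln \<circ> (\<lambda>t. of_real \<epsilon> - \<i> * \<sigma> t)) has_vector_derivative (- (\<i> * (\<gamma>' t / v))) * inverse (of_real \<epsilon> - \<i> * \<sigma> t)) (at t within {a..b})"
      unfolding \<sigma>_def using v
      by (intro field_vector_diff_chain_within) (auto intro!: derivative_eq_intros d\<gamma> has_field_derivative_at_within[OF has_field_derivative_Ln])
    have nz: "of_real \<epsilon> + \<i> * \<sigma> t \<noteq> 0" "of_real \<epsilon> - \<i> * \<sigma> t \<noteq> 0"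
      using \<open>(of_real \<epsilon> + \<i> * \<sigma> t) \<notin> \<real>\<^sub>\<le>\<^sub>0\<close> \<open>(of_real \<epsilon> - \<i> * \<sigma> t) \<notin> \<real>\<^sub>\<le>\<^sub>0\<close> by auto
    have e1: "\<gamma> t - ?p \<epsilon> = - \<i> * v * (of_real \<epsilon> + \<i> * \<sigma> t)"
      "\<gamma> t - ?m \<epsilon> = \<i> * v * (of_real \<epsilon> - \<i> * \<sigma> t)"
      unfolding \<sigma>_def using v by (simp_all add: field_simps)
    have "g \<epsilon> t = (\<i> * (\<gamma>' t / v)) * inverse (of_real \<epsilon> + \<i> * \<sigma> t) - (- (\<i> * (\<gamma>' t / v))) * inverse (of_real \<epsilon> - \<i> * \<sigma> t)"
      unfolding g_def e1 using nz v by (simp add: divide_simps) (simp add: algebra_simps)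
    then show "(L \<epsilon> has_vector_derivative g \<epsilon> t) (at t within {a..b})"
      using has_vector_derivative_diff[OF D1 D2] by (simp add: L_def[abs_def] o_def)
  qed
  have Llim: "((\<lambda>\<epsilon>. L \<epsilon> t) \<longlongrightarrow> Ln (\<i> * \<sigma> t) - Ln (- (\<i> * \<sigma> t))) (at_right 0)" if "Re (\<sigma> t) \<noteq> 0" for t
  proof -
    have n: "0 + \<i> * \<sigma> t \<notin> \<real>\<^sub>\<le>\<^sub>0" "0 - \<i> * \<sigma> t \<notin> \<real>\<^sub>\<le>\<^sub>0"
      using that by (auto simp: complex_nonpos_Reals_iff)
    have o: "((\<lambda>\<epsilon>. of_real \<epsilon>) \<longlongrightarrow> (0::complex)) (at_right 0)"
      using tendsto_of_real[of "\<lambda>x. x" 0 "at_right 0"] by simp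
    show ?thesis unfolding L_def
      using tendsto_diff[OF isCont_tendsto_compose[OF continuous_at_Ln[OF n(1)] tendsto_add[OF o tendsto_const]]
          isCont_tendsto_compose[OF continuous_at_Ln[OF n(2)] tendsto_diff[OF o tendsto_const]]]
      by simp
  qed
  have Reb: "0 < Re (\<sigma> b)" using Re\<sigma>[of b] ab by (auto simp: abs_if split: if_splits)
  have Rea: "0 < Re (- \<sigma> a)" using Re\<sigma>[of a] ab by (auto simp: abs_if split: if_splits)
  \<comment> \<open>\<open>\<sigma> b\<close> lies to the right and \<open>\<sigma> a\<close> to the
    left of the imaginary axis, so each end contributes \<open>\<i> * pi\<close> to the total
    \<open>2 * pi * \<i>\<close>.\<close>
  have "((\<lambda>\<epsilon>. L \<epsilon> b - L \<epsilon> a) \<longlongrightarrow> (Ln (\<i> * \<sigma> b) - Ln (- (\<i> * \<sigma> b))) - (Ln (\<i> * \<sigma> a) - Ln (- (\<i> * \<sigma> a)))) (at_right 0)"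
    using Rea Reb by (intro tendsto_diff[OF Llim Llim]) auto
  moreover have "Ln (\<i> * \<sigma> b) - Ln (- (\<i> * \<sigma> b)) = \<i> * of_real pi"
    by (rule Ln_ii_diff[OF Reb])
  moreover have "Ln (\<i> * \<sigma> a) - Ln (- (\<i> * \<sigma> a)) = - (\<i> * of_real pi)"
    using Ln_ii_diff[OF Rea] by (simp add: minus_equation_iff algebra_simps eq_diff_eq)
  ultimately have Lab: "((\<lambda>\<epsilon>. L \<epsilon> b - L \<epsilon> a) \<longlongrightarrow> 2 * pi * \<i>) (at_right 0)"
    by (simp add: mult.commute mult.left_commute)
  have "((\<lambda>\<epsilon>. 1 / (2 * pi * \<i>) * (integral {0..a} (g \<epsilon>) + (L \<epsilon> b - L \<epsilon> a) + integral {b..1} (g \<epsilon>)))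
     \<longlongrightarrow> 1 / (2 * pi * \<i>) * (0 + 2 * pi * \<i> + 0)) (at_right 0)"
    using ab by (intro tendsto_intros far Lab) auto
  then have lim: "((\<lambda>\<epsilon>. 1 / (2 * pi * \<i>) * (integral {0..a} (g \<epsilon>) + (L \<epsilon> b - L \<epsilon> a) + integral {b..1} (g \<epsilon>)))
     \<longlongrightarrow> 1) (at_right 0)" by simp
  show ?thesis
  proof (rule Lim_transform_eventually[OF lim])
    show "\<forall>\<^sub>F \<epsilon> in at_right 0. 1 / (2 * pi * \<i>) * (integral {0..a} (g \<epsilon>) + (L \<epsilon> b - L \<epsilon> a) + integral {b..1} (g \<epsilon>))
      = winding_number \<gamma> (?p \<epsilon>) - winding_number \<gamma> (?m \<epsilon>)"
      using eventually_at_right_real[OF \<kappa>(2)] by eventually_elim (simp add: wn arc)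
  qed
qed

text \<open>Near \<open>\<gamma> (1/2)\<close> take \<open>P\<close> on the left, which is in
  \<open>G\<close>, and \<open>Q\<close> on the right. Their winding numbers differ, so not both
  points are inside, where the winding number is constant, and not both outside, where it is
  \<open>0\<close>. If \<open>P\<close> is inside, the inner value is \<open>1\<close>; if
  \<open>Q\<close> is, the value is \<open>-1\<close>. Connectedness of \<open>G\<close> does the
  rest.\<close>

lemma left_side_winding_number:
  assumes G: "connected G" "G \<inter> path_image \<gamma> = {}"
    and left: "\<forall>\<^sub>F \<epsilon> in at_right 0. \<gamma> (1/2) + of_real \<epsilon> * (\<i> * \<gamma>' (1/2)) \<in> G"
  shows "G \<subseteq> inside (path_image \<gamma>) \<and> (\<forall>w\<in>inside (path_image \<gamma>). winding_number \<gamma> w = 1) \<or>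
         G \<subseteq> outside (path_image \<gamma>) \<and> (\<forall>w\<in>inside (path_image \<gamma>). winding_number \<gamma> w = - 1)"
proof -
  note J = Jordan_inside_outside[OF simple loop] and part = Jordan_partition[OF simple loop]
  obtain \<kappa> \<epsilon>0 where \<kappa>: "0 < \<kappa>" "0 < \<epsilon>0"
    "\<And>t d \<epsilon>. \<lbrakk>t \<in> {0..1}; cmod (d - \<i> * \<gamma>' t) \<le> \<kappa>; \<epsilon> \<noteq> 0; \<bar>\<epsilon>\<bar> \<le> \<epsilon>0\<rbrakk> \<Longrightarrow>
       \<gamma> t + of_real \<epsilon> * d \<notin> path_image \<gamma>"
    using transversal_off_curve by blast
  define P where "P \<epsilon> = \<gamma> (1/2) + of_real \<epsilon> * (\<i> * \<gamma>' (1/2))" for \<epsilon>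
  define Q where "Q \<epsilon> = \<gamma> (1/2) - of_real \<epsilon> * (\<i> * \<gamma>' (1/2))" for \<epsilon>
  have "\<forall>\<^sub>F \<epsilon> in at_right 0. dist (winding_number \<gamma> (P \<epsilon>) - winding_number \<gamma> (Q \<epsilon>)) 1 < 1"
    using tendstoD[OF winding_number_jump_tendsto, of 1] unfolding P_def Q_def by simp
  then have "\<forall>\<^sub>F \<epsilon> in at_right 0. dist (winding_number \<gamma> (P \<epsilon>) - winding_number \<gamma> (Q \<epsilon>)) 1 < 1 \<and> P \<epsilon> \<in> G \<and> \<epsilon> \<in> {0<..<\<epsilon>0}"
    using left eventually_at_right_real[OF \<kappa>(2)] unfolding P_def by (intro eventually_conj)
  then obtain \<epsilon> where e: "dist (winding_number \<gamma> (P \<epsilon>) - winding_number \<gamma> (Q \<epsilon>)) 1 < 1" "P \<epsilon> \<in> G" "0 < \<epsilon>" "\<epsilon> < \<epsilon>0"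
    using eventually_happens'[OF trivial_limit_at_right_real] by fastforce
  have offP: "P \<epsilon> \<notin> path_image \<gamma>"
    using \<kappa>(3)[of "1/2" "\<i> * \<gamma>' (1/2)" \<epsilon>] e \<kappa>(1) by (simp add: P_def)
  have offQ: "Q \<epsilon> \<notin> path_image \<gamma>"
    using \<kappa>(3)[of "1/2" "\<i> * \<gamma>' (1/2)" "- \<epsilon>"] e \<kappa>(1) by (simp add: Q_def)
  have cP: "winding_number \<gamma> (P \<epsilon>) \<in> {-1,0,1}" "winding_number \<gamma> (Q \<epsilon>) \<in> {-1,0,1}"
    using simple_closed_path_winding_number_cases[OF simple loop] offP offQ by blast+
  \<comment> \<open>The difference is an integer at distance less than \<open>1\<close> from
    \<open>1\<close>.\<close>
  have jump: "winding_number \<gamma> (P \<epsilon>) - winding_number \<gamma> (Q \<epsilon>) = 1"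
    using e(1) cP by (auto simp: dist_norm)
  have const: "winding_number \<gamma> x = winding_number \<gamma> y"
    if "x \<in> inside (path_image \<gamma>)" "y \<in> inside (path_image \<gamma>)" for x y
    using winding_number_constant[OF simple_path_imp_path[OF simple] loop, of "inside (path_image \<gamma>)"] J part(2) that
    unfolding constant_on_def by metis
  have zero: "winding_number \<gamma> x = 0" if "x \<in> outside (path_image \<gamma>)" for x
    using that by (intro winding_number_zero_in_outside simple_path_imp_path simple loop)
  have "G \<subseteq> inside (path_image \<gamma>) \<union> outside (path_image \<gamma>)" using G(2) part(4) by blast
  then have GG: "inside (path_image \<gamma>) \<inter> G = {} \<or> outside (path_image \<gamma>) \<inter> G = {}"
    using J part(1) by (intro connectedD[OF G(1)]) auto
  show ?thesis
  proof (cases "P \<epsilon> \<in> inside (path_image \<gamma>)")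
    case True
    have "Q \<epsilon> \<notin> inside (path_image \<gamma>)" using jump const[OF True, of "Q \<epsilon>"] by auto
    then have "winding_number \<gamma> (Q \<epsilon>) = 0" using zero part(4)[of "Q \<epsilon>"] offQ by blast
    then have "winding_number \<gamma> (P \<epsilon>) = 1" using jump by simp
    then have "\<forall>w\<in>inside (path_image \<gamma>). winding_number \<gamma> w = 1" using const[OF _ True] by auto
    moreover have "G \<subseteq> inside (path_image \<gamma>)"
      using GG True e(2) \<open>G \<subseteq> inside (path_image \<gamma>) \<union> outside (path_image \<gamma>)\<close> by blast
    ultimately show ?thesis by blast
  next
    case False
    then have Po: "P \<epsilon> \<in> outside (path_image \<gamma>)" using part(4)[of "P \<epsilon>"] offP by blast
    then have Q1: "winding_number \<gamma> (Q \<epsilon>) = -1" using jump zero[OF Po] by (simp add: minus_equation_iff)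
    then have "Q \<epsilon> \<in> inside (path_image \<gamma>)" using zero[of "Q \<epsilon>"] part(4)[of "Q \<epsilon>"] offQ by fastforce
    then have "\<forall>w\<in>inside (path_image \<gamma>). winding_number \<gamma> w = -1" using const Q1 by metis
    moreover have "G \<subseteq> outside (path_image \<gamma>)"
      using GG Po e(2) \<open>G \<subseteq> inside (path_image \<gamma>) \<union> outside (path_image \<gamma>)\<close> by blast
    ultimately show ?thesis by blast
  qed
qed

end

section \<open>Smooth functions on the plane\<close>

lemma Ck_SucI:
  assumes "\<And>z. (f has_derivative D z) (at z)" "\<And>v. Ck k (\<lambda>z. D z v)"
  shows "Ck (Suc k) f"
proof -
  have "frechet_derivative f (at z) = D z" for z
    using frechet_derivative_at[OF assms(1)] by simp
  then show ?thesis using assms by (auto simp: differentiable_def)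
qed

lemma Ck_Suc_has_derivative:
  "Ck (Suc k) f \<Longrightarrow> (f has_derivative frechet_derivative f (at z)) (at z)"
  by (simp add: frechet_derivative_works)

lemma Ck_Suc_imp_Ck: "Ck (Suc k) f \<Longrightarrow> Ck k f"
proof (induction k arbitrary: f)
  case 0
  then show ?case
    by (auto intro: continuous_at_imp_continuous_on differentiable_imp_continuous_within)
qed simp

lemma Ck_const: "Ck k (\<lambda>z. c)"
proof (induction k arbitrary: c)
  case (Suc k)
  show ?case by (rule Ck_SucI[of _ "\<lambda>z v. 0"]) (auto intro: derivative_eq_intros Suc)
qed simp

lemma Ck_bounded_linear_compose:
  assumes L: "bounded_linear L" and "Ck k f"
  shows "Ck k (\<lambda>z. L (f z))"
  using assms(2)
proof (induction k arbitrary: f)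
  case 0
  then show ?case
    using L by (auto intro: continuous_on_compose2 linear_continuous_on)
next
  case (Suc k)
  show ?case
  proof (rule Ck_SucI)
    show "((\<lambda>z. L (f z)) has_derivative (\<lambda>v. L (frechet_derivative f (at z) v))) (at z)" for z
      using bounded_linear.has_derivative[OF L Ck_Suc_has_derivative[OF Suc.prems]] .
  qed (use Suc in auto)
qed

lemma Ck_id: "Ck k (\<lambda>z. z)"
proof (cases k)
  case (Suc n)
  show ?thesis unfolding Suc by (rule Ck_SucI[of _ "\<lambda>z v. v"]) (auto intro: Ck_const)
qed (auto intro: continuous_intros)

lemma Ck_add: "Ck k f \<Longrightarrow> Ck k g \<Longrightarrow> Ck k (\<lambda>z. f z + g z)"
proof (induction k arbitrary: f g)
  case (Suc k)
  show ?case
    by (rule Ck_SucI[OF has_derivative_add[OF Ck_Suc_has_derivative[OF Suc.prems(1)] Ck_Suc_has_derivative[OF Suc.prems(2)]]])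
       (use Suc in auto)
qed (auto intro: continuous_intros)

lemma Ck_mult: "Ck k f \<Longrightarrow> Ck k g \<Longrightarrow> Ck k (\<lambda>z. f z * g z)"
proof (induction k arbitrary: f g)
  case (Suc k)
  show ?case
    by (rule Ck_SucI[OF has_derivative_mult[OF Ck_Suc_has_derivative[OF Suc.prems(1)] Ck_Suc_has_derivative[OF Suc.prems(2)]]])
       (intro Ck_add Suc.IH; use Suc.prems Ck_Suc_imp_Ck in auto)
qed (auto intro: continuous_intros)

lemma Ck_inverse: "Ck k f \<Longrightarrow> (\<And>z. f z \<noteq> 0) \<Longrightarrow> Ck k (\<lambda>z. inverse (f z))"
proof (induction k arbitrary: f)
  case (Suc k)
  have "Ck k (\<lambda>z. inverse (f z))" using Suc Ck_Suc_imp_Ck by blast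
  moreover have "Ck k (\<lambda>z. - frechet_derivative f (at z) v)" for v
    using Suc.prems by (intro Ck_bounded_linear_compose[OF bounded_linear_minus[OF bounded_linear_ident]]) auto
  ultimately have *: "Ck k (\<lambda>z. inverse (f z) * (- frechet_derivative f (at z) v) * inverse (f z))" for v
    by (intro Ck_mult)
  show ?case
    by (rule Ck_SucI[OF Deriv.has_derivative_inverse[OF Suc.prems(2) Ck_Suc_has_derivative[OF Suc.prems(1)]]])
       (use * in simp)
qed (auto intro: continuous_intros)

lemmas Ck_cnj = Ck_bounded_linear_compose[OF bounded_linear_cnj]

lemma Ck_Re: "Ck k f \<Longrightarrow> Ck k (\<lambda>z. of_real (Re (f z)))"
  by (rule Ck_bounded_linear_compose[of "\<lambda>z. of_real (Re z)"])
     (intro bounded_linear_compose[OF bounded_linear_of_real bounded_linear_Re])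

text \<open>This family of functions, flat at \<open>0\<close>, is closed under differentiation.\<close>

definition flat :: "real poly \<Rightarrow> real \<Rightarrow> real" where
  "flat p t = (if t > 0 then poly p (1/t) * exp (- 1/t) else 0)"

lemma poly_times_exp_tendsto_0: "((\<lambda>x::real. poly p x * exp (- x)) \<longlongrightarrow> 0) at_top"
proof -
  have "((\<lambda>x. \<Sum>i\<le>degree p. coeff p i * (x ^ i / exp x)) \<longlongrightarrow> (\<Sum>i\<le>degree p. coeff p i * 0)) at_top"
    by (intro tendsto_intros tendsto_power_div_exp_0)
  then show ?thesis by (simp add: poly_altdef sum_divide_distrib exp_minus field_simps)
qed

text \<open>With \<open>x = 1/t\<close> and \<open>dx/dt = - x^2\<close>, the derivative of
  \<open>p(x) * exp (- x)\<close> is \<open>x^2 * (p(x) - p'(x)) * exp (- x)\<close>; the polynomial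
  \<open>[:0,0,1:]\<close> is \<open>x^2\<close>. At \<open>0\<close> the right difference quotient
  is \<open>x * p(x) * exp (- x)\<close>, which tends to \<open>0\<close> as \<open>x\<close> tends
  to infinity.\<close>

lemma has_real_derivative_flat:
  "(flat p has_real_derivative flat ([:0,0,1:] * (p - pderiv p)) t) (at t)"
proof -
  let ?q = "flat ([:0,0,1:] * (p - pderiv p))"
  consider "t > 0" | "t < 0" | "t = 0" by linarith
  then show ?thesis
  proof cases
    case 1
    have "((\<lambda>t. poly p (1/t) * exp (- 1/t)) has_real_derivative ?q t) (at t)"
      using 1 by (auto intro!: derivative_eq_intros DERIV_chain'[where g = "poly p"] poly_DERIV
          simp: flat_def field_simps power2_eq_square)
    then show ?thesis
      by (rule has_field_derivative_transform_within_open[where S = "{0<..}"]) (use 1 in \<open>auto simp: flat_def\<close>)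
  next
    case 2
    have "((\<lambda>t. 0) has_real_derivative ?q t) (at t)"
      using 2 by (simp add: flat_def)
    then show ?thesis
      by (rule has_field_derivative_transform_within_open[where S = "{..<0}"]) (use 2 in \<open>auto simp: flat_def\<close>)
  next
    case 3
    have "((\<lambda>h. flat p h / h) \<longlongrightarrow> 0) (at_right 0)"
    proof (rule Lim_transform_eventually)
      show "((\<lambda>h::real. poly ([:0,1:] * p) (inverse h) * exp (- inverse h)) \<longlongrightarrow> 0) (at_right 0)"
        by (rule filterlim_compose[OF poly_times_exp_tendsto_0 filterlim_inverse_at_top_right])
      show "\<forall>\<^sub>F h in at_right 0. poly ([:0,1:] * p) (inverse h) * exp (- inverse h) = flat p h / h"
        using eventually_at_right_less[of 0] by eventually_elim (simp add: flat_def field_simps)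
    qed
    moreover have "((\<lambda>h. flat p h / h) \<longlongrightarrow> 0) (at_left 0)"
    proof (rule Lim_transform_eventually)
      show "((\<lambda>h::real. 0::real) \<longlongrightarrow> 0) (at_left 0)" by simp
      have "\<forall>\<^sub>F h in at_left (0::real). h < 0" by (simp add: eventually_at_filter)
      then show "\<forall>\<^sub>F h in at_left 0. 0 = flat p h / h" by eventually_elim (simp add: flat_def)
    qed
    ultimately have "((\<lambda>h. flat p h / h) \<longlongrightarrow> 0) (at 0)" by (simp add: filterlim_split_at)
    then show ?thesis using 3 by (simp add: DERIV_def flat_def)
  qed
qed

text \<open>The induction runs over all \<open>p\<close> at once, since each differentiation
  replaces \<open>p\<close> by another polynomial and multiplies by a derivative of
  \<open>s\<close>.\<close>

lemma Ck_flat_compose: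
  assumes "\<And>k. Ck k (\<lambda>z. of_real (s z))"
  shows "Ck k (\<lambda>z. of_real (flat p (s z)))"
proof (induction k arbitrary: p)
  let ?d = "\<lambda>z v. frechet_derivative (\<lambda>z. complex_of_real (s z)) (at z) v" and ?q = "\<lambda>p. flat ([:0,0,1:] * (p - pderiv p))"
  \<comment> \<open>\<open>Ck\<close> speaks of complex-valued functions, so the derivative of the
    real function \<open>s\<close> is recovered as the real part of the derivative of its
    embedding.\<close>
  have ds: "(s has_derivative (\<lambda>v. Re (?d z v))) (at z)" for z
    using bounded_linear.has_derivative[OF bounded_linear_Re Ck_Suc_has_derivative[OF assms]] by simp
  have d: "((\<lambda>z. complex_of_real (flat p (s z))) has_derivative
      (\<lambda>v. of_real (?q p (s z))
         * of_real (Re (?d z v)))) (at z)" for p z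
    using bounded_linear.has_derivative[OF bounded_linear_of_real
        has_derivative_compose[OF ds has_real_derivative_flat[unfolded has_field_derivative_def]]]
    by simp
  {
    case 0
    show ?case unfolding Ck.simps
      by (rule continuous_at_imp_continuous_on) (use has_derivative_continuous[OF d[of p]] in blast)
  next
    case (Suc k)
    show ?case
    proof (rule Ck_SucI[OF d])
      fix v
      have "Ck k (\<lambda>z. ?d z v)"
        using assms[of "Suc k"] by simp
      then show "Ck k (\<lambda>z. of_real (?q p (s z))
         * of_real (Re (?d z v)))"
        by (intro Ck_mult Ck_Re Suc)
    qed
  }
qed

lemma Ck_norm_square: "Ck k (\<lambda>z. of_real ((cmod (z - z0))\<^sup>2))"
proof -
  have "Ck k (\<lambda>z. (z + - z0) * cnj (z + - z0))"
    by (intro Ck_mult Ck_cnj Ck_add Ck_const Ck_id)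
  then show ?thesis by (simp only: complex_norm_square diff_conv_add_uminus)
qed

text \<open>The quotient \<open>f(s) / (f(s) + f(t))\<close> with \<open>f = flat 1\<close>:
  \<open>s\<close> is positive exactly inside radius \<open>r\<close> and \<open>t\<close> exactly
  outside radius \<open>r/2\<close>, so the denominator never vanishes. Squared distances are taken
  because they are smooth at the centre too.\<close>

lemma smooth_bump:
  assumes r: "0 < r"
  obtains \<psi> where "\<And>k. Ck k \<psi>" "\<And>z. z \<in> cball z0 (r/2) \<Longrightarrow> \<psi> z = 1" "\<And>z. z \<notin> cball z0 r \<Longrightarrow> \<psi> z = 0"
proof -
  define s t where "s z = r\<^sup>2 - (cmod (z - z0))\<^sup>2" and "t z = (cmod (z - z0))\<^sup>2 - (r/2)\<^sup>2" for z
  define \<psi> where "\<psi> z = complex_of_real (flat 1 (s z)) * inverse (of_real (flat 1 (s z)) + of_real (flat 1 (t z)))" for z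
  have pos: "0 < flat 1 (s z) \<or> 0 < flat 1 (t z)" for z
  proof -
    have "(r/2)\<^sup>2 < r\<^sup>2" using r by (simp add: power2_eq_square)
    then have "0 < s z \<or> 0 < t z" unfolding s_def t_def by linarith
    then show ?thesis by (auto simp: flat_def)
  qed
  have nn: "0 \<le> flat 1 x" for x by (simp add: flat_def)
  have nz: "complex_of_real (flat 1 (s z)) + of_real (flat 1 (t z)) \<noteq> 0" for z
    using pos[of z] nn[of "s z"] nn[of "t z"]
    by (metis add_nonneg_eq_0_iff less_irrefl of_real_add of_real_eq_0_iff)
  have Cs: "Ck k (\<lambda>z. of_real (s z))" for k
  proof -
    have "Ck k (\<lambda>z. of_real (r\<^sup>2) + - 1 * of_real ((cmod (z - z0))\<^sup>2))"
      by (intro Ck_add Ck_mult Ck_const Ck_norm_square)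
    then show ?thesis by (simp add: s_def)
  qed
  have Ct: "Ck k (\<lambda>z. of_real (t z))" for k
  proof -
    have "Ck k (\<lambda>z. of_real ((cmod (z - z0))\<^sup>2) + - of_real ((r/2)\<^sup>2))"
      by (intro Ck_add Ck_const Ck_norm_square)
    then show ?thesis by (simp add: t_def)
  qed
  have "Ck k \<psi>" for k
    unfolding \<psi>_def by (intro Ck_mult Ck_inverse Ck_add Ck_flat_compose Cs Ct nz)
  moreover have "\<psi> z = 1" if "z \<in> cball z0 (r/2)" for z
  proof -
    have "(cmod (z - z0))\<^sup>2 \<le> (r/2)\<^sup>2" using that by (intro power_mono) (auto simp: dist_norm norm_minus_commute)
    then have "flat 1 (t z) = 0" by (simp add: t_def flat_def)
    then show ?thesis using nz[of z] by (simp add: \<psi>_def)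
  qed
  moreover have "\<psi> z = 0" if "z \<notin> cball z0 r" for z
  proof -
    have "r\<^sup>2 \<le> (cmod (z - z0))\<^sup>2" using that r by (intro power_mono) (auto simp: dist_norm norm_minus_commute)
    then show ?thesis by (simp add: \<psi>_def s_def flat_def)
  qed
  ultimately show ?thesis using that by blast
qed

section \<open>The Wirtinger derivative and the regularised Cauchy kernel\<close>

definition dbar :: "(complex \<Rightarrow> complex) \<Rightarrow> complex \<Rightarrow> complex" where
  "dbar f z = (frechet_derivative f (at z) 1 + \<i> * frechet_derivative f (at z) \<i>) / 2"

lemma dbar_eq:
  assumes "(f has_derivative D) (at z)"
  shows "dbar f z = (D 1 + \<i> * D \<i>) / 2"
  using frechet_derivative_at[OF assms] by (simp add: dbar_def)

lemma dbar_mult: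
  assumes "Ck 1 f" "Ck 1 g"
  shows "dbar (\<lambda>z. f z * g z) z = f z * dbar g z + dbar f z * g z"
proof -
  have "dbar (\<lambda>z. f z * g z) z = ((f z * frechet_derivative g (at z) 1 + frechet_derivative f (at z) 1 * g z)
     + \<i> * (f z * frechet_derivative g (at z) \<i> + frechet_derivative f (at z) \<i> * g z)) / 2"
    using assms by (intro dbar_eq has_derivative_mult) (auto simp: frechet_derivative_works)
  then show ?thesis
    by (rule trans) (simp add: dbar_def add_divide_distrib algebra_simps)
qed

lemma continuous_on_dbar: "Ck 1 f \<Longrightarrow> continuous_on UNIV (dbar f)"
  unfolding dbar_def by (intro continuous_intros) auto

lemma frechet_derivative_eq_0_off_support:
  assumes "compact K" "\<And>z. z \<notin> K \<Longrightarrow> f z = (0::complex)" "z \<notin> (K::complex set)"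
  shows "frechet_derivative f (at z) v = 0"
proof -
  have "((\<lambda>z. 0::complex) has_derivative (\<lambda>v. 0)) (at z)" by (rule has_derivative_const)
  then have "(f has_derivative (\<lambda>v. 0)) (at z)"
    by (rule has_derivative_transform_within_open[where s = "- K"])
       (use assms compact_imp_closed in auto)
  from frechet_derivative_at[OF this] show ?thesis by metis
qed

text \<open>A smooth regularisation of \<open>1 / z\<close>, whose \<open>dbar\<close> is \<open>pi\<close> times an approximate identity.\<close>

definition cauchy_reg :: "real \<Rightarrow> complex \<Rightarrow> complex" where
  "cauchy_reg \<delta> z = cnj z * inverse (z * cnj z + of_real (\<delta>\<^sup>2))"

lemma cauchy_reg_denom: "z * cnj z + of_real (\<delta>\<^sup>2) = of_real ((cmod z)\<^sup>2 + \<delta>\<^sup>2)"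
  by (simp add: complex_norm_square[symmetric])

lemma cauchy_reg_denom_nz: "\<delta> \<noteq> 0 \<Longrightarrow> z * cnj z + of_real (\<delta>\<^sup>2) \<noteq> 0"
  unfolding cauchy_reg_denom of_real_eq_0_iff by (metis sum_power2_eq_zero_iff)

lemma Ck_cauchy_reg: "\<delta> \<noteq> 0 \<Longrightarrow> Ck k (\<lambda>\<zeta>. cauchy_reg \<delta> (\<zeta> + - z))"
  unfolding cauchy_reg_def
  by (intro Ck_mult Ck_inverse Ck_add Ck_cnj Ck_id Ck_const cauchy_reg_denom_nz)

lemma dbar_cauchy_reg:
  assumes \<delta>: "\<delta> \<noteq> 0"
  shows "dbar (\<lambda>\<zeta>. cauchy_reg \<delta> (\<zeta> + - z)) \<zeta> = of_real (\<delta>\<^sup>2 / ((cmod (\<zeta> - z))\<^sup>2 + \<delta>\<^sup>2)\<^sup>2)"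
proof -
  define x where "x = \<zeta> + - z"
  define Q where "Q = x * cnj x + of_real (\<delta>\<^sup>2)"
  have Q: "Q \<noteq> 0" unfolding Q_def by (rule cauchy_reg_denom_nz[OF \<delta>])
  define D where "D h = cnj x * - (inverse Q * (x * cnj h + h * cnj x) * inverse Q) + cnj h * inverse Q" for h
  have "((\<lambda>\<zeta>. cauchy_reg \<delta> (\<zeta> + - z)) has_derivative D) (at \<zeta>)"
    unfolding cauchy_reg_def D_def[abs_def] x_def Q_def
    using cauchy_reg_denom_nz[OF \<delta>, of "\<zeta> + - z"]
    by (auto intro!: derivative_eq_intros bounded_linear.has_derivative[OF bounded_linear_cnj])
  from dbar_eq[OF this] have "dbar (\<lambda>\<zeta>. cauchy_reg \<delta> (\<zeta> + - z)) \<zeta> = (D 1 + \<i> * D \<i>) / 2" .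
  \<comment> \<open>In this combination the terms linear in \<open>h\<close> cancel and those linear
    in \<open>cnj h\<close> double.\<close>
  moreover have "D 1 + \<i> * D \<i> = 2 * (inverse Q - x * cnj x * inverse Q * inverse Q)"
    by (simp add: D_def algebra_simps)
  ultimately have "dbar (\<lambda>\<zeta>. cauchy_reg \<delta> (\<zeta> + - z)) \<zeta> = inverse Q - x * cnj x * inverse Q * inverse Q"
    by (metis nonzero_mult_div_cancel_left zero_neq_numeral)
  also have "\<dots> = (Q - x * cnj x) / Q\<^sup>2" using Q by (simp add: field_simps power2_eq_square)
  also have "\<dots> = of_real (\<delta>\<^sup>2) / Q\<^sup>2" by (simp add: Q_def)
  also have "Q = of_real ((cmod x)\<^sup>2 + \<delta>\<^sup>2)" unfolding Q_def by (rule cauchy_reg_denom)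
  finally show ?thesis by (simp add: x_def)
qed

section \<open>Radial integrals in the plane\<close>

lemma emeasure_lborel_cball_complex:
  "0 \<le> r \<Longrightarrow> emeasure lborel (cball (z::complex) r) = ennreal (pi * r\<^sup>2)"
  by (simp add: emeasure_cball unit_ball_vol_2)

text \<open>Layer-cake: \<open>F (cmod (x - z))\<close> is the integral of \<open>g s\<close> over \<open>s \<ge> cmod (x - z)\<close>.\<close>

lemma nn_integral_radial:
  fixes F g :: "real \<Rightarrow> real" and z :: complex
  assumes [measurable]: "g \<in> borel_measurable borel" "S \<in> sets borel"
    and DERIV: "\<And>x. 0 < x \<Longrightarrow> (F has_real_derivative - g x) (at x)"
    and pos: "\<And>x. 0 < x \<Longrightarrow> 0 \<le> g x" and lim: "(F \<longlongrightarrow> 0) at_top"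
  shows "(\<integral>\<^sup>+x. ennreal (F (cmod (x - z))) * indicator S x \<partial>lborel) =
    (\<integral>\<^sup>+s. ennreal (g s) * indicator {0<..} s * emeasure lborel (cball z s \<inter> S) \<partial>lborel)"
proof -
  let ?f = "\<lambda>x s. ennreal (g s) * indicator {0<..} s * (if cmod (x - z) \<le> s then indicator S x else 0)"
  have Fr: "ennreal (F r) = (\<integral>\<^sup>+s. ennreal (g s) * indicator {r..} s \<partial>lborel)" if r: "0 < r" for r
  proof -
    have "(\<integral>\<^sup>+s. ennreal (g s) * indicator {r..} s \<partial>lborel) = ennreal (- 0 - - F r)"
    proof (rule nn_integral_FTC_atLeast)
      show "((\<lambda>x. - F x) has_real_derivative g x) (at x)" if "r \<le> x" for x
        using DERIV_minus[OF DERIV[of x]] that r by simp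
      show "((\<lambda>x. - F x) \<longlongrightarrow> - 0) at_top" by (intro tendsto_intros lim)
    qed (use r pos in auto)
    then show ?thesis by simp
  qed
  have AE: "AE x in lborel. x \<noteq> z" by (rule AE_lborel_singleton)
  have "(\<integral>\<^sup>+x. ennreal (F (cmod (x - z))) * indicator S x \<partial>lborel) =
    (\<integral>\<^sup>+x. (\<integral>\<^sup>+s. ennreal (g s) * indicator {cmod (x - z)..} s * indicator S x \<partial>lborel) \<partial>lborel)"
    using AE by (intro nn_integral_cong_AE, eventually_elim) (simp add: Fr nn_integral_multc)
  also have "\<dots> = (\<integral>\<^sup>+x. (\<integral>\<^sup>+s. ?f x s \<partial>lborel) \<partial>lborel)"
  proof (intro nn_integral_cong_AE, use AE in eventually_elim)
    fix x assume x: "x \<noteq> z"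
    show "(\<integral>\<^sup>+s. ennreal (g s) * indicator {cmod (x - z)..} s * indicator S x \<partial>lborel) =
      (\<integral>\<^sup>+s. ?f x s \<partial>lborel)"
    proof (intro nn_integral_cong)
      fix s :: real
      have "0 < s" if "cmod (x - z) \<le> s" using that x by (intro order.strict_trans2[OF _ that]) simp
      then show "ennreal (g s) * indicator {cmod (x - z)..} s * indicator S x =
        ?f x s"
        by (auto simp: indicator_def)
    qed
  qed
  also have "\<dots> = (\<integral>\<^sup>+s. (\<integral>\<^sup>+x. ?f x s \<partial>lborel) \<partial>lborel)"
    by (rule lborel_pair.Fubini'[symmetric]) measurable
  also have "\<dots> = (\<integral>\<^sup>+s. ennreal (g s) * indicator {0<..} s * emeasure lborel (cball z s \<inter> S) \<partial>lborel)"
  proof (intro nn_integral_cong)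
    fix s :: real
    have "(\<integral>\<^sup>+x. ?f x s \<partial>lborel)
      = ennreal (g s) * indicator {0<..} s * (\<integral>\<^sup>+x. (if cmod (x - z) \<le> s then indicator S x else 0) \<partial>lborel)"
      by (rule nn_integral_cmult) measurable
    also have "(\<integral>\<^sup>+x. (if cmod (x - z) \<le> s then indicator S x else 0) \<partial>lborel) = (\<integral>\<^sup>+x. indicator (cball z s \<inter> S) x \<partial>lborel)"
      by (intro nn_integral_cong) (auto simp: indicator_def dist_norm norm_minus_commute)
    also have "\<dots> = emeasure lborel (cball z s \<inter> S)" by simp
    finally show "(\<integral>\<^sup>+x. ?f x s \<partial>lborel)
      = ennreal (g s) * indicator {0<..} s * emeasure lborel (cball z s \<inter> S)" .
  qed
  finally show ?thesis .
qed

text \<open>Layer-cake with \<open>F x = x powr (- p)\<close>. The levels \<open>s \<le> R\<close>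
  see a disc of area \<open>pi * s^2\<close> and contribute the integral of a multiple of
  \<open>s powr (1 - p)\<close>, finite because \<open>p < 2\<close>; the levels above
  \<open>R\<close> see the fixed area \<open>pi * R^2\<close>. Neither contribution depends on
  \<open>z\<close>.\<close>

lemma nn_integral_norm_powr_cball:
  assumes p: "0 < p" "p < 2" and R: "0 < R"
  obtains C where "\<And>z::complex. (\<integral>\<^sup>+x. ennreal (cmod (x - z) powr (- p)) * indicator (cball z R) x \<partial>lborel) \<le> ennreal C"
proof -
  define C1 where "C1 = p * pi * (R powr (2 - p) / (2 - p))"
  have "(\<integral>\<^sup>+x. ennreal (cmod (x - z) powr (- p)) * indicator (cball z R) x \<partial>lborel) \<le> ennreal (C1 + pi * R\<^sup>2 * R powr (- p))" for z :: complex
  proof -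
    let ?g = "\<lambda>s. p * s powr (- p - 1)"
    have lim: "((\<lambda>x. x powr (- p)) \<longlongrightarrow> 0) at_top" using p by (intro tendsto_neg_powr filterlim_ident) auto
    have D: "((\<lambda>x. x powr (- p)) has_real_derivative - ?g x) (at x)" if "0 < x" for x
      using has_real_derivative_powr[OF that, of "- p"] by simp
    have "(\<integral>\<^sup>+x. ennreal (cmod (x - z) powr (- p)) * indicator (cball z R) x \<partial>lborel) =
      (\<integral>\<^sup>+s. ennreal (?g s) * indicator {0<..} s * emeasure lborel (cball z s \<inter> cball z R) \<partial>lborel)"
      using p by (intro nn_integral_radial D lim) auto
    also have "\<dots> \<le> (\<integral>\<^sup>+s. ennreal (indicator {0..R} s * (p * pi * s powr (1 - p))) + ennreal (pi * R\<^sup>2) * (ennreal (?g s) * indicator {R..} s) \<partial>lborel)"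
    proof (intro nn_integral_mono)
      fix s :: real
      show "ennreal (?g s) * indicator {0<..} s * emeasure lborel (cball z s \<inter> cball z R)
        \<le> ennreal (indicator {0..R} s * (p * pi * s powr (1 - p))) + ennreal (pi * R\<^sup>2) * (ennreal (?g s) * indicator {R..} s)"
      proof (cases "0 < s")
        case s: True
        show ?thesis
        proof (cases "s \<le> R")
          case True
          have "emeasure lborel (cball z s \<inter> cball z R) \<le> emeasure lborel (cball z s)" by (intro emeasure_mono) auto
          also have "\<dots> = ennreal (pi * s\<^sup>2)" using s by (simp add: emeasure_lborel_cball_complex)
          finally have "ennreal (?g s) * emeasure lborel (cball z s \<inter> cball z R) \<le> ennreal (?g s) * ennreal (pi * s\<^sup>2)"
            by (rule mult_left_mono) auto
          also have "\<dots> = ennreal (p * pi * (s powr (- p - 1) * s\<^sup>2))"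
            using p s by (simp add: ennreal_mult'[symmetric] mult_ac)
          also have "s powr (- p - 1) * s\<^sup>2 = s powr (1 - p)"
            using s by (simp add: powr_add[symmetric] flip: powr_numeral)
          finally show ?thesis using s True by (simp add: add_increasing2)
        next
          case False
          have "emeasure lborel (cball z s \<inter> cball z R) \<le> emeasure lborel (cball z R)" by (intro emeasure_mono) auto
          also have "\<dots> = ennreal (pi * R\<^sup>2)" using R by (simp add: emeasure_lborel_cball_complex)
          finally have "ennreal (?g s) * emeasure lborel (cball z s \<inter> cball z R) \<le> ennreal (?g s) * ennreal (pi * R\<^sup>2)"
            by (rule mult_left_mono) auto
          then show ?thesis using s False by (simp add: mult.commute)
        qed
      qed auto
    qed
    also have "\<dots> = (\<integral>\<^sup>+s. ennreal (indicator {0..R} s * (p * pi * s powr (1 - p))) \<partial>lborel) + ennreal (pi * R\<^sup>2) * (\<integral>\<^sup>+s. ennreal (?g s) * indicator {R..} s \<partial>lborel)"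
      by (simp add: nn_integral_add nn_integral_cmult)
    also have "(\<integral>\<^sup>+s. ennreal (indicator {0..R} s * (p * pi * s powr (1 - p))) \<partial>lborel) = ennreal C1"
    proof -
      have "((\<lambda>s. p * pi * s powr (1 - p)) has_integral C1) {0..R}"
        using has_integral_mult_right[OF has_integral_powr_from_0[of "1 - p" R], of "p * pi"] p R by (simp add: C1_def)
      from nn_integral_has_integral_lebesgue[OF _ this] p show ?thesis by simp
    qed
    also have "(\<integral>\<^sup>+s. ennreal (?g s) * indicator {R..} s \<partial>lborel) = ennreal (- 0 - - (R powr - p))"
    proof (rule nn_integral_FTC_atLeast)
      show "((\<lambda>x. - (x powr - p)) has_real_derivative ?g x) (at x)" if "R \<le> x" for x
        using DERIV_minus[OF D[of x]] that R by simp
      show "((\<lambda>x. - (x powr - p)) \<longlongrightarrow> - 0) at_top" by (intro tendsto_intros lim)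
    qed (use p in auto)
    also have "ennreal C1 + ennreal (pi * R\<^sup>2) * ennreal (- 0 - - (R powr - p)) = ennreal (C1 + pi * R\<^sup>2 * R powr (- p))"
      using p R by (simp add: ennreal_mult'[symmetric] ennreal_plus[symmetric] C1_def del: ennreal_plus)
    finally show ?thesis .
  qed
  then show ?thesis using that by blast
qed

text \<open>The integrand is \<open>dbar\<close> of the regularised Cauchy kernel for
  \<open>\<delta> = 1\<close>; its mass \<open>pi\<close> is cancelled later by the factor
  \<open>1 / pi\<close> in \<open>T_op\<close>.\<close>

lemma nn_integral_poisson_kernel:
  "(\<integral>\<^sup>+w. ennreal (1 / (1 + (cmod w)\<^sup>2)\<^sup>2) \<partial>lborel) = ennreal pi"
proof -
  let ?g = "\<lambda>s::real. 4 * s / (1 + s\<^sup>2) ^ 3"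
  have nz: "1 + x\<^sup>2 \<noteq> (0::real)" for x by (metis add_pos_nonneg less_irrefl zero_le_power2 zero_less_one)
  have D0: "((\<lambda>x. 1 / (1 + x\<^sup>2)) has_real_derivative - (2 * x / (1 + x\<^sup>2)\<^sup>2)) (at x)" for x :: real
    using nz[of x] by (auto intro!: derivative_eq_intros simp: power2_eq_square)
  have D: "((\<lambda>x. 1 / (1 + x\<^sup>2)\<^sup>2) has_real_derivative - ?g x) (at x)" for x :: real
  proof -
    have "(of_nat 2 * (- (2 * x / q\<^sup>2) * (1 / q) ^ (2 - Suc 0))) = - (4 * x / q ^ 3)" if "q \<noteq> 0" for q
      using that by (simp add: power2_eq_square power3_eq_cube)
    from DERIV_cong[OF DERIV_power[OF D0] this[OF nz]] show ?thesis by (simp add: power_one_over)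
  qed
  \<comment> \<open>After the layer-cake step the integrand is
    \<open>4 * pi * s^3 / (1 + s^2)^3\<close>. Its antiderivative
    \<open>pi * s^4 / (1 + s^2)^2\<close> is written in a form that can be differentiated by means
    of \<open>D0\<close>.\<close>
  have D2: "((\<lambda>x. pi * (1 - 1 / (1 + x\<^sup>2))\<^sup>2) has_real_derivative ?g x * (pi * x\<^sup>2)) (at x)" for x :: real
  proof -
    have "pi * (of_nat 2 * ((0 - - (2 * x / q\<^sup>2)) * (1 - 1 / q) ^ (2 - Suc 0))) = 4 * x / q ^ 3 * (pi * (q - 1))" if "q \<noteq> 0" for q
      using that by (simp add: field_simps power2_eq_square power3_eq_cube)
    from DERIV_cong[OF DERIV_cmult[OF DERIV_power[OF DERIV_diff[OF DERIV_const D0]]] this[OF nz]] show ?thesis by simp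
  qed
  have lim: "((\<lambda>x::real. 1 / (1 + x\<^sup>2)\<^sup>2) \<longlongrightarrow> 0) at_top"
    and lim2: "((\<lambda>x::real. pi * (1 - 1 / (1 + x\<^sup>2))\<^sup>2) \<longlongrightarrow> pi) at_top" by real_asymp+
  have "(\<integral>\<^sup>+w. ennreal (1 / (1 + (cmod (w - 0))\<^sup>2)\<^sup>2) * indicator UNIV w \<partial>lborel) =
    (\<integral>\<^sup>+s. ennreal (?g s) * indicator {0<..} s * emeasure lborel (cball 0 s \<inter> (UNIV :: complex set)) \<partial>lborel)"
    by (rule nn_integral_radial[OF _ _ D _ lim]) auto
  also have "\<dots> = (\<integral>\<^sup>+s. ennreal (?g s * (pi * s\<^sup>2)) * indicator {0..} s \<partial>lborel)"
    by (intro nn_integral_cong) (auto simp: emeasure_lborel_cball_complex ennreal_mult'[symmetric] indicator_def)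
  also have "\<dots> = ennreal (pi - pi * (1 - 1 / (1 + 0\<^sup>2))\<^sup>2)"
    by (rule nn_integral_FTC_atLeast[OF _ D2 _ lim2]) auto
  finally show ?thesis by simp
qed

lemma poisson_kernel:
  "integrable lborel (\<lambda>w. 1 / (1 + (cmod w)\<^sup>2)\<^sup>2)" "(LINT w|lborel. 1 / (1 + (cmod w)\<^sup>2)\<^sup>2) = pi"
proof -
  have "(\<lambda>w. 1 / (1 + (cmod w)\<^sup>2)\<^sup>2) \<in> borel_measurable lborel" by measurable
  then show "integrable lborel (\<lambda>w. 1 / (1 + (cmod w)\<^sup>2)\<^sup>2)"
    using nn_integral_poisson_kernel by (intro integrableI_nonneg) auto
  show "(LINT w|lborel. 1 / (1 + (cmod w)\<^sup>2)\<^sup>2) = pi"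
    using nn_integral_poisson_kernel by (subst integral_eq_nn_integral) auto
qed

text \<open>The substitution \<open>\<zeta> = z + \<delta> w\<close>, with Jacobian
  \<open>\<delta>^2\<close> in the plane, moves the parameter from the kernel into the argument of
  \<open>f\<close>. Dominated convergence then needs only continuity and boundedness of
  \<open>f\<close>.\<close>

lemma poisson_kernel_approximate_identity:
  fixes f :: "complex \<Rightarrow> complex"
  assumes f: "continuous_on UNIV f" "\<And>x. cmod (f x) \<le> M"
    and \<delta>: "\<And>n. 0 < \<delta> n" "\<delta> \<longlonglongrightarrow> 0"
  shows "(\<lambda>n. LINT \<zeta>|lborel. f \<zeta> * of_real ((\<delta> n)\<^sup>2 / ((cmod (\<zeta> - z))\<^sup>2 + (\<delta> n)\<^sup>2)\<^sup>2)) \<longlonglongrightarrow> of_real pi * f z"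
proof -
  have [measurable]: "f \<in> borel_measurable borel" by (rule borel_measurable_continuous_onI[OF f(1)])
  have scale: "(LINT \<zeta>|lborel. f \<zeta> * of_real (d\<^sup>2 / ((cmod (\<zeta> - z))\<^sup>2 + d\<^sup>2)\<^sup>2)) =
      (LINT w|lborel. f (z + d *\<^sub>R w) * of_real (1 / (1 + (cmod w)\<^sup>2)\<^sup>2))" if d: "0 < d" for d
  proof -
    let ?h = "\<lambda>\<zeta>. f \<zeta> * of_real (d\<^sup>2 / ((cmod (\<zeta> - z))\<^sup>2 + d\<^sup>2)\<^sup>2)"
    have "(LINT \<zeta>|lborel. ?h \<zeta>) = (LINT \<zeta>|density (distr lborel borel (\<lambda>w. z + d *\<^sub>R w)) (\<lambda>_. \<bar>d\<bar> ^ DIM(complex)). ?h \<zeta>)"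
      using lborel_affine[of d z] d by simp
    also have "\<dots> = (LINT w|lborel. d\<^sup>2 *\<^sub>R ?h (z + d *\<^sub>R w))"
      using d by (simp add: integral_density integral_distr)
    also have "\<dots> = (LINT w|lborel. f (z + d *\<^sub>R w) * of_real (1 / (1 + (cmod w)\<^sup>2)\<^sup>2))"
    proof (intro Bochner_Integration.integral_cong refl)
      fix w :: complex
      have sc: "c *\<^sub>R (F * of_real X) = F * of_real (c * X)" for c X and F :: complex
        by (simp add: scaleR_conv_of_real)
      have q: "1 + (cmod w)\<^sup>2 \<noteq> 0" by (metis add_pos_nonneg less_irrefl zero_le_power2 zero_less_one)
      have e: "(cmod (z + d *\<^sub>R w - z))\<^sup>2 + d\<^sup>2 = d\<^sup>2 * (1 + (cmod w)\<^sup>2)"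
        by (simp add: power_mult_distrib distrib_left)
      have "d\<^sup>2 * (d\<^sup>2 / (d\<^sup>2 * q)\<^sup>2) = 1 / q\<^sup>2" if "q \<noteq> 0" for q
        using d that by (simp add: power2_eq_square)
      from this[OF q] have "d\<^sup>2 * (d\<^sup>2 / ((cmod (z + d *\<^sub>R w - z))\<^sup>2 + d\<^sup>2)\<^sup>2) = 1 / (1 + (cmod w)\<^sup>2)\<^sup>2"
        unfolding e .
      then show "d\<^sup>2 *\<^sub>R ?h (z + d *\<^sub>R w) = f (z + d *\<^sub>R w) * of_real (1 / (1 + (cmod w)\<^sup>2)\<^sup>2)"
        unfolding sc by (simp only:)
    qed
    finally show ?thesis .
  qed
  have "(\<lambda>n. LINT w|lborel. f (z + \<delta> n *\<^sub>R w) * of_real (1 / (1 + (cmod w)\<^sup>2)\<^sup>2))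
     \<longlonglongrightarrow> (LINT w|lborel. f z * of_real (1 / (1 + (cmod w)\<^sup>2)\<^sup>2))"
  proof (rule integral_dominated_convergence[where w = "\<lambda>w. M * (1 / (1 + (cmod w)\<^sup>2)\<^sup>2)"])
    show "integrable lborel (\<lambda>w. M * (1 / (1 + (cmod w)\<^sup>2)\<^sup>2))"
      using poisson_kernel(1) by (rule integrable_mult_right)
    show "AE w in lborel. (\<lambda>n. f (z + \<delta> n *\<^sub>R w) * of_real (1 / (1 + (cmod w)\<^sup>2)\<^sup>2)) \<longlonglongrightarrow> f z * of_real (1 / (1 + (cmod w)\<^sup>2)\<^sup>2)"
    proof (intro AE_I2 tendsto_intros)
      fix w :: complex
      have "(\<lambda>n. z + \<delta> n *\<^sub>R w) \<longlonglongrightarrow> z + 0 *\<^sub>R w" by (intro tendsto_intros \<delta>)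
      then have "(\<lambda>n. z + \<delta> n *\<^sub>R w) \<longlonglongrightarrow> z" by simp
      moreover have "isCont f z" using f(1) by (simp add: continuous_on_eq_continuous_at)
      ultimately show "(\<lambda>n. f (z + \<delta> n *\<^sub>R w)) \<longlonglongrightarrow> f z" by (rule isCont_tendsto_compose[rotated])
    qed
    show "AE w in lborel. norm (f (z + \<delta> n *\<^sub>R w) * of_real (1 / (1 + (cmod w)\<^sup>2)\<^sup>2)) \<le> M * (1 / (1 + (cmod w)\<^sup>2)\<^sup>2)" for n
      unfolding norm_mult norm_of_real using f(2) by (intro AE_I2 mult_mono order_trans[OF norm_ge_zero f(2)]) auto
  qed measurable
  moreover have "(LINT w|lborel. f z * of_real (1 / (1 + (cmod w)\<^sup>2)\<^sup>2)) = of_real pi * f z"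
    by (simp only: integral_mult_right_zero integral_complex_of_real poisson_kernel mult.commute)
  ultimately show ?thesis by (simp only: scale[OF \<delta>(1)])
qed

section \<open>The Cauchy transform\<close>

text \<open>All factors decrease in their base, so the product is at most the least base raised to
  the total exponent, and that is one of the three summands. It replaces a product of singularities
  at different points by a sum of single ones, whose integrals are bounded uniformly in the position
  of the points.\<close>

lemma powr_mult_le_add3:
  fixes x y w :: real
  assumes "0 < x" "0 < y" "0 < w" "0 \<le> p" "0 \<le> q" "0 \<le> r"
  shows "x powr - p * y powr - q * w powr - r \<le> x powr - (p + q + r) + y powr - (p + q + r) + w powr - (p + q + r)"
proof -
  define m where "m = min x (min y w)"
  have m: "0 < m" "m \<le> x" "m \<le> y" "m \<le> w" "m = x \<or> m = y \<or> m = w" using assms by (auto simp: m_def min_def)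
  have "x powr - p * y powr - q * w powr - r \<le> m powr - p * m powr - q * m powr - r"
    using m assms by (intro mult_mono powr_mono2') auto
  also have "\<dots> = m powr - (p + q + r)" using m by (simp add: powr_add[symmetric] algebra_simps)
  also have "\<dots> \<le> x powr - (p + q + r) + y powr - (p + q + r) + w powr - (p + q + r)"
    using m(5) by auto
  finally show ?thesis .
qed

text \<open>For \<open>z\<close> in \<open>ball 0 R\<close> the set \<open>S\<close> lies in
  \<open>cball z (2 * R)\<close>, so the bound for discs centred at the pole gives one constant for
  all \<open>z\<close>.\<close>

lemma integrable_norm_powr:
  assumes p: "0 < p" "p < 2" and S: "S \<in> sets lebesgue" "S \<subseteq> ball 0 R"
  obtains C where "\<And>z. z \<in> ball 0 R \<Longrightarrow> integrable (lebesgue_on S) (\<lambda>\<zeta>. cmod (\<zeta> - z) powr - p)"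
    "\<And>z. z \<in> ball 0 R \<Longrightarrow> (LINT \<zeta>|lebesgue_on S. cmod (\<zeta> - z) powr - p) \<le> C"
proof (cases "0 < R")
  case True
  then have "0 < 2 * R" by simp
  from nn_integral_norm_powr_cball[OF p this] obtain C where
    C: "\<And>z::complex. (\<integral>\<^sup>+x. ennreal (cmod (x - z) powr (- p)) * indicator (cball z (2 * R)) x \<partial>lborel) \<le> ennreal C"
    by blast
  have le: "(\<integral>\<^sup>+\<zeta>. ennreal (cmod (\<zeta> - z) powr - p) \<partial>lebesgue_on S) \<le> ennreal C" if z: "z \<in> ball 0 R" for z
  proof -
    have sub: "x \<in> cball z (2 * R)" if "x \<in> S" for x
    proof -
      have "dist z x \<le> dist z 0 + dist 0 x" by (rule dist_triangle)
      then show ?thesis using S(2) that z by (auto simp: dist_commute)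
    qed
    have "(\<integral>\<^sup>+\<zeta>. ennreal (cmod (\<zeta> - z) powr - p) \<partial>lebesgue_on S) = (\<integral>\<^sup>+\<zeta>. ennreal (cmod (\<zeta> - z) powr - p) * indicator S \<zeta> \<partial>lebesgue)"
      using S by (intro nn_integral_restrict_space) auto
    also have "\<dots> \<le> (\<integral>\<^sup>+\<zeta>. ennreal (cmod (\<zeta> - z) powr - p) * indicator (cball z (2 * R)) \<zeta> \<partial>lebesgue)"
      using sub by (intro nn_integral_mono) (auto simp: indicator_def)
    also have "\<dots> \<le> ennreal C" unfolding nn_integral_completion by (rule C)
    finally show ?thesis .
  qed
  have m: "(\<lambda>\<zeta>. cmod (\<zeta> - z) powr - p) \<in> borel_measurable (lebesgue_on S)" for z
  proof -
    have "(\<lambda>\<zeta>. cmod (\<zeta> - z) powr - p) \<in> borel_measurable borel" by measurable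
    then show ?thesis by (intro measurable_restrict_space1 measurable_completion) auto
  qed
  have i: "integrable (lebesgue_on S) (\<lambda>\<zeta>. cmod (\<zeta> - z) powr - p)" if z: "z \<in> ball 0 R" for z
    using le[OF z] by (intro integrableI_nonneg m) (auto simp: le_less_trans)
  moreover have "(LINT \<zeta>|lebesgue_on S. cmod (\<zeta> - z) powr - p) \<le> max 0 C" if z: "z \<in> ball 0 R" for z
  proof -
    have "ennreal (LINT \<zeta>|lebesgue_on S. cmod (\<zeta> - z) powr - p) \<le> ennreal C"
      using le[OF z] nn_integral_eq_integral[OF i[OF z]] by simp
    then show ?thesis by (auto simp: ennreal_le_iff2)
  qed
  ultimately show ?thesis using that by blast
next
  case False
  then have "ball (0::complex) R = {}" by simp
  then show ?thesis using that[of 0] by blast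
qed

lemma measurable_lebesgue_on_borel:
  fixes f :: "complex \<Rightarrow> 'b::topological_space"
  shows "f \<in> borel_measurable borel \<Longrightarrow> f \<in> borel_measurable (lebesgue_on S)"
  by (intro measurable_restrict_space1 measurable_completion) auto

lemma integrable_Cauchy_kernel_away:
  fixes k :: "complex \<Rightarrow> complex"
  assumes k: "integrable (lebesgue_on S) k" "\<And>\<zeta>. \<zeta> \<in> ball z0 \<rho> \<Longrightarrow> k \<zeta> = 0" and z: "z \<in> ball z0 \<rho>"
  shows "integrable (lebesgue_on S) (\<lambda>\<zeta>. k \<zeta> / (\<zeta> - z))"
proof -
  define d where "d = \<rho> - dist z0 z"
  have d: "0 < d" using z by (simp add: d_def)
  have [measurable]: "k \<in> borel_measurable (lebesgue_on S)" using k by auto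
  have [measurable]: "(\<lambda>\<zeta>. \<zeta>) \<in> borel_measurable (lebesgue_on S)" by (rule measurable_lebesgue_on_borel) simp
  show ?thesis
  proof (rule Bochner_Integration.integrable_bound[where f = "\<lambda>\<zeta>. k \<zeta> * of_real (1 / d)"])
    show "integrable (lebesgue_on S) (\<lambda>\<zeta>. k \<zeta> * of_real (1 / d))" using k(1) by (rule integrable_mult_left)
    show "AE \<zeta> in lebesgue_on S. norm (k \<zeta> / (\<zeta> - z)) \<le> norm (k \<zeta> * of_real (1 / d))"
    proof (intro AE_I2)
      fix \<zeta>
      show "norm (k \<zeta> / (\<zeta> - z)) \<le> norm (k \<zeta> * of_real (1 / d))"
      proof (cases "k \<zeta> = 0")
        case False
        then have "\<zeta> \<notin> ball z0 \<rho>" using k(2) by blast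
        then have "\<rho> \<le> dist z0 z + dist z \<zeta>" using dist_triangle[of z0 \<zeta> z] by simp
        then have "d \<le> cmod (\<zeta> - z)" by (simp add: d_def dist_norm norm_minus_commute)
        then have "cmod (k \<zeta>) / cmod (\<zeta> - z) \<le> cmod (k \<zeta>) / d"
          using d by (intro divide_left_mono mult_pos_pos) auto
        then show ?thesis using d by (simp add: norm_divide norm_mult)
      qed simp
    qed
  qed measurable
qed

text \<open>Differentiation under the integral with an explicit remainder: where \<open>k\<close>
  does not vanish, the distances to \<open>z\<close> and \<open>z + h\<close> are at least
  \<open>d\<close> and \<open>d/2\<close>, so the remainder is at most
  \<open>2 * norm h / d^3\<close> times the integral of \<open>norm (k \<zeta>)\<close>.\<close>

lemma Cauchy_transform_holomorphic:
  assumes k: "integrable (lebesgue_on S) k" "\<And>\<zeta>. \<zeta> \<in> ball z0 \<rho> \<Longrightarrow> k \<zeta> = 0"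
  shows "(\<lambda>z. LINT \<zeta>|lebesgue_on S. k \<zeta> / (\<zeta> - z)) holomorphic_on ball z0 \<rho>"
proof -
  let ?M = "lebesgue_on S"
  have [measurable]: "k \<in> borel_measurable (?M)" using k by auto
  have [measurable]: "(\<lambda>\<zeta>. \<zeta>) \<in> borel_measurable (?M)" by (rule measurable_lebesgue_on_borel) simp
  have "(\<lambda>z. LINT \<zeta>|?M. k \<zeta> / (\<zeta> - z)) field_differentiable (at z)" if z: "z \<in> ball z0 \<rho>" for z
  proof -
    define d where "d = \<rho> - dist z0 z"
    have d: "0 < d" using z by (simp add: d_def)
    have far: "d \<le> cmod (\<zeta> - z)" if "k \<zeta> \<noteq> 0" for \<zeta>
    proof -
      have "\<zeta> \<notin> ball z0 \<rho>" using k(2) that by blast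
      then have "\<rho> \<le> dist z0 z + dist z \<zeta>" using dist_triangle[of z0 \<zeta> z] by simp
      then show ?thesis by (simp add: d_def dist_norm norm_minus_commute)
    qed
    have far2: "d / 2 \<le> cmod (\<zeta> - z - h)" if "k \<zeta> \<noteq> 0" "cmod h < d / 2" for \<zeta> h
      using far[OF that(1)] that(2) norm_triangle_ineq2[of "\<zeta> - z" h] by linarith
    have int1: "integrable (?M) (\<lambda>\<zeta>. k \<zeta> / (\<zeta> - z - h))" if h: "cmod h < d / 2" for h
    proof -
      have "z + h \<in> ball z0 \<rho>"
        using h d dist_triangle[of z0 "z + h" z] by (simp add: d_def dist_norm)
      from integrable_Cauchy_kernel_away[OF k this] show ?thesis by (simp only: diff_diff_eq)
    qed
    have int2: "integrable (?M) (\<lambda>\<zeta>. k \<zeta> / (\<zeta> - z)\<^sup>2)"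
    proof (rule Bochner_Integration.integrable_bound[where f = "\<lambda>\<zeta>. k \<zeta> * of_real (1 / d\<^sup>2)"])
      show "AE \<zeta> in ?M. norm (k \<zeta> / (\<zeta> - z)\<^sup>2) \<le> norm (k \<zeta> * of_real (1 / d\<^sup>2))"
      proof (intro AE_I2)
        fix \<zeta>
        show "norm (k \<zeta> / (\<zeta> - z)\<^sup>2) \<le> norm (k \<zeta> * of_real (1 / d\<^sup>2))"
        proof (cases "k \<zeta> = 0")
          case False
          have "cmod (k \<zeta>) / (cmod (\<zeta> - z))\<^sup>2 \<le> cmod (k \<zeta>) / d\<^sup>2"
            using far[OF False] d by (intro divide_left_mono mult_pos_pos power_mono zero_less_power) auto
          then show ?thesis using d by (simp add: norm_divide norm_mult norm_power)
        qed simp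
      qed
    qed (use k in \<open>auto intro: integrable_mult_left\<close>)
    let ?F = "\<lambda>z. LINT \<zeta>|?M. k \<zeta> / (\<zeta> - z)"
    let ?L = "LINT \<zeta>|?M. k \<zeta> / (\<zeta> - z)\<^sup>2"
    let ?N = "LINT \<zeta>|?M. norm (k \<zeta>)"
    have est: "norm ((?F (z + h) - ?F z) / h - ?L) \<le> norm h * (2 / d ^ 3) * ?N" if h: "h \<noteq> 0" "cmod h < d / 2" for h
    proof -
      \<comment> \<open>The term \<open>- 0\<close> keeps the shape of \<open>int1\<close>, which is
        used both at \<open>h\<close> and at \<open>0\<close>.\<close>
      have ptw: "(k \<zeta> / (\<zeta> - z - h) - k \<zeta> / (\<zeta> - z - 0)) / h - k \<zeta> / (\<zeta> - z)\<^sup>2 = k \<zeta> * h / ((\<zeta> - z - h) * (\<zeta> - z)\<^sup>2)" for \<zeta>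
      proof (cases "k \<zeta> = 0")
        case False
        then have "\<zeta> - z \<noteq> 0" "\<zeta> - z - h \<noteq> 0" using far[OF False] far2[OF False h(2)] d by auto
        moreover have "(k \<zeta> / (x - h) - k \<zeta> / x) / h - k \<zeta> / x\<^sup>2 = k \<zeta> * h / ((x - h) * x\<^sup>2)" if "x \<noteq> 0" "x - h \<noteq> 0" for x
          using that h(1) by (simp add: divide_simps) (simp add: algebra_simps power2_eq_square)
        ultimately show ?thesis by simp
      qed simp
      have "(?F (z + h) - ?F z) / h - ?L = (LINT \<zeta>|?M. (k \<zeta> / (\<zeta> - z - h) - k \<zeta> / (\<zeta> - z - 0)) / h - k \<zeta> / (\<zeta> - z)\<^sup>2)"
        using int1[OF h(2)] int1[of 0] int2 d by (simp add: diff_diff_eq)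
      also have "\<dots> = (LINT \<zeta>|?M. k \<zeta> * h / ((\<zeta> - z - h) * (\<zeta> - z)\<^sup>2))" unfolding ptw ..
      also have "norm \<dots> \<le> (LINT \<zeta>|?M. norm (k \<zeta>) * (norm h * (2 / d ^ 3)))"
      proof (rule Bochner_Integration.integral_norm_bound_integral)
        have "integrable (?M) (\<lambda>\<zeta>. (k \<zeta> / (\<zeta> - z - h) - k \<zeta> / (\<zeta> - z - 0)) / h - k \<zeta> / (\<zeta> - z)\<^sup>2)"
          using int1[OF h(2)] int1[of 0] int2 d by (intro Bochner_Integration.integrable_diff integrable_divide) auto
        then show "integrable (?M) (\<lambda>\<zeta>. k \<zeta> * h / ((\<zeta> - z - h) * (\<zeta> - z)\<^sup>2))" unfolding ptw .
        show "integrable (?M) (\<lambda>\<zeta>. norm (k \<zeta>) * (norm h * (2 / d ^ 3)))"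
          using k(1) by (intro integrable_mult_left integrable_norm)
        fix \<zeta>
        show "norm (k \<zeta> * h / ((\<zeta> - z - h) * (\<zeta> - z)\<^sup>2)) \<le> norm (k \<zeta>) * (norm h * (2 / d ^ 3))"
        proof (cases "k \<zeta> = 0")
          case False
          have "norm (k \<zeta>) * norm h / (cmod (\<zeta> - z - h) * (cmod (\<zeta> - z))\<^sup>2) \<le> norm (k \<zeta>) * norm h / (d / 2 * d\<^sup>2)"
            using far[OF False] far2[OF False h(2)] d
            by (intro divide_left_mono mult_mono power_mono mult_pos_pos zero_less_power) (auto intro!: mult_pos_pos)
          also have "\<dots> = norm (k \<zeta>) * (norm h * (2 / d ^ 3))"
            using d by (simp add: power2_eq_square power3_eq_cube)
          finally show ?thesis by (simp only: norm_divide norm_mult norm_power)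
        qed simp
      qed
      also have "\<dots> = norm h * (2 / d ^ 3) * ?N" by (simp add: mult_ac)
      finally show ?thesis .
    qed
    have "(?F has_field_derivative ?L) (at z)"
      unfolding DERIV_def
    proof (rule LIM_zero_cancel, rule Lim_null_comparison)
      show "\<forall>\<^sub>F h in at 0. norm ((?F (z + h) - ?F z) / h - ?L) \<le> norm h * (2 / d ^ 3) * ?N"
        unfolding eventually_at using d est by (intro exI[of _ "d / 2"]) (auto simp: dist_norm)
      have "((\<lambda>h::complex. norm h * (2 / d ^ 3) * ?N) \<longlongrightarrow> norm (0::complex) * (2 / d ^ 3) * ?N) (at 0)" by (intro tendsto_intros)
      then show "((\<lambda>h::complex. norm h * (2 / d ^ 3) * ?N) \<longlongrightarrow> 0) (at 0)" by simp
    qed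
    then show ?thesis by (auto simp: field_differentiable_def)
  qed
  then show ?thesis by (auto simp: holomorphic_on_open field_differentiable_def)
qed

lemma AE_lebesgue_on_neq:
  assumes "S \<in> sets lebesgue"
  shows "AE x::complex in lebesgue_on S. x \<noteq> z"
proof -
  have "AE x::complex in lebesgue. x \<noteq> z" by (rule AE_completion) (rule AE_lborel_singleton)
  then show ?thesis using assms by (auto simp: AE_restrict_space_iff elim: eventually_mono)
qed

text \<open>The bound \<open>\<beta> < 1\<close> keeps the order \<open>\<beta> + 1\<close> of the
  density times the Cauchy kernel below the dimension \<open>2\<close>, also when the pole is
  \<open>a\<close> itself.\<close>

locale point_singular_density =
  fixes G :: "complex set" and a :: complex and \<beta> C :: real and h :: "complex \<Rightarrow> complex"
  assumes open_G: "open G" and bounded_G: "bounded G" and a: "a \<in> G" and \<beta>: "0 < \<beta>" "\<beta> < 1"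
    and h_meas: "h \<in> borel_measurable (lebesgue_on G)"
    and h_bound: "AE \<zeta> in lebesgue_on G. cmod (h \<zeta>) \<le> C * cmod (\<zeta> - a) powr - \<beta>"
begin

lemma G_sets: "G \<in> sets lebesgue" using open_G by auto

lemma ball_bound:
  fixes z w :: complex
  obtains R where "G \<subseteq> ball 0 R" "z \<in> ball 0 R" "w \<in> ball 0 R"
proof -
  have "bounded (G \<union> {z, w})" using bounded_G by simp
  then obtain R where "G \<union> {z, w} \<subseteq> ball 0 R" by (meson bounded_subset_ballD)
  then show ?thesis using that by auto
qed

lemma AE_neq: "AE \<zeta> in lebesgue_on G. \<zeta> \<noteq> z"
  by (rule AE_lebesgue_on_neq[OF G_sets])

lemma h_bound': "AE \<zeta> in lebesgue_on G. cmod (h \<zeta>) \<le> max 0 C * cmod (\<zeta> - a) powr - \<beta>"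
  using h_bound by eventually_elim (meson max.cobounded2 mult_right_mono order_trans powr_ge_zero)

lemma measurable_id_lebesgue_on: "(\<lambda>\<zeta>::complex. \<zeta>) \<in> borel_measurable (lebesgue_on G)"
  by (rule measurable_lebesgue_on_borel) simp

lemma Cauchy_kernel_bound:
  assumes R: "G \<subseteq> ball 0 R"
  obtains M where "\<And>z. z \<in> ball 0 R \<Longrightarrow> integrable (lebesgue_on G) (\<lambda>\<zeta>. h \<zeta> / (\<zeta> - z))"
    "\<And>z. z \<in> ball 0 R \<Longrightarrow> (LINT \<zeta>|lebesgue_on G. cmod (h \<zeta> / (\<zeta> - z))) \<le> M"
proof -
  let ?M = "lebesgue_on G"
  note [measurable] = h_meas measurable_id_lebesgue_on
  have aR: "a \<in> ball 0 R" using a R by auto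
  have s: "0 < \<beta> + 1" "\<beta> + 1 < 2" using \<beta> by auto
  obtain K where K: "\<And>z. z \<in> ball 0 R \<Longrightarrow> integrable (?M) (\<lambda>\<zeta>. cmod (\<zeta> - z) powr - (\<beta> + 1))"
    "\<And>z. z \<in> ball 0 R \<Longrightarrow> (LINT \<zeta>|?M. cmod (\<zeta> - z) powr - (\<beta> + 1)) \<le> K"
    using integrable_norm_powr[OF s G_sets R] by blast
  define b where "b z \<zeta> = max 0 C * (cmod (\<zeta> - a) powr - (\<beta> + 1) + (cmod (\<zeta> - z) powr - (\<beta> + 1) + cmod (\<zeta> - z) powr - (\<beta> + 1)))" for z \<zeta>
  have bi: "integrable (?M) (b z)" if "z \<in> ball 0 R" for z
    unfolding b_def using that aR by (intro integrable_mult_right Bochner_Integration.integrable_add K)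
  have bl: "AE \<zeta> in ?M. cmod (h \<zeta> / (\<zeta> - z)) \<le> b z \<zeta>" for z
    using h_bound' AE_neq[of z] AE_neq[of a]
  proof eventually_elim
    case (elim \<zeta>)
    have pos: "0 < cmod (\<zeta> - a)" "0 < cmod (\<zeta> - z)" using elim by auto
    have "cmod (h \<zeta> / (\<zeta> - z)) \<le> max 0 C * cmod (\<zeta> - a) powr - \<beta> * (1 / cmod (\<zeta> - z))"
      using elim(1) by (simp add: norm_divide divide_right_mono)
    \<comment> \<open>The factor with exponent \<open>0\<close> pads the product to three factors,
      with \<open>z\<close> counted twice in the resulting sum.\<close>
    also have "1 / cmod (\<zeta> - z) = cmod (\<zeta> - z) powr - 1 * cmod (\<zeta> - z) powr - 0"
      using pos by (simp add: powr_minus inverse_eq_divide)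
    also have "max 0 C * cmod (\<zeta> - a) powr - \<beta> * \<dots> = max 0 C * (cmod (\<zeta> - a) powr - \<beta> * cmod (\<zeta> - z) powr - 1 * cmod (\<zeta> - z) powr - 0)"
      by (simp only: mult.assoc)
    also have "\<dots> \<le> b z \<zeta>"
      unfolding b_def
    proof (rule mult_left_mono)
      show "cmod (\<zeta> - a) powr - \<beta> * cmod (\<zeta> - z) powr - 1 * cmod (\<zeta> - z) powr - 0
        \<le> cmod (\<zeta> - a) powr - (\<beta> + 1) + (cmod (\<zeta> - z) powr - (\<beta> + 1) + cmod (\<zeta> - z) powr - (\<beta> + 1))"
        using powr_mult_le_add3[OF pos(1) pos(2) pos(2), of \<beta> 1 0] \<beta> by (simp only: add_0_right add.assoc)
    qed simp
    finally show ?case .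
  qed
  have i: "integrable (?M) (\<lambda>\<zeta>. h \<zeta> / (\<zeta> - z))" if z: "z \<in> ball 0 R" for z
  proof (rule Bochner_Integration.integrable_bound[OF bi[OF z]])
    show "AE \<zeta> in ?M. norm (h \<zeta> / (\<zeta> - z)) \<le> norm (b z \<zeta>)"
      using bl[of z] by eventually_elim simp
  qed measurable
  moreover have "(LINT \<zeta>|?M. cmod (h \<zeta> / (\<zeta> - z))) \<le> max 0 C * (K + (K + K))" if z: "z \<in> ball 0 R" for z
  proof -
    have "(LINT \<zeta>|?M. cmod (h \<zeta> / (\<zeta> - z))) \<le> (LINT \<zeta>|?M. b z \<zeta>)"
      using i[OF z] bi[OF z] bl by (intro integral_mono_AE integrable_norm)
    also have "\<dots> = max 0 C * ((LINT \<zeta>|?M. cmod (\<zeta> - a) powr - (\<beta> + 1)) + ((LINT \<zeta>|?M. cmod (\<zeta> - z) powr - (\<beta> + 1)) + (LINT \<zeta>|?M. cmod (\<zeta> - z) powr - (\<beta> + 1))))"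
      unfolding b_def using K(1)[OF z] K(1)[OF aR] by (simp only: integral_mult_right_zero Bochner_Integration.integral_add Bochner_Integration.integrable_add)
    also have "\<dots> \<le> max 0 C * (K + (K + K))" using K(2)[OF z] K(2)[OF aR] by (intro mult_left_mono add_mono) auto
    finally show ?thesis .
  qed
  ultimately show ?thesis using that by blast
qed

lemma integrable_Cauchy_kernel: "integrable (lebesgue_on G) (\<lambda>\<zeta>. h \<zeta> / (\<zeta> - z))"
  using ball_bound[of z z] Cauchy_kernel_bound by metis

lemma integrable_density: "integrable (lebesgue_on G) h"
proof -
  obtain R where R: "G \<subseteq> ball 0 R" "a \<in> ball 0 R" using ball_bound[of a a] by blast
  obtain K where K: "\<And>z. z \<in> ball 0 R \<Longrightarrow> integrable (lebesgue_on G) (\<lambda>\<zeta>. cmod (\<zeta> - z) powr - \<beta>)"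
    using integrable_norm_powr[OF _ _ G_sets R(1), of \<beta>] \<beta> by auto
  show ?thesis
  proof (rule Bochner_Integration.integrable_bound)
    show "integrable (lebesgue_on G) (\<lambda>\<zeta>. max 0 C * cmod (\<zeta> - a) powr - \<beta>)" using K R by auto
    show "AE \<zeta> in lebesgue_on G. norm (h \<zeta>) \<le> norm (max 0 C * cmod (\<zeta> - a) powr - \<beta>)"
      using h_bound' by eventually_elim simp
  qed (rule h_meas)
qed

text \<open>The difference of the kernels at \<open>z\<close> and \<open>w\<close> is
  \<open>(z - w) / ((\<zeta> - z) * (\<zeta> - w))\<close>. A power \<open>\<sigma>\<close> of
  \<open>cmod (z - w)\<close> is kept as the gain, and the remaining power compensates part of the
  two poles.\<close>

lemma T_op_Holder:
  assumes R: "G \<subseteq> ball 0 R"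
  obtains K where "\<And>z w. z \<in> ball 0 R \<Longrightarrow> w \<in> ball 0 R \<Longrightarrow>
    cmod (T_op G h z - T_op G h w) \<le> K * cmod (z - w) powr ((1 - \<beta>) / 2)"
proof -
  let ?M = "lebesgue_on G"
  note [measurable] = h_meas measurable_id_lebesgue_on
  \<comment> \<open>Half of the room left by \<open>\<beta> < 1\<close>: the total order
    \<open>\<beta> + 1 + \<sigma> = (3 + \<beta>) / 2\<close> stays below \<open>2\<close>.\<close>
  define \<sigma> where "\<sigma> = (1 - \<beta>) / 2"
  have \<sigma>: "0 < \<sigma>" "\<sigma> < 1" "\<beta> + 1 + \<sigma> < 2" using \<beta> by (auto simp: \<sigma>_def field_simps)
  define s where "s = \<beta> + 1 + \<sigma>"
  have s: "0 < s" "s < 2" using \<sigma> \<beta> by (auto simp: s_def)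
  have aR: "a \<in> ball 0 R" using a R by auto
  obtain K where K: "\<And>z. z \<in> ball 0 R \<Longrightarrow> integrable (?M) (\<lambda>\<zeta>. cmod (\<zeta> - z) powr - s)"
    "\<And>z. z \<in> ball 0 R \<Longrightarrow> (LINT \<zeta>|?M. cmod (\<zeta> - z) powr - s) \<le> K"
    using integrable_norm_powr[OF s G_sets R] by blast
  have main: "cmod (T_op G h z - T_op G h w) \<le> (4 * max 0 C * (K + (K + K)) / pi) * cmod (z - w) powr \<sigma>"
    if z: "z \<in> ball 0 R" and w: "w \<in> ball 0 R" and ne: "z \<noteq> w" for z w
  proof -
    define D where "D = 4 * max 0 C * cmod (z - w) powr \<sigma>"
    have D: "0 \<le> D" by (simp add: D_def)
    define b where "b \<zeta> = D * (cmod (\<zeta> - a) powr - s + (cmod (\<zeta> - z) powr - s + cmod (\<zeta> - w) powr - s))" for \<zeta>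
    have bi: "integrable (?M) b"
      unfolding b_def using z w aR by (intro integrable_mult_right Bochner_Integration.integrable_add K)
    have bl: "AE \<zeta> in ?M. cmod (h \<zeta> / (\<zeta> - z) - h \<zeta> / (\<zeta> - w)) \<le> b \<zeta>"
      using h_bound' AE_neq[of z] AE_neq[of a] AE_neq[of w]
    proof eventually_elim
      case (elim \<zeta>)
      define A X Y where "A = cmod (\<zeta> - a)" and "X = cmod (\<zeta> - z)" and "Y = cmod (\<zeta> - w)"
      have pos: "0 < A" "0 < X" "0 < Y" using elim by (auto simp: A_def X_def Y_def)
      define d where "d = cmod (z - w)"
      have d: "0 < d" "d \<le> X + Y"
        using ne norm_triangle_ineq4[of "\<zeta> - w" "\<zeta> - z"] by (auto simp: d_def X_def Y_def)
      \<comment> \<open>By \<open>d \<le> X + Y\<close>, the factor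
        \<open>d powr (1 - \<sigma>)\<close> lowers one of the two poles from order \<open>1\<close>
        to order \<open>\<sigma>\<close>; either pole may be the one lowered, hence the two summands
        in \<open>q\<close>.\<close>
      have "d powr (1 - \<sigma>) \<le> (2 * max X Y) powr (1 - \<sigma>)" using d \<sigma> by (intro powr_mono2) auto
      also have "\<dots> = 2 powr (1 - \<sigma>) * max X Y powr (1 - \<sigma>)" using pos by (simp add: powr_mult)
      also have "\<dots> \<le> 2 powr 1 * (X powr (1 - \<sigma>) + Y powr (1 - \<sigma>))"
        using \<sigma> by (intro mult_mono powr_mono) (auto simp: max_def)
      finally have dX: "d powr (1 - \<sigma>) \<le> 2 * (X powr (1 - \<sigma>) + Y powr (1 - \<sigma>))" by simp
      have "d / (X * Y) = d powr \<sigma> * d powr (1 - \<sigma>) / (X * Y)"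
        using d by (simp add: powr_add[symmetric])
      also have "\<dots> \<le> d powr \<sigma> * (2 * (X powr (1 - \<sigma>) + Y powr (1 - \<sigma>))) / (X * Y)"
        using dX pos by (intro divide_right_mono mult_left_mono) auto
      also have "\<dots> = 2 * d powr \<sigma> * (X powr - \<sigma> * Y powr - 1 + X powr - 1 * Y powr - \<sigma>)"
        using pos by (simp add: powr_diff powr_minus field_simps)
      finally have q: "d / (X * Y) \<le> 2 * d powr \<sigma> * (X powr - \<sigma> * Y powr - 1 + X powr - 1 * Y powr - \<sigma>)" .
      have "h \<zeta> / (\<zeta> - z) - h \<zeta> / (\<zeta> - w) = h \<zeta> * ((z - w) / ((\<zeta> - z) * (\<zeta> - w)))"
        using elim by (simp add: field_simps)
      then have "cmod (h \<zeta> / (\<zeta> - z) - h \<zeta> / (\<zeta> - w)) = cmod (h \<zeta>) * (d / (X * Y))"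
        by (simp add: norm_mult norm_divide d_def X_def Y_def)
      also have "\<dots> \<le> (max 0 C * A powr - \<beta>) * (2 * d powr \<sigma> * (X powr - \<sigma> * Y powr - 1 + X powr - 1 * Y powr - \<sigma>))"
        using elim(1) q d pos by (intro mult_mono) (auto simp: A_def)
      also have "\<dots> = 2 * max 0 C * d powr \<sigma> * (A powr - \<beta> * X powr - \<sigma> * Y powr - 1 + A powr - \<beta> * X powr - 1 * Y powr - \<sigma>)"
        by (simp add: algebra_simps)
      also have "\<dots> \<le> 2 * max 0 C * d powr \<sigma> * ((A powr - s + X powr - s + Y powr - s) + (A powr - s + X powr - s + Y powr - s))"
      proof (intro mult_left_mono add_mono)
        show "A powr - \<beta> * X powr - \<sigma> * Y powr - 1 \<le> A powr - s + X powr - s + Y powr - s"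
          using powr_mult_le_add3[OF pos, of \<beta> \<sigma> 1] \<beta> \<sigma> by (simp add: s_def add_ac)
        show "A powr - \<beta> * X powr - 1 * Y powr - \<sigma> \<le> A powr - s + X powr - s + Y powr - s"
          using powr_mult_le_add3[OF pos, of \<beta> 1 \<sigma>] \<beta> \<sigma> by (simp add: s_def)
      qed auto
      also have "\<dots> = b \<zeta>" by (simp add: b_def D_def d_def A_def X_def Y_def algebra_simps)
      finally show ?case .
    qed
    have "T_op G h z - T_op G h w = - (1 / of_real pi) * (LINT \<zeta>|?M. h \<zeta> / (\<zeta> - z) - h \<zeta> / (\<zeta> - w))"
      unfolding T_op_def by (subst Bochner_Integration.integral_diff[OF integrable_Cauchy_kernel integrable_Cauchy_kernel]) (simp only: right_diff_distrib)
    then have "cmod (T_op G h z - T_op G h w) = (1 / pi) * cmod (LINT \<zeta>|?M. h \<zeta> / (\<zeta> - z) - h \<zeta> / (\<zeta> - w))"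
      by (simp add: norm_mult norm_divide)
    also have "\<dots> \<le> (1 / pi) * (LINT \<zeta>|?M. cmod (h \<zeta> / (\<zeta> - z) - h \<zeta> / (\<zeta> - w)))"
      by (intro mult_left_mono integral_norm_bound) auto
    also have "\<dots> \<le> (1 / pi) * (LINT \<zeta>|?M. b \<zeta>)"
      using bi bl by (intro mult_left_mono integral_mono_AE integrable_norm Bochner_Integration.integrable_diff integrable_Cauchy_kernel) auto
    also have "(LINT \<zeta>|?M. b \<zeta>) = D * ((LINT \<zeta>|?M. cmod (\<zeta> - a) powr - s) + ((LINT \<zeta>|?M. cmod (\<zeta> - z) powr - s) + (LINT \<zeta>|?M. cmod (\<zeta> - w) powr - s)))"
      unfolding b_def using K(1)[OF z] K(1)[OF aR] K(1)[OF w] by (simp only: integral_mult_right_zero Bochner_Integration.integral_add Bochner_Integration.integrable_add)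
    also have "(1 / pi) * \<dots> \<le> (1 / pi) * (D * (K + (K + K)))"
      using K(2)[OF z] K(2)[OF aR] K(2)[OF w] D by (intro mult_left_mono add_mono) auto
    also have "(1 / pi) * (D * (K + (K + K))) = (4 * max 0 C * (K + (K + K)) / pi) * cmod (z - w) powr \<sigma>"
      by (simp add: D_def field_simps)
    finally show ?thesis .
  qed
  show ?thesis
  proof (rule that[of "4 * max 0 C * (K + (K + K)) / pi"])
    fix z w :: complex assume "z \<in> ball 0 R" "w \<in> ball 0 R"
    then show "cmod (T_op G h z - T_op G h w) \<le> 4 * max 0 C * (K + (K + K)) / pi * cmod (z - w) powr ((1 - \<beta>) / 2)"
      using main[of z w] unfolding \<sigma>_def by (cases "z = w") auto
  qed
qed

lemma continuous_on_T_op: "continuous_on UNIV (T_op G h)"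
proof (rule continuous_at_imp_continuous_on, rule ballI)
  fix z :: complex
  obtain R where R: "G \<subseteq> ball 0 R" "z \<in> ball 0 R" using ball_bound[of z z] by blast
  obtain K where K: "\<And>z w. z \<in> ball 0 R \<Longrightarrow> w \<in> ball 0 R \<Longrightarrow>
    cmod (T_op G h z - T_op G h w) \<le> K * cmod (z - w) powr ((1 - \<beta>) / 2)"
    using T_op_Holder[OF R(1)] by blast
  have "(T_op G h \<longlongrightarrow> T_op G h z) (at z)"
  proof (rule LIM_zero_cancel, rule Lim_null_comparison)
    show "\<forall>\<^sub>F w in at z. norm (T_op G h w - T_op G h z) \<le> K * cmod (w - z) powr ((1 - \<beta>) / 2)"
      using eventually_at_in_open'[OF open_ball R(2)] by eventually_elim (use K R in auto)
    have "((\<lambda>w. K * cmod (w - z) powr ((1 - \<beta>) / 2)) \<longlongrightarrow> K * cmod (z - z) powr ((1 - \<beta>) / 2)) (at z)"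
      using \<beta> by (intro tendsto_intros) auto
    then show "((\<lambda>w. K * cmod (w - z) powr ((1 - \<beta>) / 2)) \<longlongrightarrow> 0) (at z)" by simp
  qed
  then show "isCont (T_op G h) z" by (simp add: isCont_def)
qed

end

subsection \<open>Weak solutions of the inhomogeneous Cauchy-Riemann equation\<close>

lemma bounded_of_compact_support:
  fixes f :: "complex \<Rightarrow> complex"
  assumes "continuous_on UNIV f" "compact K" "\<And>x. x \<notin> K \<Longrightarrow> f x = 0"
  obtains M where "\<And>x. cmod (f x) \<le> M" "0 \<le> M"
proof -
  have "bounded (f ` K)"
    by (intro compact_imp_bounded compact_continuous_image assms(2) continuous_on_subset[OF assms(1)]) auto
  then obtain M where M: "\<And>x. x \<in> K \<Longrightarrow> cmod (f x) \<le> M" by (auto simp: bounded_iff)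
  have "cmod (f x) \<le> max 0 M" for x
    using M[of x] assms(3)[of x] by (cases "x \<in> K") auto
  then show ?thesis using that[of "max 0 M"] by auto
qed

text \<open>On \<open>K\<close> the factor \<open>\<psi>\<close> is bounded and off \<open>K\<close>
  the product vanishes, so integrability of \<open>f\<close> on \<open>K\<close> is enough.\<close>

lemma integrable_locally_integrable_mult:
  assumes f: "locally_integrable G f" and \<psi>: "continuous_on UNIV \<psi>"
    and K: "compact K" "K \<subseteq> G" "\<And>x. x \<notin> K \<Longrightarrow> \<psi> x = 0" and G: "open G"
  shows "integrable (lebesgue_on G) (\<lambda>z. f z * \<psi> z)"
proof -
  obtain M where M: "\<And>x. cmod (\<psi> x) \<le> M" "0 \<le> M"
    using bounded_of_compact_support[OF \<psi> K(1,3)] by blast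
  have fK: "integrable (lebesgue_on K) f" using f K by (auto simp: locally_integrable_def)
  have "integrable (lebesgue_on K) (\<lambda>z. f z * \<psi> z)"
  proof (rule Bochner_Integration.integrable_bound[where f = "\<lambda>z. f z * of_real M"])
    show "integrable (lebesgue_on K) (\<lambda>z. f z * of_real M)" using fK by (rule integrable_mult_left)
    have "\<psi> \<in> borel_measurable (lebesgue_on K)"
      by (intro measurable_lebesgue_on_borel borel_measurable_continuous_onI \<psi>)
    moreover have "f \<in> borel_measurable (lebesgue_on K)" using fK by auto
    ultimately show "(\<lambda>z. f z * \<psi> z) \<in> borel_measurable (lebesgue_on K)" by measurable
    show "AE z in lebesgue_on K. norm (f z * \<psi> z) \<le> norm (f z * of_real M)"
      unfolding norm_mult norm_of_real using M by (intro AE_I2 mult_left_mono) auto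
  qed
  moreover have "K \<in> sets lebesgue" using K(1) by (simp add: compact_imp_closed)
  moreover have "(\<lambda>z. indicator K z *\<^sub>R (f z * \<psi> z)) = (\<lambda>z. indicator G z *\<^sub>R (f z * \<psi> z))"
    using K by (auto simp: indicator_def fun_eq_iff)
  ultimately show ?thesis using G by (simp add: integrable_restrict_space)
qed

lemma cauchy_reg_norm_le: "cmod (cauchy_reg \<delta> z) \<le> 1 / cmod z"
proof (cases "z = 0")
  case False
  then have p: "0 < cmod z" by simp
  have "cmod (cauchy_reg \<delta> z) = cmod z / ((cmod z)\<^sup>2 + \<delta>\<^sup>2)"
    unfolding cauchy_reg_def cauchy_reg_denom norm_mult norm_inverse norm_of_real complex_mod_cnj
    by (simp add: divide_inverse)
  also have "\<dots> \<le> cmod z / (cmod z)\<^sup>2" using p by (intro divide_left_mono) (auto intro!: mult_pos_pos add_pos_nonneg)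
  finally show ?thesis using p by (simp add: power2_eq_square)
qed (simp add: cauchy_reg_def)

lemma cauchy_reg_tendsto:
  assumes "z \<noteq> 0" "\<delta> \<longlonglongrightarrow> 0"
  shows "(\<lambda>n. cauchy_reg (\<delta> n) z) \<longlonglongrightarrow> 1 / z"
proof -
  have "(\<lambda>n. cauchy_reg (\<delta> n) z) \<longlonglongrightarrow> cnj z * inverse (z * cnj z + of_real (0\<^sup>2))"
    unfolding cauchy_reg_def using assms(1) by (intro tendsto_intros assms(2)) auto
  then show ?thesis using assms(1) by (simp add: field_simps)
qed

locale weak_dbar_solution = point_singular_density +
  fixes V :: "complex \<Rightarrow> complex"
  assumes V_cont: "continuous_on G V" and V_loc: "locally_integrable G V"
    and weak: "\<And>\<phi>. \<phi> \<in> test_functions G \<Longrightarrow>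
      (LINT \<zeta>|lebesgue_on G. V \<zeta> * dbar \<phi> \<zeta>) = - (LINT \<zeta>|lebesgue_on G. h \<zeta> * \<phi> \<zeta>)"
begin

lemma V_times_continuous_extension:
  assumes "continuous_on UNIV f" "compact K" "K \<subseteq> G" "\<And>x. x \<notin> K \<Longrightarrow> f x = 0"
  shows "continuous_on UNIV (\<lambda>\<zeta>. if \<zeta> \<in> G then V \<zeta> * f \<zeta> else 0)"
proof -
  let ?F = "\<lambda>\<zeta>. if \<zeta> \<in> G then V \<zeta> * f \<zeta> else 0"
  have "continuous_on G (\<lambda>\<zeta>. V \<zeta> * f \<zeta>)"
    by (intro continuous_intros V_cont continuous_on_subset[OF assms(1)]) auto
  then have 1: "continuous_on G ?F" by (rule continuous_on_eq) auto
  have 2: "continuous_on (- K) ?F"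
    by (rule continuous_on_eq[OF continuous_on_const[of _ 0]]) (use assms(4) in auto)
  have "continuous_on (G \<union> - K) ?F"
    using 1 2 open_G compact_imp_closed[OF assms(2)] by (intro continuous_on_open_Un) auto
  moreover have "G \<union> - K = UNIV" using assms(3) by auto
  ultimately show ?thesis by simp
qed

text \<open>The limit of the tested equation is \<open>pi * V z = - \<integral> (h * \<psi> + V *
  dbar \<psi>) / (\<zeta> - z)\<close>. Comparing with \<open>T_op\<close> leaves the Cauchy
  transform of \<open>k = h * (1 - \<psi>) - V * dbar \<psi>\<close>, and both terms of
  \<open>k\<close> vanish where \<open>\<psi>\<close> is locally \<open>1\<close>.\<close>

lemma local_representation:
  assumes r: "0 < r" "cball z0 r \<subseteq> G"
  shows "(\<lambda>z. V z - T_op G h z) holomorphic_on ball z0 (r/2)"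
proof -
  let ?M = "lebesgue_on G"
  note [measurable] = h_meas measurable_id_lebesgue_on
  obtain \<psi> where \<psi>: "\<And>k. Ck k \<psi>" "\<And>z. z \<in> cball z0 (r/2) \<Longrightarrow> \<psi> z = 1" "\<And>z. z \<notin> cball z0 r \<Longrightarrow> \<psi> z = 0"
    using smooth_bump[OF r(1)] by blast
  let ?K = "cball z0 r"
  have \<psi>_cont: "continuous_on UNIV \<psi>" using \<psi>(1)[of 0] by simp
  have d\<psi>_cont: "continuous_on UNIV (dbar \<psi>)" by (rule continuous_on_dbar[OF \<psi>(1)])
  have d\<psi>_out: "dbar \<psi> z = 0" if "z \<notin> ?K" for z
    using frechet_derivative_eq_0_off_support[OF _ \<psi>(3) that] by (simp add: dbar_def)
  have d\<psi>_in: "dbar \<psi> z = 0" if "z \<in> ball z0 (r/2)" for z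
  proof -
    have "((\<lambda>z. 1::complex) has_derivative (\<lambda>v. 0)) (at z)" by (rule has_derivative_const)
    then have "(\<psi> has_derivative (\<lambda>v. 0)) (at z)"
      by (rule has_derivative_transform_within_open[where s = "ball z0 (r/2)"]) (use that \<psi>(2) in auto)
    from dbar_eq[OF this] show ?thesis by simp
  qed
  obtain M where M: "\<And>x. cmod (\<psi> x) \<le> M" "0 \<le> M"
    using bounded_of_compact_support[OF \<psi>_cont compact_cball \<psi>(3)] by blast
  have [measurable]: "\<psi> \<in> borel_measurable (?M)"
    by (intro measurable_lebesgue_on_borel borel_measurable_continuous_onI \<psi>_cont)
  define k where "k \<zeta> = h \<zeta> * (1 - \<psi> \<zeta>) - V \<zeta> * dbar \<psi> \<zeta>" for \<zeta>
  have iVd: "integrable (?M) (\<lambda>\<zeta>. V \<zeta> * dbar \<psi> \<zeta>)"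
    using r(2) d\<psi>_out by (intro integrable_locally_integrable_mult[OF V_loc d\<psi>_cont, of ?K] open_G) auto
  have ih: "integrable (?M) (\<lambda>\<zeta>. f \<zeta> * (1 - \<psi> \<zeta>))" if f: "integrable (?M) f" for f
  proof (rule Bochner_Integration.integrable_bound[where f = "\<lambda>\<zeta>. of_real (1 + M) * f \<zeta>"])
    show "integrable (?M) (\<lambda>\<zeta>. of_real (1 + M) * f \<zeta>)" using f by (intro integrable_mult_right)
    have "f \<in> borel_measurable (?M)" using f by auto
    then show "(\<lambda>\<zeta>. f \<zeta> * (1 - \<psi> \<zeta>)) \<in> borel_measurable (?M)" by measurable
    have "cmod (1 - \<psi> \<zeta>) \<le> 1 + M" for \<zeta> using norm_triangle_ineq4[of 1 "\<psi> \<zeta>"] M(1)[of \<zeta>] by simp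
    then show "AE \<zeta> in ?M. norm (f \<zeta> * (1 - \<psi> \<zeta>)) \<le> norm (of_real (1 + M) * f \<zeta>)"
      unfolding norm_mult norm_of_real using M(2)
      by (intro AE_I2) (subst mult.commute, intro mult_right_mono, auto)
  qed
  have ik: "integrable (?M) k"
    unfolding k_def by (intro Bochner_Integration.integrable_diff ih integrable_density iVd)
  have k0: "k \<zeta> = 0" if "\<zeta> \<in> ball z0 (r/2)" for \<zeta>
    using that \<psi>(2)[of \<zeta>] d\<psi>_in[OF that] by (simp add: k_def)
  have rep: "V z - T_op G h z = (1 / of_real pi) * (LINT \<zeta>|?M. k \<zeta> / (\<zeta> - z))" if z: "z \<in> ball z0 (r/2)" for z
  proof -
    have zG: "z \<in> G" using z r by (auto simp: subset_eq)
    define \<delta> where "\<delta> n = 1 / real (Suc n)" for n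
    have \<delta>: "0 < \<delta> n" "\<delta> \<longlonglongrightarrow> 0" for n
      unfolding \<delta>_def by (simp, use LIMSEQ_inverse_real_of_nat in \<open>simp add: inverse_eq_divide\<close>)
    have \<delta>': "\<delta> n \<noteq> 0" for n using \<delta>(1)[of n] by simp
    define E where "E n \<zeta> = cauchy_reg (\<delta> n) (\<zeta> + - z)" for n \<zeta>
    define P where "P n \<zeta> = complex_of_real ((\<delta> n)\<^sup>2 / ((cmod (\<zeta> - z))\<^sup>2 + (\<delta> n)\<^sup>2)\<^sup>2)" for n \<zeta>
    have CE: "Ck m (E n)" for m n unfolding E_def by (rule Ck_cauchy_reg[OF \<delta>'])
    have E_cont: "continuous_on UNIV (E n)" for n using CE[of 0] by simp
    have [measurable]: "E n \<in> borel_measurable (?M)" for n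
      by (intro measurable_lebesgue_on_borel borel_measurable_continuous_onI E_cont)
    have dE: "dbar (E n) \<zeta> = P n \<zeta>" for n \<zeta>
      unfolding E_def P_def by (rule dbar_cauchy_reg[OF \<delta>'])
    have P_cont: "continuous_on UNIV (P n)" for n
      using continuous_on_dbar[OF CE[of 1 n]] dE by (simp cong: continuous_on_cong)
    have test: "(\<lambda>\<zeta>. \<psi> \<zeta> * E n \<zeta>) \<in> test_functions G" for n
      unfolding test_functions_def using r(2) \<psi>(3)
      by (auto intro!: Ck_mult \<psi>(1) CE exI[of _ ?K])
    \<comment> \<open>The approximate identity asks for a function on the whole plane; the cutoff
      makes the extension of \<open>V * \<psi>\<close> by \<open>0\<close> continuous.\<close>
    define f where "f \<zeta> = (if \<zeta> \<in> G then V \<zeta> * \<psi> \<zeta> else 0)" for \<zeta>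
    have f_cont: "continuous_on UNIV f"
      unfolding f_def using r(2) by (intro V_times_continuous_extension[OF \<psi>_cont, of ?K] \<psi>(3)) auto
    have f0: "f x = 0" if "x \<notin> ?K" for x using \<psi>(3)[OF that] by (simp add: f_def)
    obtain Mf where Mf: "\<And>x. cmod (f x) \<le> Mf"
      using bounded_of_compact_support[OF f_cont compact_cball f0] by blast
    have i1: "integrable (?M) (\<lambda>\<zeta>. V \<zeta> * (\<psi> \<zeta> * P n \<zeta>))" for n
      using r(2) \<psi>(3) by (intro integrable_locally_integrable_mult[OF V_loc, of _ ?K] open_G continuous_intros \<psi>_cont P_cont) auto
    have i2: "integrable (?M) (\<lambda>\<zeta>. V \<zeta> * (dbar \<psi> \<zeta> * E n \<zeta>))" for n
      using r(2) d\<psi>_out by (intro integrable_locally_integrable_mult[OF V_loc, of _ ?K] open_G continuous_intros d\<psi>_cont E_cont) auto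
    \<comment> \<open>The product rule splits \<open>dbar (\<psi> * E n)\<close>: the part with
      \<open>P n\<close> concentrates at \<open>z\<close>, while in the other two integrals
      \<open>E n\<close> tends to the Cauchy kernel.\<close>
    have id: "(LINT \<zeta>|?M. V \<zeta> * (\<psi> \<zeta> * P n \<zeta>)) + (LINT \<zeta>|?M. V \<zeta> * (dbar \<psi> \<zeta> * E n \<zeta>))
       = - (LINT \<zeta>|?M. h \<zeta> * (\<psi> \<zeta> * E n \<zeta>))" for n
    proof -
      have "dbar (\<lambda>\<zeta>. \<psi> \<zeta> * E n \<zeta>) \<zeta> = \<psi> \<zeta> * P n \<zeta> + dbar \<psi> \<zeta> * E n \<zeta>" for \<zeta>
        unfolding dE[symmetric] by (rule dbar_mult[OF \<psi>(1) CE])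
      then have "(LINT \<zeta>|?M. V \<zeta> * (\<psi> \<zeta> * P n \<zeta>) + V \<zeta> * (dbar \<psi> \<zeta> * E n \<zeta>))
       = - (LINT \<zeta>|?M. h \<zeta> * (\<psi> \<zeta> * E n \<zeta>))"
        using weak[OF test[of n]] by (simp only: distrib_left)
      then show ?thesis by (simp only: Bochner_Integration.integral_add[OF i1 i2])
    qed
    have E_le: "cmod (E n \<zeta>) \<le> 1 / cmod (\<zeta> - z)" for n \<zeta>
      using cauchy_reg_norm_le[of "\<delta> n" "\<zeta> - z"] by (simp add: E_def)
    have E_lim: "(\<lambda>n. E n \<zeta>) \<longlonglongrightarrow> 1 / (\<zeta> - z)" if "\<zeta> \<noteq> z" for \<zeta>
      unfolding E_def using cauchy_reg_tendsto[of "\<zeta> + - z", OF _ \<delta>(2)] that by simp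
    have lim1: "(\<lambda>n. LINT \<zeta>|?M. V \<zeta> * (\<psi> \<zeta> * P n \<zeta>)) \<longlonglongrightarrow> of_real pi * V z"
    proof -
      have "(LINT \<zeta>|?M. V \<zeta> * (\<psi> \<zeta> * P n \<zeta>)) = (LINT \<zeta>|lborel. f \<zeta> * P n \<zeta>)" for n
      proof -
        have "(LINT \<zeta>|?M. V \<zeta> * (\<psi> \<zeta> * P n \<zeta>)) = (LINT \<zeta>|lebesgue. indicator G \<zeta> *\<^sub>R (V \<zeta> * (\<psi> \<zeta> * P n \<zeta>)))"
          using open_G by (intro integral_restrict_space) auto
        also have "\<dots> = (LINT \<zeta>|lebesgue. f \<zeta> * P n \<zeta>)"
          by (intro Bochner_Integration.integral_cong refl) (auto simp: f_def indicator_def)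
        also have "\<dots> = (LINT \<zeta>|lborel. f \<zeta> * P n \<zeta>)"
        proof (rule integral_completion)
          have "(\<lambda>\<zeta>. f \<zeta> * P n \<zeta>) \<in> borel_measurable borel"
            by (intro borel_measurable_continuous_onI continuous_intros f_cont P_cont)
          then show "(\<lambda>\<zeta>. f \<zeta> * P n \<zeta>) \<in> borel_measurable lborel" by simp
        qed
        finally show ?thesis .
      qed
      moreover have "(\<lambda>n. LINT \<zeta>|lborel. f \<zeta> * P n \<zeta>) \<longlonglongrightarrow> of_real pi * f z"
        unfolding P_def by (rule poisson_kernel_approximate_identity[OF f_cont Mf \<delta>])
      moreover have "f z = V z" using zG z \<psi>(2)[of z] by (simp add: f_def)
      ultimately show ?thesis by simp
    qed
    \<comment> \<open>\<open>E n\<close> is dominated by the modulus of the kernel it approximates,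
      so the integrand of the limit serves as majorant.\<close>
    have lim2: "(\<lambda>n. LINT \<zeta>|?M. u \<zeta> * E n \<zeta>) \<longlonglongrightarrow> (LINT \<zeta>|?M. u \<zeta> / (\<zeta> - z))"
      if iu: "integrable (?M) (\<lambda>\<zeta>. u \<zeta> / (\<zeta> - z))" and mu: "u \<in> borel_measurable (?M)" for u
    proof (rule integral_dominated_convergence[where w = "\<lambda>\<zeta>. norm (u \<zeta> / (\<zeta> - z))"])
      note [measurable] = mu
      show "(\<lambda>\<zeta>. u \<zeta> / (\<zeta> - z)) \<in> borel_measurable (?M)" by measurable
      show "(\<lambda>\<zeta>. u \<zeta> * E n \<zeta>) \<in> borel_measurable (?M)" for n by measurable
      show "integrable (?M) (\<lambda>\<zeta>. norm (u \<zeta> / (\<zeta> - z)))" using iu by (rule integrable_norm)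
      show "AE \<zeta> in ?M. (\<lambda>n. u \<zeta> * E n \<zeta>) \<longlonglongrightarrow> u \<zeta> / (\<zeta> - z)"
        using AE_neq[of z]
      proof eventually_elim
        case (elim \<zeta>)
        have "(\<lambda>n. u \<zeta> * E n \<zeta>) \<longlonglongrightarrow> u \<zeta> * (1 / (\<zeta> - z))" by (intro tendsto_intros E_lim elim)
        then show ?case by simp
      qed
      show "AE \<zeta> in ?M. norm (u \<zeta> * E n \<zeta>) \<le> norm (u \<zeta> / (\<zeta> - z))" for n
      proof (intro AE_I2)
        fix \<zeta>
        have "norm (u \<zeta> * E n \<zeta>) \<le> norm (u \<zeta>) * (1 / cmod (\<zeta> - z))"
          unfolding norm_mult by (intro mult_left_mono E_le) auto
        then show "norm (u \<zeta> * E n \<zeta>) \<le> norm (u \<zeta> / (\<zeta> - z))" by (simp add: norm_divide)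
      qed
    qed
    have "integrable (?M) (\<lambda>\<zeta>. h \<zeta> * (1 - \<psi> \<zeta>) / (\<zeta> - z))"
      using ih[OF integrable_density] \<psi>(2) by (intro integrable_Cauchy_kernel_away[OF _ _ z]) auto
    from Bochner_Integration.integrable_diff[OF integrable_Cauchy_kernel[of z] this]
    have ih\<psi>: "integrable (?M) (\<lambda>\<zeta>. h \<zeta> * \<psi> \<zeta> / (\<zeta> - z))"
      by (simp add: algebra_simps diff_divide_distrib)
    have iV: "integrable (?M) (\<lambda>\<zeta>. V \<zeta> * dbar \<psi> \<zeta> / (\<zeta> - z))"
      using iVd d\<psi>_in by (intro integrable_Cauchy_kernel_away[OF _ _ z]) auto
    have "(\<lambda>n. (LINT \<zeta>|?M. V \<zeta> * (\<psi> \<zeta> * P n \<zeta>)) + (LINT \<zeta>|?M. (V \<zeta> * dbar \<psi> \<zeta>) * E n \<zeta>))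
      \<longlonglongrightarrow> of_real pi * V z + (LINT \<zeta>|?M. V \<zeta> * dbar \<psi> \<zeta> / (\<zeta> - z))"
      using iVd by (intro tendsto_add lim1 lim2 iV) auto
    moreover have "(\<lambda>n. - (LINT \<zeta>|?M. (h \<zeta> * \<psi> \<zeta>) * E n \<zeta>)) \<longlonglongrightarrow> - (LINT \<zeta>|?M. h \<zeta> * \<psi> \<zeta> / (\<zeta> - z))"
      by (intro tendsto_minus lim2 ih\<psi>) measurable
    ultimately have eq: "of_real pi * V z + (LINT \<zeta>|?M. V \<zeta> * dbar \<psi> \<zeta> / (\<zeta> - z)) = - (LINT \<zeta>|?M. h \<zeta> * \<psi> \<zeta> / (\<zeta> - z))"
      using id by (simp only: mult.assoc LIMSEQ_unique)
    have "(LINT \<zeta>|?M. k \<zeta> / (\<zeta> - z)) = (LINT \<zeta>|?M. h \<zeta> / (\<zeta> - z) - h \<zeta> * \<psi> \<zeta> / (\<zeta> - z) - V \<zeta> * dbar \<psi> \<zeta> / (\<zeta> - z))"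
      by (intro Bochner_Integration.integral_cong refl) (simp add: k_def right_diff_distrib diff_divide_distrib)
    also have "\<dots> = (LINT \<zeta>|?M. h \<zeta> / (\<zeta> - z)) - (LINT \<zeta>|?M. h \<zeta> * \<psi> \<zeta> / (\<zeta> - z)) - (LINT \<zeta>|?M. V \<zeta> * dbar \<psi> \<zeta> / (\<zeta> - z))"
      using integrable_Cauchy_kernel[of z] ih\<psi> iV by (simp add: Bochner_Integration.integral_diff Bochner_Integration.integrable_diff)
    also have "\<dots> = (LINT \<zeta>|?M. h \<zeta> / (\<zeta> - z)) + of_real pi * V z"
    proof -
      have "x - u - v = x + p" if "p + v = - u" for x u v p :: complex
      proof -
        have "x - u - v = x + - u - v" by simp
        then show ?thesis unfolding that[symmetric] by simp
      qed
      from this[OF eq] show ?thesis .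
    qed
    finally show ?thesis by (simp add: T_op_def field_simps)
  qed
  have "(\<lambda>z. (1 / of_real pi) * (LINT \<zeta>|?M. k \<zeta> / (\<zeta> - z))) holomorphic_on ball z0 (r/2)"
    by (intro holomorphic_intros Cauchy_transform_holomorphic[OF ik k0])
  then show ?thesis
    by (rule holomorphic_transform) (use rep in auto)
qed

lemma holomorphic_on_diff_T_op: "(\<lambda>z. V z - T_op G h z) holomorphic_on G"
proof -
  have "\<exists>r>0. (\<lambda>z. V z - T_op G h z) holomorphic_on ball z0 r" if z0: "z0 \<in> G" for z0
  proof -
    obtain r where "0 < r" "cball z0 r \<subseteq> G" using open_G z0 open_contains_cball by blast
    then show ?thesis using local_representation[of r z0] by (intro exI[of _ "r/2"]) auto
  qed
  then have "(\<lambda>z. V z - T_op G h z) analytic_on G" by (auto simp: analytic_on_def)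
  then show ?thesis by (rule analytic_imp_holomorphic)
qed

end

section \<open>Cauchy's formula up to the boundary\<close>

text \<open>The global Cauchy formula takes a single closed path. Each loop is attached to the base
  point \<open>x\<close> by a path in \<open>U\<close> that is run out and back, so the connections
  cancel in every contour integral.\<close>

lemma join_loops:
  fixes c :: "'i \<Rightarrow> real \<Rightarrow> complex"
  assumes U: "open U" "connected U" "x \<in> U" and "finite I"
    and "\<And>i. i \<in> I \<Longrightarrow> valid_path (c i)" "\<And>i. i \<in> I \<Longrightarrow> pathfinish (c i) = pathstart (c i)"
    and "\<And>i. i \<in> I \<Longrightarrow> path_image (c i) \<subseteq> U"
  shows "\<exists>p. valid_path p \<and> pathstart p = x \<and> pathfinish p = x \<and> path_image p \<subseteq> U \<and>
    (\<forall>f. f holomorphic_on U \<longrightarrow> contour_integral p f = (\<Sum>i\<in>I. contour_integral (c i) f))"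
  using assms(4-)
proof (induction I rule: finite_induct)
  case empty
  show ?case using U by (intro exI[of _ "linepath x x"]) (simp only: valid_path_linepath
      pathstart_linepath pathfinish_linepath path_image_linepath closed_segment_idem contour_integral_trivial sum.empty, simp)
next
  case (insert i I)
  obtain p where p: "valid_path p" "pathstart p = x" "pathfinish p = x" "path_image p \<subseteq> U"
    "\<And>f. f holomorphic_on U \<Longrightarrow> contour_integral p f = (\<Sum>i\<in>I. contour_integral (c i) f)"
    using insert by auto
  have c: "valid_path (c i)" "pathfinish (c i) = pathstart (c i)" "path_image (c i) \<subseteq> U"
    using insert.prems by auto
  then have "pathstart (c i) \<in> U" by auto
  then obtain g where "polynomial_function g" "path_image g \<subseteq> U" "pathstart g = x" "pathfinish g = pathstart (c i)"
    using connected_open_polynomial_connected[OF U(1,2,3)] by blast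
  then have g: "valid_path g" "path_image g \<subseteq> U" "pathstart g = x" "pathfinish g = pathstart (c i)"
    by (auto simp: valid_path_polynomial_function)
  let ?l = "g +++ c i +++ reversepath g"
  have l: "valid_path ?l" "pathstart ?l = x" "pathfinish ?l = x" "path_image ?l \<subseteq> U"
    using g c by (auto simp: path_image_join)
  have "contour_integral (p +++ ?l) f = (\<Sum>i\<in>insert i I. contour_integral (c i) f)" if f: "f holomorphic_on U" for f
  proof -
    have int: "f contour_integrable_on q" if "valid_path q" "path_image q \<subseteq> U" for q
      using contour_integrable_holomorphic_simple[OF f U(1) that] .
    have ir: "f contour_integrable_on reversepath g" using g by (intro int) auto
    have icr: "f contour_integrable_on (c i +++ reversepath g)" using g c by (intro int) (auto simp: path_image_join)
    have "contour_integral ?l f = contour_integral g f + (contour_integral (c i) f + contour_integral (reversepath g) f)"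
      using int g c ir icr by (simp add: contour_integral_join)
    also have "\<dots> = contour_integral (c i) f" using g by (simp add: contour_integral_reversepath)
    finally show ?thesis
      using int[OF p(1,4)] int[OF l(1,4)] p l f insert.hyps by (simp add: contour_integral_join)
  qed
  moreover have "path_image (p +++ ?l) \<subseteq> U" using p l by (metis path_image_join Un_least)
  ultimately show ?case
    using p l by (intro exI[of _ "p +++ ?l"]) (simp add: valid_path_join)
qed

lemma homotopic_loops_Compl_imp_winding_number:
  assumes "path g" "path h" "pathfinish g = pathstart g" "pathfinish h = pathstart h"
    and "\<And>t. t \<in> {0..1} \<Longrightarrow> w \<notin> closed_segment (g t) (h t)"
  shows "winding_number g w = winding_number h w"
  using assms by (intro winding_number_homotopic_loops homotopic_loops_linear) auto

section \<open>Domains bounded by finitely many regular Jordan curves\<close>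

locale C1_Jordan_domain =
  fixes G :: "complex set" and \<Gamma> :: "(real \<Rightarrow> complex) set" and D :: "(real \<Rightarrow> complex) \<Rightarrow> real \<Rightarrow> complex"
  assumes domain: "open G" "connected G" "bounded G"
    and finite_boundary: "finite \<Gamma>"
    and curve: "\<And>\<gamma>. \<gamma> \<in> \<Gamma> \<Longrightarrow> C1_Jordan_curve \<gamma> (D \<gamma>)"
    and disjoint: "disjoint_family_on path_image \<Gamma>"
    and boundary: "(\<Union>\<gamma>\<in>\<Gamma>. path_image \<gamma>) = frontier G"
    and left: "\<And>\<gamma> t. \<gamma> \<in> \<Gamma> \<Longrightarrow> t \<in> {0..1} \<Longrightarrow> \<forall>\<^sub>F \<epsilon> in at_right 0. \<gamma> t + of_real \<epsilon> * (\<i> * D \<gamma> t) \<in> G"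
begin

lemma boundary_subset: "\<gamma> \<in> \<Gamma> \<Longrightarrow> path_image \<gamma> \<subseteq> frontier G"
  using boundary by auto

lemma G_Int_path_image: "\<gamma> \<in> \<Gamma> \<Longrightarrow> G \<inter> path_image \<gamma> = {}"
  using boundary_subset domain(1) by (fastforce simp: frontier_def interior_open)

lemma orientation:
  assumes "\<gamma> \<in> \<Gamma>"
  shows "G \<subseteq> inside (path_image \<gamma>) \<and> (\<forall>w\<in>inside (path_image \<gamma>). winding_number \<gamma> w = 1) \<or>
         G \<subseteq> outside (path_image \<gamma>) \<and> (\<forall>w\<in>inside (path_image \<gamma>). winding_number \<gamma> w = - 1)"
proof -
  interpret C1_Jordan_curve \<gamma> "D \<gamma>" by (rule curve[OF assms])
  show ?thesis
    using left[OF assms, of "1/2"] by (intro left_side_winding_number domain G_Int_path_image assms) auto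
qed

lemma winding_number_sum:
  assumes "z \<in> G"
  shows "(\<Sum>\<gamma>\<in>\<Gamma>. winding_number \<gamma> z) = 1"
    and "w \<notin> closure G \<Longrightarrow> (\<Sum>\<gamma>\<in>\<Gamma>. winding_number \<gamma> w) = 0"
proof -
  have ne: "G \<noteq> {}" using assms by auto
  note s = C1_Jordan_curve.simple[OF curve] and l = C1_Jordan_curve.loop[OF curve]
  show "(\<Sum>\<gamma>\<in>\<Gamma>. winding_number \<gamma> z) = 1"
    by (rule sum_winding_number_Jordan_boundary(1)[OF domain ne finite_boundary s l disjoint boundary orientation assms])
  show "(\<Sum>\<gamma>\<in>\<Gamma>. winding_number \<gamma> w) = 0" if "w \<notin> closure G"
    by (rule sum_winding_number_Jordan_boundary(2)[OF domain ne finite_boundary s l disjoint boundary orientation that])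
qed

text \<open>\<open>G\<close> lies on one side of the curve through \<open>w\<close>, so the other
  side is disjoint from \<open>closure G\<close>, and every point of a Jordan curve is a limit of
  points of either side. This allows winding numbers at frontier points to be read off from exterior
  points.\<close>

lemma boundary_point_exterior:
  assumes "w \<in> frontier G"
  shows "w \<in> closure (- closure G)"
proof -
  obtain \<gamma> where \<gamma>: "\<gamma> \<in> \<Gamma>" "w \<in> path_image \<gamma>" using assms boundary by auto
  interpret C1_Jordan_curve \<gamma> "D \<gamma>" by (rule curve[OF \<gamma>(1)])
  note part = Jordan_partition[OF simple loop]
  consider "G \<subseteq> inside (path_image \<gamma>)" | "G \<subseteq> outside (path_image \<gamma>)" using orientation[OF \<gamma>(1)] by blast
  then show ?thesis
  proof cases
    case 1
    then have "closure G \<subseteq> inside (path_image \<gamma>) \<union> path_image \<gamma>" using closure_mono part(5) by blast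
    then have "outside (path_image \<gamma>) \<subseteq> - closure G" using part(1,3) by blast
    then show ?thesis using closure_mono part(6) \<gamma>(2) by blast
  next
    case 2
    then have "closure G \<subseteq> outside (path_image \<gamma>) \<union> path_image \<gamma>" using closure_mono part(6) by blast
    then have "inside (path_image \<gamma>) \<subseteq> - closure G" using part(1,2) by blast
    then show ?thesis using closure_mono part(5) \<gamma>(2) by blast
  qed
qed

text \<open>The normal is only continuous; replacing it by a polynomial approximation makes the shifted
  curves \<open>C\<^sup>1\<close>.\<close>

lemma shift_into_domain:
  assumes \<gamma>: "\<gamma> \<in> \<Gamma>"
  obtains n n' \<epsilon>1 where "polynomial_function n" "polynomial_function n'"
    "\<And>t. (n has_vector_derivative n' t) (at t)" "n 1 = n 0" "0 < \<epsilon>1"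
    "\<And>t \<epsilon>. \<lbrakk>t \<in> {0..1}; 0 < \<epsilon>; \<epsilon> \<le> \<epsilon>1\<rbrakk> \<Longrightarrow> \<gamma> t + of_real \<epsilon> * n t \<in> G"
proof -
  interpret C1_Jordan_curve \<gamma> "D \<gamma>" by (rule curve[OF \<gamma>])
  obtain \<kappa> \<epsilon>0 where \<kappa>: "0 < \<kappa>" "0 < \<epsilon>0"
    "\<And>t d \<epsilon>. \<lbrakk>t \<in> {0..1}; cmod (d - \<i> * D \<gamma> t) \<le> \<kappa>; \<epsilon> \<noteq> 0; \<bar>\<epsilon>\<bar> \<le> \<epsilon>0\<rbrakk> \<Longrightarrow>
       \<gamma> t + of_real \<epsilon> * d \<notin> path_image \<gamma>"
    using transversal_off_curve by blast
  obtain m M where m: "0 < m" "\<And>t. t \<in> {0..1} \<Longrightarrow> m \<le> cmod (D \<gamma> t)" "\<And>t. t \<in> {0..1} \<Longrightarrow> cmod (D \<gamma> t) \<le> M"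
    using derivative_bounds by blast
  have M: "0 < M" using m(1) m(2)[of 0] m(3)[of 0] by auto
  define T where "T = (\<Union>\<delta>\<in>\<Gamma> - {\<gamma>}. path_image \<delta>)"
  have T: "closed T"
    unfolding T_def using finite_boundary C1_Jordan_curve.simple[OF curve]
    by (intro closed_UN) (auto intro: closed_simple_path_image)
  have PT: "path_image \<gamma> \<inter> T = {}"
    using disjoint \<gamma> unfolding T_def disjoint_family_on_def by blast
  obtain \<rho> where \<rho>: "0 < \<rho>" "\<And>x y. x \<in> path_image \<gamma> \<Longrightarrow> y \<in> T \<Longrightarrow> \<rho> \<le> dist x y"
    using separate_compact_closed[OF compact_simple_path_image[OF simple] T PT] by blast
  \<comment> \<open>The second term keeps the shifted point within \<open>\<rho> / 2\<close> of
    \<open>\<gamma> t\<close>, hence off the other boundary curves.\<close>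
  define \<epsilon>1 where "\<epsilon>1 = min \<epsilon>0 (\<rho> / (2 * (M + \<kappa>)))"
  have \<epsilon>1: "0 < \<epsilon>1" using \<kappa> \<rho> M by (simp add: \<epsilon>1_def)
  have off: "\<gamma> t + of_real \<epsilon> * d \<notin> frontier G"
    if t: "t \<in> {0..1}" and d: "cmod (d - \<i> * D \<gamma> t) \<le> \<kappa>" and \<epsilon>: "0 < \<epsilon>" "\<epsilon> \<le> \<epsilon>1" for t d \<epsilon>
  proof -
    have "\<gamma> t + of_real \<epsilon> * d \<notin> path_image \<gamma>" using \<kappa>(3)[OF t d, of \<epsilon>] \<epsilon> by (auto simp: \<epsilon>1_def)
    moreover have "\<gamma> t + of_real \<epsilon> * d \<notin> T"
    proof
      assume "\<gamma> t + of_real \<epsilon> * d \<in> T"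
      moreover have "\<gamma> t \<in> path_image \<gamma>" using t by (simp add: path_image_def)
      ultimately have "\<rho> \<le> \<epsilon> * cmod d" using \<rho>(2) \<epsilon> by (fastforce simp: dist_norm norm_mult)
      also have "cmod d \<le> cmod (\<i> * D \<gamma> t) + \<kappa>" using d norm_triangle_sub[of d "\<i> * D \<gamma> t"] by linarith
      then have "cmod d \<le> M + \<kappa>" using m(3)[OF t] by (simp add: norm_mult)
      then have "\<epsilon> * cmod d \<le> \<rho> / (2 * (M + \<kappa>)) * (M + \<kappa>)" using \<epsilon> M \<kappa> \<rho>(1) by (intro mult_mono) (auto simp: \<epsilon>1_def)
      also have "\<dots> = \<rho> / 2"
      proof -
        have "M + \<kappa> \<noteq> 0" using M \<kappa> by simp
        then show ?thesis by (simp add: divide_simps)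
      qed
      finally show False using \<rho>(1) by simp
    qed
    ultimately show ?thesis using boundary \<gamma> unfolding T_def by auto
  qed
  have inG: "\<gamma> t + of_real \<epsilon> * d \<in> G"
    if t: "t \<in> {0..1}" and d: "cmod (d - \<i> * D \<gamma> t) \<le> \<kappa>" and \<epsilon>: "0 < \<epsilon>" "\<epsilon> \<le> \<epsilon>1" for t d \<epsilon>
  proof -
    \<comment> \<open>\<open>left\<close> provides some small \<open>\<epsilon>\<close> depending on
      \<open>t\<close>, and only for the exact normal. All admissible shifts of
      \<open>\<gamma> t\<close> form a connected set that misses the frontier and meets
      \<open>G\<close> by \<open>left\<close>, so the whole set lies in \<open>G\<close>; this makes
      \<open>\<epsilon>1\<close> uniform and admits approximate normals.\<close>
    define X where "X = (\<lambda>p. \<gamma> t + of_real (fst p) * snd p) ` ({0<..\<epsilon>1} \<times> cball (\<i> * D \<gamma> t) \<kappa>)"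
    have "connected X" unfolding X_def
      by (intro connected_continuous_image continuous_intros connected_Times convex_connected) auto
    moreover have "X \<inter> frontier G = {}" unfolding X_def using off[OF t]
      by (auto simp: dist_norm norm_minus_commute)
    moreover have "X \<inter> G \<noteq> {}"
    proof -
      obtain \<epsilon>' where "\<epsilon>' \<in> {0<..<\<epsilon>1}" "\<gamma> t + of_real \<epsilon>' * (\<i> * D \<gamma> t) \<in> G"
        using eventually_happens'[OF trivial_limit_at_right_real eventually_conj[OF eventually_at_right_real[OF \<epsilon>1] left[OF \<gamma> t]]]
        by auto
      then show ?thesis unfolding X_def using \<kappa>(1)
        by (auto intro!: image_eqI[of _ _ "(\<epsilon>', \<i> * D \<gamma> t)"])
    qed
    ultimately have "X \<subseteq> G" using connected_Int_frontier[of X G] by blast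
    moreover have "\<gamma> t + of_real \<epsilon> * d \<in> X"
      unfolding X_def using d \<epsilon> by (intro image_eqI[of _ _ "(\<epsilon>, d)"]) (auto simp: dist_norm norm_minus_commute)
    ultimately show ?thesis by auto
  qed
  have "path (\<lambda>t. \<i> * D \<gamma> t)" unfolding path_def by (intro continuous_intros cont_deriv)
  \<comment> \<open>The approximation keeps the end values, and \<open>D \<gamma>\<close> agrees at
    \<open>0\<close> and \<open>1\<close>, so the shifted curve is closed.\<close>
  then obtain n where n: "polynomial_function n" "pathstart n = \<i> * D \<gamma> 0" "pathfinish n = \<i> * D \<gamma> 1"
    "\<And>t. t \<in> {0..1} \<Longrightarrow> norm (n t - \<i> * D \<gamma> t) < \<kappa>"
    using path_approx_polynomial_function[OF _ \<kappa>(1)] by (auto simp: pathstart_def pathfinish_def)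
  obtain n' where n': "polynomial_function n'" "\<And>t. (n has_vector_derivative n' t) (at t)"
    using has_vector_derivative_polynomial_function[OF n(1)] by blast
  have "n 1 = n 0" using n(2,3) deriv_loop by (simp add: pathstart_def pathfinish_def)
  moreover have "\<gamma> t + of_real \<epsilon> * n t \<in> G" if "t \<in> {0..1}" "0 < \<epsilon>" "\<epsilon> \<le> \<epsilon>1" for t \<epsilon>
    using inG[OF that(1) _ that(2,3)] n(4)[OF that(1)] by auto
  ultimately show ?thesis using that n n' \<epsilon>1 by blast
qed

proposition Cauchy_integral_formula_boundary:
  assumes u: "u holomorphic_on G" "continuous_on (closure G) u" and z: "z \<in> G"
  shows "(\<Sum>\<gamma>\<in>\<Gamma>. contour_integral \<gamma> (\<lambda>t. u t / (t - z))) = 2 * of_real pi * \<i> * u z"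
proof -
  let ?K = "\<lambda>t. u t / (t - z)"
  define Q where "Q \<gamma> n n' \<epsilon>1 \<longleftrightarrow> polynomial_function n \<and> polynomial_function n' \<and>
      (\<forall>t. (n has_vector_derivative n' t) (at t)) \<and> n 1 = n 0 \<and> 0 < \<epsilon>1 \<and>
      (\<forall>t \<epsilon>. t \<in> {0..1} \<longrightarrow> 0 < \<epsilon> \<longrightarrow> \<epsilon> \<le> \<epsilon>1 \<longrightarrow> \<gamma> t + of_real \<epsilon> * n t \<in> G)"
    for \<gamma> :: "real \<Rightarrow> complex" and n n' :: "real \<Rightarrow> complex" and \<epsilon>1 :: real
  have "\<exists>n n' \<epsilon>1. Q \<gamma> n n' \<epsilon>1" if "\<gamma> \<in> \<Gamma>" for \<gamma>
    using shift_into_domain[OF that] unfolding Q_def by metis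
  then obtain N N' E where Q: "\<And>\<gamma>. \<gamma> \<in> \<Gamma> \<Longrightarrow> Q \<gamma> (N \<gamma>) (N' \<gamma>) (E \<gamma>)"
    by metis
  then have N: "\<And>\<gamma>. \<gamma> \<in> \<Gamma> \<Longrightarrow> polynomial_function (N \<gamma>)" "\<And>\<gamma>. \<gamma> \<in> \<Gamma> \<Longrightarrow> polynomial_function (N' \<gamma>)"
      "\<And>\<gamma> t. \<gamma> \<in> \<Gamma> \<Longrightarrow> (N \<gamma> has_vector_derivative N' \<gamma> t) (at t)" "\<And>\<gamma>. \<gamma> \<in> \<Gamma> \<Longrightarrow> N \<gamma> 1 = N \<gamma> 0" "\<And>\<gamma>. \<gamma> \<in> \<Gamma> \<Longrightarrow> 0 < E \<gamma>"
      "\<And>\<gamma> t \<epsilon>. \<gamma> \<in> \<Gamma> \<Longrightarrow> t \<in> {0..1} \<Longrightarrow> 0 < \<epsilon> \<Longrightarrow> \<epsilon> \<le> E \<gamma> \<Longrightarrow> \<gamma> t + of_real \<epsilon> * N \<gamma> t \<in> G"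
    unfolding Q_def by blast+
  obtain \<rho> where \<rho>: "0 < \<rho>" "ball z \<rho> \<subseteq> G" using domain(1) z open_contains_ball by blast
  have Nc: "continuous_on {0..1} (N \<gamma>)" "continuous_on {0..1} (N' \<gamma>)" if "\<gamma> \<in> \<Gamma>" for \<gamma>
    using N(1,2)[OF that] by (auto intro: continuous_on_polymonial_function)
  have "\<forall>\<gamma>\<in>\<Gamma>. \<exists>B>0. \<forall>t\<in>{0..1}. cmod (N \<gamma> t) \<le> B"
  proof
    fix \<gamma> assume "\<gamma> \<in> \<Gamma>"
    then have "bounded (N \<gamma> ` {0..1})" by (intro compact_imp_bounded compact_continuous_image Nc compact_Icc)
    then show "\<exists>B>0. \<forall>t\<in>{0..1}. cmod (N \<gamma> t) \<le> B" by (auto simp: bounded_pos)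
  qed
  then obtain B where B: "\<And>\<gamma>. \<gamma> \<in> \<Gamma> \<Longrightarrow> 0 < B \<gamma>" "\<And>\<gamma> t. \<gamma> \<in> \<Gamma> \<Longrightarrow> t \<in> {0..1} \<Longrightarrow> cmod (N \<gamma> t) \<le> B \<gamma>"
    by metis
  \<comment> \<open>One shift size for all curves: inside \<open>G\<close>, at distance at least
    \<open>\<rho> / 2\<close> from \<open>z\<close>, and at most \<open>1\<close>, the last for the
    majorant in the limit. Inserting \<open>1\<close> also keeps the set nonempty.\<close>
  define \<epsilon>0 where "\<epsilon>0 = Min (insert 1 ((\<lambda>\<gamma>. min (E \<gamma>) (\<rho> / (2 * B \<gamma>))) ` \<Gamma>))"
  have \<epsilon>0: "0 < \<epsilon>0" unfolding \<epsilon>0_def using finite_boundary N(5) B(1) \<rho>(1) by (subst Min_gr_iff) auto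
  have \<epsilon>0E: "\<epsilon>0 \<le> E \<gamma>" "\<epsilon>0 \<le> \<rho> / (2 * B \<gamma>)" "\<epsilon>0 \<le> 1" if "\<gamma> \<in> \<Gamma>" for \<gamma>
  proof -
    have "\<epsilon>0 \<le> min (E \<gamma>) (\<rho> / (2 * B \<gamma>))" "\<epsilon>0 \<le> 1"
      unfolding \<epsilon>0_def using finite_boundary that by (intro Min_le finite.insertI finite_imageI; blast)+
    then show "\<epsilon>0 \<le> E \<gamma>" "\<epsilon>0 \<le> \<rho> / (2 * B \<gamma>)" "\<epsilon>0 \<le> 1" by auto
  qed
  define c where "c \<epsilon> \<gamma> t = \<gamma> t + of_real \<epsilon> * N \<gamma> t" for \<epsilon> \<gamma> t
  have cG: "c \<epsilon> \<gamma> t \<in> G" if "\<gamma> \<in> \<Gamma>" "t \<in> {0..1}" "0 < \<epsilon>" "\<epsilon> \<le> \<epsilon>0" for \<epsilon> \<gamma> t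
    unfolding c_def using N(6)[OF that(1-3)] \<epsilon>0E(1)[OF that(1)] that(4) by simp
  have far0: "\<rho> \<le> cmod (\<gamma> t - z)" if "\<gamma> \<in> \<Gamma>" "t \<in> {0..1}" for \<gamma> t
  proof -
    have "\<gamma> t \<in> path_image \<gamma>" using that(2) by (simp add: path_image_def)
    then have "\<gamma> t \<notin> G" using G_Int_path_image[OF that(1)] by blast
    then have "\<gamma> t \<notin> ball z \<rho>" using \<rho>(2) by blast
    then show ?thesis by (simp add: dist_norm norm_minus_commute)
  qed
  have far: "\<rho> / 2 \<le> cmod (c \<epsilon> \<gamma> t - z)" if "\<gamma> \<in> \<Gamma>" "t \<in> {0..1}" "0 \<le> \<epsilon>" "\<epsilon> \<le> \<epsilon>0" for \<epsilon> \<gamma> t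
  proof -
    have "\<epsilon> * cmod (N \<gamma> t) \<le> \<rho> / (2 * B \<gamma>) * B \<gamma>"
      using \<epsilon>0E(2)[OF that(1)] that B[OF that(1)] by (intro mult_mono) auto
    then have "cmod (of_real \<epsilon> * N \<gamma> t) \<le> \<rho> / 2" using B(1)[OF that(1)] that(3) by (simp add: norm_mult)
    then show ?thesis
      using far0[OF that(1,2)] norm_diff_ineq[of "\<gamma> t - z" "of_real \<epsilon> * N \<gamma> t"] by (simp add: c_def algebra_simps)
  qed
  have vp: "valid_path (c \<epsilon> \<gamma>)" if "\<gamma> \<in> \<Gamma>" for \<epsilon> \<gamma>
  proof -
    have "polynomial_function (\<lambda>t. of_real \<epsilon> * N \<gamma> t)"
      using N(1)[OF that] by (simp add: polynomial_function_cmul flip: scaleR_conv_of_real)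
    then have "valid_path (\<lambda>t. of_real \<epsilon> * N \<gamma> t)" by (rule valid_path_polynomial_function)
    then show ?thesis
      using C1_Jordan_curve.valid_path[OF curve[OF that]]
      unfolding c_def[abs_def] valid_path_def by (rule piecewise_C1_differentiable_add[rotated])
  qed
  have vp0: "path \<gamma>" "pathfinish \<gamma> = pathstart \<gamma>" if "\<gamma> \<in> \<Gamma>" for \<gamma>
    using C1_Jordan_curve.simple[OF curve[OF that]] C1_Jordan_curve.loop[OF curve[OF that]]
    by (auto simp: simple_path_imp_path)
  have lp: "pathfinish (c \<epsilon> \<gamma>) = pathstart (c \<epsilon> \<gamma>)" if "\<gamma> \<in> \<Gamma>" for \<epsilon> \<gamma>
    using vp0(2)[OF that] N(4)[OF that] by (simp add: c_def pathfinish_def pathstart_def)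
  \<comment> \<open>The straight homotopy from \<open>\<gamma>\<close> to the shifted curve stays in
    \<open>closure G\<close> and away from \<open>z\<close>, so it changes the winding number
    neither at \<open>z\<close> nor at exterior points.\<close>
  have seg: "x \<in> closure G \<and> \<rho> / 2 \<le> cmod (x - z)"
    if A: "\<gamma> \<in> \<Gamma>" "t \<in> {0..1}" "0 < \<epsilon>" "\<epsilon> \<le> \<epsilon>0" "x \<in> closed_segment (\<gamma> t) (c \<epsilon> \<gamma> t)" for \<epsilon> \<gamma> t x
  proof -
    obtain s where s: "0 \<le> s" "s \<le> 1" "x = (1 - s) *\<^sub>R \<gamma> t + s *\<^sub>R c \<epsilon> \<gamma> t"
      using A(5) by (auto simp: in_segment)
    then have x: "x = c (s * \<epsilon>) \<gamma> t" by (simp add: c_def scaleR_conv_of_real algebra_simps)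
    have se: "s * \<epsilon> \<le> \<epsilon>0" using s A(3,4) mult_right_mono[of s 1 \<epsilon>] by linarith
    have "x \<in> closure G"
    proof (cases "s = 0")
      case True
      then have "x \<in> path_image \<gamma>" using A(2) s(3) by (simp add: path_image_def)
      then show ?thesis using boundary_subset[OF A(1)] by (auto simp: frontier_def)
    next
      case False
      then show ?thesis unfolding x using cG[OF A(1,2), of "s * \<epsilon>"] s A(3) se closure_subset by auto
    qed
    then show ?thesis using far[OF A(1,2), of "s * \<epsilon>"] s A(3) se unfolding x by auto
  qed
  have wn: "winding_number (c \<epsilon> \<gamma>) w = winding_number \<gamma> w"
    if A: "\<gamma> \<in> \<Gamma>" "0 < \<epsilon>" "\<epsilon> \<le> \<epsilon>0" "w = z \<or> w \<notin> closure G" for \<epsilon> \<gamma> w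
  proof (rule sym, rule homotopic_loops_Compl_imp_winding_number)
    show "path (c \<epsilon> \<gamma>)" using vp[OF A(1)] by (rule valid_path_imp_path)
    show "w \<notin> closed_segment (\<gamma> t) (c \<epsilon> \<gamma> t)" if t: "t \<in> {0..1}" for t
      using seg[OF A(1) t A(2,3), of w] A(4) \<rho>(1) by auto
  qed (use vp0[OF A(1)] lp[OF A(1)] in auto)
  have pic: "path_image (c \<epsilon> \<gamma>) \<subseteq> G - {z}" if "\<gamma> \<in> \<Gamma>" "0 < \<epsilon>" "\<epsilon> \<le> \<epsilon>0" for \<epsilon> \<gamma>
    using cG[OF that(1) _ that(2,3)] far[OF that(1) _ _ that(3)] that(2) \<rho>(1) by (fastforce simp: path_image_def)
  have wz: "(\<Sum>\<gamma>\<in>\<Gamma>. winding_number (c \<epsilon> \<gamma>) z) = 1" if "0 < \<epsilon>" "\<epsilon> \<le> \<epsilon>0" for \<epsilon>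
    using winding_number_sum(1)[OF z] wn that by simp
  have wext: "(\<Sum>\<gamma>\<in>\<Gamma>. winding_number (c \<epsilon> \<gamma>) w) = 0" if e: "0 < \<epsilon>" "\<epsilon> \<le> \<epsilon>0" and w: "w \<notin> G" for \<epsilon> w
  proof (cases "w \<in> closure G")
    case False
    then show ?thesis using winding_number_sum(2)[OF z False] wn e by simp
  next
    case True
    \<comment> \<open>The homotopy starts on the frontier and may pass through \<open>w\<close>.
      Instead, the winding numbers of the shifted curves are locally constant near \<open>w\<close>,
      and some nearby point is exterior.\<close>
    then have "w \<in> frontier G" using w domain(1) by (simp add: frontier_def interior_open)
    then have wcl: "w \<in> closure (- closure G)" by (rule boundary_point_exterior)
    define U where "U = (\<Inter>\<gamma>\<in>\<Gamma>. {x. x \<notin> path_image (c \<epsilon> \<gamma>) \<and> winding_number (c \<epsilon> \<gamma>) x = winding_number (c \<epsilon> \<gamma>) w})"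
    have "open U" unfolding U_def using finite_boundary vp lp
      by (intro open_INT ballI open_winding_number_levelsets) (auto intro: valid_path_imp_path)
    moreover have "w \<in> U" unfolding U_def using pic[OF _ e] w by auto
    ultimately obtain x where x: "x \<in> U" "x \<notin> closure G"
      using wcl open_Int_closure_eq_empty[of U "- closure G"] by blast
    have "(\<Sum>\<gamma>\<in>\<Gamma>. winding_number (c \<epsilon> \<gamma>) w) = (\<Sum>\<gamma>\<in>\<Gamma>. winding_number (c \<epsilon> \<gamma>) x)"
      using x(1) unfolding U_def by (intro sum.cong) auto
    also have "\<dots> = 0" using winding_number_sum(2)[OF z x(2)] wn e x(2) by simp
    finally show ?thesis .
  qed
  have shifted: "(\<Sum>\<gamma>\<in>\<Gamma>. contour_integral (c \<epsilon> \<gamma>) ?K) = 2 * of_real pi * \<i> * u z"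
    if e: "0 < \<epsilon>" "\<epsilon> \<le> \<epsilon>0" for \<epsilon>
  proof -
    \<comment> \<open>Without \<open>z\<close> the integrand and the kernel
      \<open>1 / (x - z)\<close> are holomorphic on the set in which the curves are joined, and
      deleting a point from a plane domain keeps it connected.\<close>
    have "open (G - {z})" "connected (G - {z})" using domain by (auto simp: connected_open_delete)
    moreover have "z + of_real (\<rho>/2) \<in> G - {z}" using \<rho> by (auto simp: dist_norm subset_eq)
    ultimately obtain p where p: "valid_path p" "pathfinish p = pathstart p" "path_image p \<subseteq> G - {z}"
      "\<And>f. f holomorphic_on G - {z} \<Longrightarrow> contour_integral p f = (\<Sum>\<gamma>\<in>\<Gamma>. contour_integral (c \<epsilon> \<gamma>) f)"
      using join_loops[of "G - {z}" _ \<Gamma> "c \<epsilon>"] finite_boundary vp lp pic e by metis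
    have wp: "winding_number p w = (\<Sum>\<gamma>\<in>\<Gamma>. winding_number (c \<epsilon> \<gamma>) w)" if "w \<notin> G - {z}" for w
    proof -
      have "(\<lambda>x. 1 / (x - w)) holomorphic_on G - {z}" using that by (intro holomorphic_intros) auto
      note h = p(4)[OF this]
      have "winding_number p w = 1 / (2 * pi * \<i>) * contour_integral p (\<lambda>x. 1 / (x - w))"
        using that p by (intro winding_number_valid_path) auto
      also have "\<dots> = (\<Sum>\<gamma>\<in>\<Gamma>. 1 / (2 * pi * \<i>) * contour_integral (c \<epsilon> \<gamma>) (\<lambda>x. 1 / (x - w)))"
        unfolding h by (rule sum_distrib_left)
      also have "\<dots> = (\<Sum>\<gamma>\<in>\<Gamma>. winding_number (c \<epsilon> \<gamma>) w)"
        using that pic[OF _ e] vp by (intro sum.cong refl winding_number_valid_path[symmetric]) auto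
      finally show ?thesis .
    qed
    have "((\<lambda>w. u w / (w - z)) has_contour_integral (2 * pi * \<i> * winding_number p z * u z)) p"
      using wp wext[OF e] by (intro Cauchy_integral_formula_global[OF domain(1) u(1) z p(1,3,2)]) auto
    then have c1: "contour_integral p (\<lambda>w. u w / (w - z)) = 2 * of_real pi * \<i> * u z"
      using wp[of z] wz[OF e] by (simp add: contour_integral_unique)
    have c2: "(\<lambda>w. u w / (w - z)) holomorphic_on G - {z}"
      by (intro holomorphic_intros holomorphic_on_subset[OF u(1)]) auto
    show ?thesis by (rule trans[OF p(4)[OF c2, symmetric] c1])
  qed
  define \<epsilon> where "\<epsilon> k = \<epsilon>0 / real (Suc k)" for k
  have \<epsilon>: "0 < \<epsilon> k" "\<epsilon> k \<le> \<epsilon>0" for k using \<epsilon>0 by (auto simp: \<epsilon>_def divide_simps)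
  have \<epsilon>_lim: "\<epsilon> \<longlonglongrightarrow> 0"
    using tendsto_mult_left[OF LIMSEQ_inverse_real_of_nat, of \<epsilon>0] by (simp add: \<epsilon>_def[abs_def] divide_inverse)
  have lim: "(\<lambda>k. contour_integral (c (\<epsilon> k) \<gamma>) ?K) \<longlonglongrightarrow> contour_integral \<gamma> ?K"
    if \<gamma>: "\<gamma> \<in> \<Gamma>" for \<gamma>
  proof -
    interpret C1_Jordan_curve \<gamma> "D \<gamma>" by (rule curve[OF \<gamma>])
    have dc: "(c e \<gamma> has_vector_derivative (D \<gamma> t + of_real e * N' \<gamma> t)) (at t within {0..1})" if "t \<in> {0..1}" for t e
      unfolding c_def[abs_def]
      using deriv[OF that] has_vector_derivative_at_within[OF N(3)[OF \<gamma>, of t]]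
      by (intro has_vector_derivative_add has_vector_derivative_mult_right)
    have clc: "c (\<epsilon> k) \<gamma> t \<in> closure G" if "t \<in> {0..1}" for k t
      using cG[OF \<gamma> that \<epsilon>] closure_subset by blast
    have cont_c: "continuous_on {0..1} (c e \<gamma>)" for e
      unfolding c_def[abs_def] by (intro continuous_intros continuous Nc \<gamma>)
    have nz: "c (\<epsilon> k) \<gamma> t - z \<noteq> 0" if "t \<in> {0..1}" for k t
      using far[OF \<gamma> that, of "\<epsilon> k"] \<epsilon>[of k] \<rho>(1) by auto
    have nz0: "\<gamma> t - z \<noteq> 0" if "t \<in> {0..1}" for t using far0[OF \<gamma> that] \<rho>(1) by auto
    have "bounded (u ` closure G)"
      using domain(3) by (intro compact_imp_bounded compact_continuous_image u) simp
    then obtain Mu where Mu: "\<And>x. x \<in> closure G \<Longrightarrow> cmod (u x) \<le> Mu" by (auto simp: bounded_iff)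
    have Mu0: "0 \<le> Mu" using Mu[of z] z closure_subset[of G] by (meson in_mono norm_ge_zero order_trans)
    \<comment> \<open>Majorant for the shifted integrals: \<open>Mu\<close> bounds \<open>u\<close>
      on the compact closure, \<open>\<rho>/2\<close> bounds the distance to \<open>z\<close> from
      below, and \<open>\<epsilon> k \<le> 1\<close> controls the derivative.\<close>
    define h where "h t = Mu / (\<rho>/2) * (cmod (D \<gamma> t) + cmod (N' \<gamma> t))" for t
    let ?I = "\<lambda>k t. u (c (\<epsilon> k) \<gamma> t) / (c (\<epsilon> k) \<gamma> t - z) * (D \<gamma> t + of_real (\<epsilon> k) * N' \<gamma> t)"
    have "(\<lambda>k. integral {0..1} (\<lambda>t. ?I k t))
      \<longlonglongrightarrow> integral {0..1} (\<lambda>t. u (\<gamma> t) / (\<gamma> t - z) * D \<gamma> t)"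
    proof (rule dominated_convergence(2)[where h = h])
      show "h integrable_on {0..1}" unfolding h_def
        by (intro integrable_continuous_interval continuous_intros cont_deriv Nc \<gamma>)
      fix k
      show "(\<lambda>t. ?I k t) integrable_on {0..1}"
        using nz clc
        by (intro integrable_continuous_interval continuous_intros cont_deriv Nc \<gamma> cont_c continuous_on_compose2[OF u(2)]) auto
      fix t :: real assume t: "t \<in> {0..1}"
      have "cmod (D \<gamma> t + of_real (\<epsilon> k) * N' \<gamma> t) \<le> cmod (D \<gamma> t) + \<epsilon> k * cmod (N' \<gamma> t)"
        using norm_triangle_ineq[of "D \<gamma> t" "of_real (\<epsilon> k) * N' \<gamma> t"] \<epsilon>(1)[of k] by (simp add: norm_mult)
      also have "\<dots> \<le> cmod (D \<gamma> t) + 1 * cmod (N' \<gamma> t)"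
        using \<epsilon>(2)[of k] \<epsilon>0E(3)[OF \<gamma>] by (intro add_left_mono mult_right_mono) auto
      finally have "cmod (D \<gamma> t + of_real (\<epsilon> k) * N' \<gamma> t) \<le> cmod (D \<gamma> t) + cmod (N' \<gamma> t)" by simp
      moreover have "cmod (u (c (\<epsilon> k) \<gamma> t)) / cmod (c (\<epsilon> k) \<gamma> t - z) \<le> Mu / (\<rho>/2)"
        using Mu[OF clc[OF t]] far[OF \<gamma> t less_imp_le[OF \<epsilon>(1)] \<epsilon>(2)] \<rho>(1) Mu0 by (intro frac_le) auto
      ultimately show "norm (?I k t) \<le> h t"
        unfolding h_def norm_mult norm_divide using Mu0 \<rho>(1) by (intro mult_mono) auto
    next
      fix t :: real assume t: "t \<in> {0..1}"
      have cl: "(\<lambda>k. c (\<epsilon> k) \<gamma> t) \<longlonglongrightarrow> \<gamma> t + of_real 0 * N \<gamma> t"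
        unfolding c_def by (intro tendsto_intros \<epsilon>_lim)
      then have cl: "(\<lambda>k. c (\<epsilon> k) \<gamma> t) \<longlonglongrightarrow> \<gamma> t" by simp
      have "\<gamma> t \<in> closure G"
        using boundary_subset[OF \<gamma>] t unfolding path_image_def frontier_def by blast
      then have "(\<lambda>k. u (c (\<epsilon> k) \<gamma> t)) \<longlonglongrightarrow> u (\<gamma> t)"
        using clc[OF t] by (intro continuous_on_tendsto_compose[OF u(2) cl]) auto
      then have "(\<lambda>k. ?I k t)
        \<longlonglongrightarrow> u (\<gamma> t) / (\<gamma> t - z) * (D \<gamma> t + of_real 0 * N' \<gamma> t)"
        using nz0[OF t] by (intro tendsto_intros cl \<epsilon>_lim)
      then show "(\<lambda>k. ?I k t)
        \<longlonglongrightarrow> u (\<gamma> t) / (\<gamma> t - z) * D \<gamma> t" by simp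
    qed
    then show ?thesis
      by (simp only: contour_integral_has_vector_derivative[OF dc] contour_integral_has_vector_derivative[OF deriv])
  qed
  have "(\<lambda>k. \<Sum>\<gamma>\<in>\<Gamma>. contour_integral (c (\<epsilon> k) \<gamma>) ?K) \<longlonglongrightarrow> (\<Sum>\<gamma>\<in>\<Gamma>. contour_integral \<gamma> ?K)"
    by (intro tendsto_sum lim)
  then show ?thesis unfolding shifted[OF \<epsilon>] by (simp add: LIMSEQ_const_iff)
qed

end

section \<open>The integral representation\<close>

lemma closed_C1_Holder_curve_imp_C1_Jordan_curve:
  assumes c: "closed_C1_Holder_curve \<alpha> \<gamma>" and \<alpha>: "0 < \<alpha>"
  shows "C1_Jordan_curve \<gamma> (\<lambda>t. vector_derivative \<gamma> (at t within {0..1}))"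
proof -
  let ?d = "\<lambda>t. vector_derivative \<gamma> (at t within {0..1})"
  obtain C where C: "\<And>s t. s \<in> {0..1} \<Longrightarrow> t \<in> {0..1} \<Longrightarrow> dist (?d s) (?d t) \<le> C * \<bar>s - t\<bar> powr \<alpha>"
    using c unfolding closed_C1_Holder_curve_def by blast
  have cont: "continuous_on {0..1} ?d"
    unfolding continuous_on
  proof
    fix t :: real assume t: "t \<in> {0..1}"
    show "(?d \<longlongrightarrow> ?d t) (at t within {0..1})"
    proof (rule LIM_zero_cancel, rule Lim_null_comparison)
      show "\<forall>\<^sub>F s in at t within {0..1}. norm (?d s - ?d t) \<le> C * \<bar>s - t\<bar> powr \<alpha>"
        unfolding eventually_at_filter using C[OF _ t] by (intro always_eventually) (auto simp: dist_norm)
      have "((\<lambda>s. C * \<bar>s - t\<bar> powr \<alpha>) \<longlongrightarrow> C * \<bar>t - t\<bar> powr \<alpha>) (at t within {0..1})"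
        using \<alpha> by (intro tendsto_intros) auto
      then show "((\<lambda>s. C * \<bar>s - t\<bar> powr \<alpha>) \<longlongrightarrow> 0) (at t within {0..1})" by simp
    qed
  qed
  show ?thesis
    using c cont unfolding closed_C1_Holder_curve_def
    by unfold_locales (auto simp: vector_derivative_works)
qed

text \<open>Partial fractions: \<open>1 / ((\<zeta> - x) * (x - z))\<close> is
  \<open>1 / (\<zeta> - z)\<close> times the difference of the Cauchy kernels at \<open>z\<close>
  and at \<open>\<zeta>\<close>.\<close>

lemma (in C1_Jordan_curve) integral_difference_Cauchy_kernels:
  assumes "z \<notin> path_image \<gamma>" "\<zeta> \<notin> path_image \<gamma>" "\<zeta> \<noteq> z"
  shows "integral {0..1} (\<lambda>t. 1 / (\<zeta> - \<gamma> t) * (\<gamma>' t / (\<gamma> t - z))) =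
    2 * of_real pi * \<i> / (\<zeta> - z) * (winding_number \<gamma> z - winding_number \<gamma> \<zeta>)"
proof -
  have nz: "\<gamma> t - z \<noteq> 0" "\<zeta> - \<gamma> t \<noteq> 0" "\<gamma> t - \<zeta> \<noteq> 0" if "t \<in> {0..1}" for t
    using assms that by (auto simp: path_image_def)
  have c: "continuous_on {0..1} (\<lambda>t. 1 / (\<gamma> t - z) * \<gamma>' t)" "continuous_on {0..1} (\<lambda>t. 1 / (\<gamma> t - \<zeta>) * \<gamma>' t)"
    using nz by (auto intro!: continuous_intros continuous cont_deriv)
  have w: "2 * of_real pi * \<i> * winding_number \<gamma> x = integral {0..1} (\<lambda>t. 1 / (\<gamma> t - x) * \<gamma>' t)"
    if "x \<notin> path_image \<gamma>" for x
    using winding_number_valid_path[OF valid_path that] by (simp add: contour_integral_eq)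
  have "integral {0..1} (\<lambda>t. 1 / (\<zeta> - \<gamma> t) * (\<gamma>' t / (\<gamma> t - z))) =
    integral {0..1} (\<lambda>t. 1 / (\<zeta> - z) * (1 / (\<gamma> t - z) * \<gamma>' t - 1 / (\<gamma> t - \<zeta>) * \<gamma>' t))"
  proof (rule Henstock_Kurzweil_Integration.integral_cong)
    fix t :: real assume t: "t \<in> {0..1}"
    have "1 / (\<zeta> - x) * (d / (x - z)) = 1 / (\<zeta> - z) * (1 / (x - z) * d - 1 / (x - \<zeta>) * d)"
      if "x - z \<noteq> 0" "\<zeta> - x \<noteq> 0" "x - \<zeta> \<noteq> 0" for x d
      using that assms(3) by (simp add: divide_simps) (simp add: algebra_simps)
    then show "1 / (\<zeta> - \<gamma> t) * (\<gamma>' t / (\<gamma> t - z)) = 1 / (\<zeta> - z) * (1 / (\<gamma> t - z) * \<gamma>' t - 1 / (\<gamma> t - \<zeta>) * \<gamma>' t)"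
      using nz[OF t] by blast
  qed
  also have "\<dots> = 1 / (\<zeta> - z) * (2 * of_real pi * \<i> * winding_number \<gamma> z - 2 * of_real pi * \<i> * winding_number \<gamma> \<zeta>)"
    unfolding w[OF assms(1)] w[OF assms(2)] using c
    by (simp only: integral_mult_right integral_diff[OF integrable_continuous_interval integrable_continuous_interval])
  finally show ?thesis by (simp only: right_diff_distrib) simp
qed

locale dbar_boundary_problem = C1_Jordan_domain G \<Gamma> D + weak_dbar_solution G a \<beta> C h V
  for G \<Gamma> D a \<beta> C h V +
  assumes V_cont_closure: "continuous_on (closure G) V"
begin

text \<open>By Fubini this reduces to the kernel \<open>1 / ((\<zeta> - t) (t - z))\<close> with \<open>\<zeta>, z \<in> G\<close>, whose
  integral is a multiple of the difference of two winding numbers, and these agree.\<close>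

lemma Cauchy_integral_T_op:
  assumes \<gamma>: "\<gamma> \<in> \<Gamma>" and z: "z \<in> G"
  shows "contour_integral \<gamma> (\<lambda>t. T_op G h t / (t - z)) = 0"
proof -
  interpret C1_Jordan_curve \<gamma> "D \<gamma>" by (rule curve[OF \<gamma>])
  let ?M1 = "lebesgue_on {0..1::real}" and ?M2 = "lebesgue_on G"
  have off: "x \<notin> path_image \<gamma>" if "x \<in> G" for x using G_Int_path_image[OF \<gamma>] that by blast
  have nz: "\<gamma> t - x \<noteq> 0" if "t \<in> {0..1}" "x \<in> G" for t x
    using off[OF that(2)] that(1) by (auto simp: path_image_def)
  define w where "w t = D \<gamma> t / (\<gamma> t - z)" for t
  have w_cont: "continuous_on {0..1} w"
    unfolding w_def using nz z by (intro continuous_intros continuous cont_deriv) auto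
  define f where "f t \<zeta> = h \<zeta> / (\<zeta> - \<gamma> t) * w t" for t \<zeta>
  have fin1: "finite_measure ?M1" by (rule finite_measure_lebesgue_on) auto
  have fin2: "finite_measure ?M2"
    using bounded_G open_G by (intro finite_measure_lebesgue_on) (auto intro: lmeasurable_open)
  interpret M1: finite_measure ?M1 by (rule fin1)
  interpret M2: finite_measure ?M2 by (rule fin2)
  interpret P: pair_sigma_finite ?M1 ?M2 ..
  have meas1: "g \<in> borel_measurable ?M1" if "continuous_on {0..1} g" for g :: "real \<Rightarrow> complex"
    using that by (intro continuous_imp_measurable_on_sets_lebesgue) auto
  note [measurable] = h_meas measurable_id_lebesgue_on meas1[OF w_cont] meas1[OF continuous]
  have fm: "case_prod f \<in> borel_measurable (?M1 \<Otimes>\<^sub>M ?M2)"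
    unfolding f_def by measurable
  obtain R0 where R0: "closure G \<subseteq> ball 0 R0" using domain(3) by (meson bounded_closure bounded_subset_ballD)
  then have R: "G \<subseteq> ball 0 R0" using closure_subset by blast
  obtain K where K: "\<And>z. z \<in> ball 0 R0 \<Longrightarrow> integrable ?M2 (\<lambda>\<zeta>. h \<zeta> / (\<zeta> - z))"
    "\<And>z. z \<in> ball 0 R0 \<Longrightarrow> (LINT \<zeta>|?M2. cmod (h \<zeta> / (\<zeta> - z))) \<le> K"
    using Cauchy_kernel_bound[OF R] by blast
  have \<gamma>R: "\<gamma> t \<in> ball 0 R0" if "t \<in> {0..1}" for t
    using boundary_subset[OF \<gamma>] R0 that unfolding path_image_def frontier_def by blast
  have "0 \<le> (LINT \<zeta>|?M2. cmod (h \<zeta> / (\<zeta> - \<gamma> 0)))" by (rule Bochner_Integration.integral_nonneg) simp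
  also have "\<dots> \<le> K" by (rule K(2)[OF \<gamma>R]) simp
  finally have K0: "0 \<le> K" .
  have "bounded (w ` {0..1})" by (intro compact_imp_bounded compact_continuous_image w_cont compact_Icc)
  then obtain W where W: "\<And>t. t \<in> {0..1} \<Longrightarrow> cmod (w t) \<le> W" unfolding bounded_iff by blast
  have fint: "integrable (?M1 \<Otimes>\<^sub>M ?M2) (case_prod f)"
  proof (rule P.Fubini_integrable[OF fm])
    have sp: "space ?M1 = {0..1}" by (simp add: space_restrict_space)
    \<comment> \<open>The poles \<open>\<gamma> t\<close> lie on the boundary of \<open>G\<close>;
      the bound \<open>K\<close> is uniform over a ball containing \<open>closure G\<close> and
      therefore covers them.\<close>
    show "integrable ?M1 (\<lambda>x. LINT y|?M2. norm (case_prod f (x, y)))"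
    proof (rule M1.integrable_const_bound[where B = "K * W"])
      show "AE x in ?M1. norm (LINT y|?M2. norm (case_prod f (x, y))) \<le> K * W"
      proof (intro AE_I2)
        fix t assume "t \<in> space ?M1"
        then have t: "t \<in> {0..1}" by (simp add: sp)
        have "(LINT y|?M2. norm (case_prod f (t, y))) = (LINT y|?M2. cmod (h y / (y - \<gamma> t))) * cmod (w t)"
          by (simp only: case_prod_conv f_def norm_mult integral_mult_left_zero)
        also have "\<dots> \<le> K * W"
          using K(2)[OF \<gamma>R[OF t]] W[OF t] K0 by (intro mult_mono) auto
        finally show "norm (LINT y|?M2. norm (case_prod f (t, y))) \<le> K * W"
          by (simp only: real_norm_def abs_of_nonneg[OF Bochner_Integration.integral_nonneg[OF norm_ge_zero]])
      qed
      have "case_prod (\<lambda>x y. norm (f x y)) \<in> borel_measurable (?M1 \<Otimes>\<^sub>M ?M2)" using fm by measurable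
      from M2.borel_measurable_lebesgue_integral[OF this]
      show "(\<lambda>x. LINT y|?M2. norm (case_prod f (x, y))) \<in> borel_measurable ?M1" by simp
    qed
    show "AE x in ?M1. integrable ?M2 (\<lambda>y. case_prod f (x, y))"
    proof (intro AE_I2)
      fix t assume "t \<in> space ?M1"
      then have "\<gamma> t \<in> ball 0 R0" using \<gamma>R sp by blast
      from integrable_mult_left[OF K(1)[OF this]]
      show "integrable ?M2 (\<lambda>y. case_prod f (t, y))" unfolding case_prod_conv f_def by blast
    qed
  qed
  have wn_const: "winding_number \<gamma> \<zeta> = winding_number \<gamma> z" if "\<zeta> \<in> G" for \<zeta>
    using winding_number_constant[OF simple_path_imp_path[OF simple] loop domain(2) G_Int_path_image[OF \<gamma>]] that z
    unfolding constant_on_def by metis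
  have inner: "(LINT t|?M1. f t \<zeta>) = 0" if \<zeta>: "\<zeta> \<in> G" "\<zeta> \<noteq> z" for \<zeta>
  proof -
    have nz': "\<zeta> - \<gamma> t \<noteq> 0" if "t \<in> {0..1}" for t using nz[OF that \<zeta>(1)] by auto
    have c: "continuous_on {0..1} (\<lambda>t. 1 / (\<zeta> - \<gamma> t) * w t)"
      using nz' by (intro continuous_intros continuous w_cont) auto
    have "(LINT t|?M1. 1 / (\<zeta> - \<gamma> t) * w t) = integral {0..1} (\<lambda>t. 1 / (\<zeta> - \<gamma> t) * w t)"
      by (intro lebesgue_integral_eq_integral continuous_imp_integrable_real[OF c]) auto
    also have "\<dots> = 0"
      unfolding w_def integral_difference_Cauchy_kernels[OF off[OF z] off[OF \<zeta>(1)] \<zeta>(2)] wn_const[OF \<zeta>(1)] by simp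
    finally have "(LINT t|?M1. 1 / (\<zeta> - \<gamma> t) * w t) = 0" .
    moreover have "(LINT t|?M1. f t \<zeta>) = (LINT t|?M1. h \<zeta> * (1 / (\<zeta> - \<gamma> t) * w t))"
      by (simp add: f_def)
    ultimately show ?thesis by (simp only: integral_mult_right_zero mult_zero_right)
  qed
  \<comment> \<open>The partial fraction identity excludes \<open>\<zeta> = z\<close>, a null
    set.\<close>
  have "AE \<zeta> in ?M2. (LINT t|?M1. f t \<zeta>) = 0"
    using AE_neq[of z] by (rule AE_mp) (auto intro!: AE_I2 inner simp: space_restrict_space)
  then have zero: "(LINT \<zeta>|?M2. (LINT t|?M1. f t \<zeta>)) = 0"
    by (rule integral_eq_zero_AE)
  have c: "continuous_on {0..1} (\<lambda>t. T_op G h (\<gamma> t) * w t)"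
    by (intro continuous_intros w_cont continuous_on_compose2[OF continuous_on_T_op continuous]) auto
  have "contour_integral \<gamma> (\<lambda>t. T_op G h t / (t - z)) = integral {0..1} (\<lambda>t. T_op G h (\<gamma> t) * w t)"
    by (simp add: contour_integral_eq w_def)
  also have "\<dots> = (LINT t|?M1. T_op G h (\<gamma> t) * w t)"
    by (intro lebesgue_integral_eq_integral[symmetric] continuous_imp_integrable_real[OF c]) auto
  also have "\<dots> = (LINT t|?M1. - (1 / of_real pi) * (LINT \<zeta>|?M2. f t \<zeta>))"
    by (simp only: T_op_def f_def integral_mult_left_zero mult.assoc)
  also have "\<dots> = - (1 / of_real pi) * (LINT t|?M1. (LINT \<zeta>|?M2. f t \<zeta>))"
    by (rule integral_mult_right_zero)
  also have "(LINT t|?M1. (LINT \<zeta>|?M2. f t \<zeta>)) = 0"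
    using P.Fubini_integral[OF fint] zero by simp
  finally show ?thesis by simp
qed

theorem Cauchy_Pompeiu:
  assumes z: "z \<in> G"
  shows "V z = K_op \<Gamma> V z + T_op G h z"
proof -
  let ?u = "\<lambda>x. V x - T_op G h x"
  have Tc: "continuous_on S (T_op G h)" for S using continuous_on_T_op continuous_on_subset by blast
  have "contour_integral \<gamma> (\<lambda>t. ?u t / (t - z)) = contour_integral \<gamma> (\<lambda>t. V t / (t - z))" if \<gamma>: "\<gamma> \<in> \<Gamma>" for \<gamma>
  proof -
    interpret C1_Jordan_curve \<gamma> "D \<gamma>" by (rule curve[OF \<gamma>])
    have nz: "\<gamma> t - z \<noteq> 0" if "t \<in> {0..1}" for t
      using G_Int_path_image[OF \<gamma>] z that by (auto simp: path_image_def)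
    have cl: "\<gamma> ` {0..1} \<subseteq> closure G"
      using boundary_subset[OF \<gamma>] unfolding path_image_def frontier_def by blast
    have "(\<lambda>t. f (\<gamma> t) / (\<gamma> t - z) * D \<gamma> t) integrable_on {0..1}" if "continuous_on (closure G) f" for f
      using nz by (intro integrable_continuous_interval continuous_intros continuous cont_deriv
          continuous_on_compose2[OF that continuous cl]) auto
    from integral_diff[OF this[OF V_cont_closure] this[OF Tc]]
    have "contour_integral \<gamma> (\<lambda>t. ?u t / (t - z)) = contour_integral \<gamma> (\<lambda>t. V t / (t - z)) - contour_integral \<gamma> (\<lambda>t. T_op G h t / (t - z))"
      by (simp add: contour_integral_eq diff_divide_distrib left_diff_distrib)
    then show ?thesis using Cauchy_integral_T_op[OF \<gamma> z] by simp
  qed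
  then have "K_op \<Gamma> V z = 1 / (2 * of_real pi * \<i>) * (\<Sum>\<gamma>\<in>\<Gamma>. contour_integral \<gamma> (\<lambda>t. ?u t / (t - z)))"
    by (simp add: K_op_def)
  also have "\<dots> = ?u z"
    using Cauchy_integral_formula_boundary[OF holomorphic_on_diff_T_op _ z] continuous_on_diff[OF V_cont_closure Tc]
    by simp
  finally show ?thesis by simp
qed

end

section \<open>From the function spaces of the theorem to the boundary problem\<close>

lemma has_weak_dbar_test:
  assumes w: "has_weak_dbar G f h" and G: "open G" and \<phi>: "\<phi> \<in> test_functions G"
  shows "(LINT z|lebesgue_on G. f z * dbar \<phi> z) = - (LINT z|lebesgue_on G. h z * \<phi> z)"
    and "integrable (lebesgue_on G) (\<lambda>z. h z * \<phi> z)"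
proof -
  let ?M = "lebesgue_on G"
  obtain fx fy where fx: "has_weak_derivative G 1 f fx" and fy: "has_weak_derivative G \<i> f fy"
    and h: "\<And>z. h z = (fx z + \<i> * fy z) / 2"
    using w unfolding has_weak_dbar_def by blast
  obtain K where K: "compact K" "K \<subseteq> G" "\<And>z. z \<notin> K \<Longrightarrow> \<phi> z = 0" and Ck: "\<And>k. Ck k \<phi>"
    using \<phi> unfolding test_functions_def by blast
  have \<phi>c: "continuous_on UNIV \<phi>" using Ck[of 0] by simp
  have dc: "continuous_on UNIV (\<lambda>z. frechet_derivative \<phi> (at z) v)" for v
    using Ck[of 1] by simp
  note int = integrable_locally_integrable_mult[OF _ _ K(1,2) _ G]
  have if': "integrable (?M) (\<lambda>z. f z * frechet_derivative \<phi> (at z) v)" for v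
    using fx frechet_derivative_eq_0_off_support[OF K(1,3)] unfolding has_weak_derivative_def
    by (intro int dc) auto
  have ix: "integrable (?M) (\<lambda>z. fx z * \<phi> z)" and iy: "integrable (?M) (\<lambda>z. fy z * \<phi> z)"
    using fx fy K(3) unfolding has_weak_derivative_def by (auto intro!: int \<phi>c)
  have hphi: "h z * \<phi> z = (fx z * \<phi> z + \<i> * (fy z * \<phi> z)) / 2" for z by (simp add: h algebra_simps)
  show "integrable (?M) (\<lambda>z. h z * \<phi> z)"
    unfolding hphi by (intro integrable_divide Bochner_Integration.integrable_add integrable_mult_right ix iy)
  have fdb: "f z * dbar \<phi> z = (f z * frechet_derivative \<phi> (at z) 1 + \<i> * (f z * frechet_derivative \<phi> (at z) \<i>)) / 2" for z
    by (simp add: dbar_def algebra_simps)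
  have "(LINT z|?M. f z * dbar \<phi> z) = ((LINT z|?M. f z * frechet_derivative \<phi> (at z) 1)
      + \<i> * (LINT z|?M. f z * frechet_derivative \<phi> (at z) \<i>)) / 2"
    unfolding fdb by (simp only: integral_divide_zero Bochner_Integration.integral_add[OF if' integrable_mult_right[OF if']] integral_mult_right_zero)
  also have "\<dots> = (- (LINT z|?M. fx z * \<phi> z) + \<i> * - (LINT z|?M. fy z * \<phi> z)) / 2"
    using fx fy \<phi> unfolding has_weak_derivative_def by simp
  also have "\<dots> = - (((LINT z|?M. fx z * \<phi> z) + \<i> * (LINT z|?M. fy z * \<phi> z)) / 2)"
    by (simp add: field_simps)
  also have "\<dots> = - (LINT z|?M. h z * \<phi> z)"
    unfolding hphi by (simp only: integral_divide_zero Bochner_Integration.integral_add[OF ix integrable_mult_right[OF iy]] integral_mult_right_zero)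
  finally show "(LINT z|?M. f z * dbar \<phi> z) = - (LINT z|?M. h z * \<phi> z)" .
qed

text \<open>The weight is \<open>0\<close> at \<open>a\<close> in HOL, so the defining estimate says
  nothing about \<open>f a\<close>; hence the guard \<open>z \<noteq> a\<close>. Elsewhere the
  weight is positive and can be divided out.\<close>

lemma S_space_bound:
  assumes "f \<in> S_space \<nu> G a"
  obtains C where "0 \<le> C" "AE z in lebesgue_on G. z \<noteq> a \<longrightarrow> cmod (f z) \<le> C * cmod (z - a) powr - \<nu>"
proof -
  obtain C where C: "AE z in lebesgue_on G. cmod (z - a) powr \<nu> * cmod (f z) \<le> C"
    using assms unfolding S_space_def by blast
  have "AE z in lebesgue_on G. z \<noteq> a \<longrightarrow> cmod (f z) \<le> max 0 C * cmod (z - a) powr - \<nu>"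
    using C
  proof eventually_elim
    case (elim z)
    show ?case
    proof
      assume "z \<noteq> a"
      then have p: "0 < cmod (z - a) powr \<nu>" by simp
      have "cmod (z - a) powr \<nu> * cmod (f z) \<le> max 0 C" using elim by simp
      then show "cmod (f z) \<le> max 0 C * cmod (z - a) powr - \<nu>"
        using p by (simp add: powr_minus field_simps)
    qed
  qed
  then show ?thesis using that by (meson max.cobounded1)
qed

theorem mainTheorem4:
  fixes G :: "complex set" and \<Gamma> :: "(real \<Rightarrow> complex) set" and a :: complex
    and A B F V :: "complex \<Rightarrow> complex" and \<alpha> \<mu> q \<beta> :: real
  assumes "open G" and "connected G" and "bounded G" and "a \<in> G"
    and "0 < \<alpha>" and "\<alpha> < 1"
    and "positively_oriented_C1_Holder_boundary \<alpha> G \<Gamma>"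
    and "A \<in> S_space 1 G a" and "B \<in> S_space 1 G a"
    and "\<mu> = S_norm 1 G a A + S_norm 1 G a B"
    and "2 < q" and "\<mu> < 1/8 \<longrightarrow> q < 2 / (1 - 8 * \<mu>)"
    and "max 0 (1 - 8 * \<mu>) < \<beta>" and "\<beta> < 2 / q"
    and "F \<in> S_space \<beta> G a"
    and "V \<in> Sobolev_W1 q G \<inter> C_space (\<beta> - 1) G a"
    and "\<exists>V'. has_weak_dbar G V V' \<and>
           (AE z in lebesgue_on G. V' z + A z * V z + B z * cnj (V z) = F z)"
  shows "\<forall>z\<in>G. V z = - P_op_at A B G a V z + K_op_at \<Gamma> a V z + T_op_at G a F z"
proof -
  let ?M = "lebesgue_on G"
  have \<beta>: "0 < \<beta>" using assms(13) by simp
  have "2 / q < 1" using assms(11) by simp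
  then have \<beta>1: "\<beta> < 1" using assms(14) by linarith
  have meas: "A \<in> borel_measurable (?M)" "B \<in> borel_measurable (?M)" "F \<in> borel_measurable (?M)"
    using assms(8,9,15) by (auto simp: S_space_def)
  \<comment> \<open>As \<open>\<beta> - 1 \<le> 0\<close>, \<open>C_space\<close> also supplies
    continuity of \<open>V\<close> itself on the closure, including at \<open>a\<close>.\<close>
  obtain g where g: "continuous_on (closure G) g" "\<And>z. z \<in> closure G - {a} \<Longrightarrow> g z = of_real (cmod (z - a) powr (\<beta> - 1)) * V z"
    and Vc: "continuous_on (closure G) V"
    using assms(16) \<beta>1 unfolding C_space_def by auto
  have VcG: "continuous_on G V" using Vc closure_subset continuous_on_subset by blast
  then have Vm: "V \<in> borel_measurable (?M)"
    using assms(1) by (intro continuous_imp_measurable_on_sets_lebesgue) auto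
  note [measurable] = meas Vm
  have "bounded (g ` closure G)"
    using assms(3) by (intro compact_imp_bounded compact_continuous_image g(1)) simp
  then obtain Mg where Mg: "\<And>z. z \<in> closure G \<Longrightarrow> cmod (g z) \<le> Mg" unfolding bounded_iff by blast
  have Mg0: "0 \<le> Mg" using Mg[of a] assms(4) closure_subset norm_ge_zero order_trans by (metis in_mono)
  have Vb: "cmod (V z) \<le> Mg * cmod (z - a) powr (1 - \<beta>)" if "z \<in> closure G" "z \<noteq> a" for z
  proof -
    have p: "0 < cmod (z - a) powr (\<beta> - 1)" using that by simp
    have "cmod (z - a) powr (\<beta> - 1) * cmod (V z) \<le> Mg"
      using Mg[OF that(1)] g(2)[of z] that by (simp add: norm_mult)
    moreover have "v \<le> m * inverse x" if "x * v \<le> m" "0 < x" for x v m :: real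
      using that by (simp add: field_simps)
    ultimately have "cmod (V z) \<le> Mg * inverse (cmod (z - a) powr (\<beta> - 1))" using p by blast
    then show ?thesis by (simp add: powr_minus[symmetric])
  qed
  have Va: "V a = 0"
  proof -
    have "(V \<longlongrightarrow> V a) (at a)"
      using VcG assms(1,4) by (simp add: continuous_on_eq_continuous_at isCont_def)
    \<comment> \<open>The exponent \<open>1 - \<beta>\<close> is positive, so the weighted bound
      forces the limit \<open>0\<close> at \<open>a\<close>.\<close>
    moreover have "(V \<longlongrightarrow> 0) (at a)"
    proof (rule Lim_null_comparison)
      show "\<forall>\<^sub>F z in at a. norm (V z) \<le> Mg * cmod (z - a) powr (1 - \<beta>)"
        using eventually_at_in_open[OF assms(1,4)] by eventually_elim (use Vb closure_subset[of G] in blast)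
      have "((\<lambda>z. Mg * cmod (z - a) powr (1 - \<beta>)) \<longlongrightarrow> Mg * cmod (a - a) powr (1 - \<beta>)) (at a)"
        using \<beta>1 by (intro tendsto_intros) auto
      then show "((\<lambda>z. Mg * cmod (z - a) powr (1 - \<beta>)) \<longlongrightarrow> 0) (at a)" by simp
    qed
    ultimately show ?thesis using LIM_unique by blast
  qed
  obtain CA where CA: "0 \<le> CA" "AE z in ?M. z \<noteq> a \<longrightarrow> cmod (A z) \<le> CA * cmod (z - a) powr - 1"
    using S_space_bound[OF assms(8)] by blast
  obtain CB where CB: "0 \<le> CB" "AE z in ?M. z \<noteq> a \<longrightarrow> cmod (B z) \<le> CB * cmod (z - a) powr - 1"
    using S_space_bound[OF assms(9)] by blast
  obtain CF where CF: "0 \<le> CF" "AE z in ?M. z \<noteq> a \<longrightarrow> cmod (F z) \<le> CF * cmod (z - a) powr - \<beta>"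
    using S_space_bound[OF assms(15)] by blast
  define fs where "fs z = A z * V z + B z * cnj (V z)" for z
  have AEG: "AE z in ?M. z \<in> closure G"
    using closure_subset[of G] by (intro AE_I2) (auto simp: space_restrict_space)
  have AEa: "AE z in ?M. z \<noteq> a"
    using assms(1) by (intro AE_lebesgue_on_neq) auto
  have fs_bound: "AE z in ?M. cmod (fs z) \<le> (CA * Mg + CB * Mg) * cmod (z - a) powr - \<beta>"
    using CA(2) CB(2) AEG AEa
  proof eventually_elim
    case (elim z)
    let ?d = "cmod (z - a)"
    have d: "0 < ?d" using elim by simp
    have e: "?d powr - 1 * ?d powr (1 - \<beta>) = ?d powr - \<beta>" by (simp only: powr_add[symmetric]) simp
    have "cmod (fs z) \<le> cmod (A z) * cmod (V z) + cmod (B z) * cmod (V z)"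
      unfolding fs_def using norm_triangle_ineq[of "A z * V z" "B z * cnj (V z)"] by (simp add: norm_mult)
    also have "\<dots> \<le> (CA * ?d powr - 1) * (Mg * ?d powr (1 - \<beta>)) + (CB * ?d powr - 1) * (Mg * ?d powr (1 - \<beta>))"
      using elim Vb[of z] CA(1) CB(1) by (intro add_mono mult_mono) auto
    also have "\<dots> = (CA * Mg + CB * Mg) * (?d powr - 1 * ?d powr (1 - \<beta>))" by (simp only: algebra_simps)
    finally show ?case unfolding e .
  qed
  have F_bound: "AE z in ?M. cmod (F z) \<le> CF * cmod (z - a) powr - \<beta>"
    using CF(2) AEa by eventually_elim simp
  have fs_meas: "fs \<in> borel_measurable (?M)"
  proof -
    have "(\<lambda>z. cnj (V z)) \<in> borel_measurable (?M)"
      using VcG assms(1) by (intro continuous_imp_measurable_on_sets_lebesgue continuous_intros) auto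
    then show ?thesis unfolding fs_def[abs_def] by measurable
  qed
  define h where "h z = F z - fs z" for z
  have h_meas: "h \<in> borel_measurable (?M)" unfolding h_def[abs_def] using fs_meas by measurable
  have h_bound: "AE z in ?M. cmod (h z) \<le> (CF + (CA * Mg + CB * Mg)) * cmod (z - a) powr - \<beta>"
    using F_bound fs_bound
    by eventually_elim (use norm_triangle_ineq4 in \<open>fastforce simp: h_def distrib_right intro: order_trans\<close>)
  obtain V' where V': "has_weak_dbar G V V'" "AE z in ?M. V' z + A z * V z + B z * cnj (V z) = F z"
    using assms(17) by blast
  \<comment> \<open>The equation identifies \<open>V'\<close> with \<open>h\<close> almost
    everywhere, which suffices because the weak equation sees \<open>V'\<close> only under
    integrals.\<close>
  have V'h: "AE z in ?M. V' z = h z"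
    using V'(2) by eventually_elim (simp add: h_def fs_def algebra_simps eq_diff_eq)
  have weak: "(LINT z|?M. V z * dbar \<phi> z) = - (LINT z|?M. h z * \<phi> z)"
    if \<phi>: "\<phi> \<in> test_functions G" for \<phi>
  proof -
    have "continuous_on UNIV \<phi>" using \<phi> unfolding test_functions_def by (auto dest: spec[of _ 0])
    then have [measurable]: "\<phi> \<in> borel_measurable (?M)"
      by (intro measurable_lebesgue_on_borel borel_measurable_continuous_onI)
    have "(LINT z|?M. V' z * \<phi> z) = (LINT z|?M. h z * \<phi> z)"
    proof (rule integral_cong_AE)
      show "(\<lambda>z. V' z * \<phi> z) \<in> borel_measurable (?M)"
        using has_weak_dbar_test(2)[OF V'(1) assms(1) \<phi>] by auto
      show "(\<lambda>z. h z * \<phi> z) \<in> borel_measurable (?M)" using h_meas by measurable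
      show "AE z in ?M. V' z * \<phi> z = h z * \<phi> z" using V'h by eventually_elim simp
    qed
    then show ?thesis using has_weak_dbar_test(1)[OF V'(1) assms(1) \<phi>] by simp
  qed
  have V_loc: "locally_integrable G V"
    using V'(1) unfolding has_weak_dbar_def has_weak_derivative_def by blast
  let ?D = "\<lambda>\<gamma> t. vector_derivative \<gamma> (at t within {0..1})"
  have bd: "finite \<Gamma>" "\<And>\<gamma>. \<gamma> \<in> \<Gamma> \<Longrightarrow> closed_C1_Holder_curve \<alpha> \<gamma>" "disjoint_family_on path_image \<Gamma>"
    "(\<Union>\<gamma>\<in>\<Gamma>. path_image \<gamma>) = frontier G"
    "\<And>\<gamma> t. \<gamma> \<in> \<Gamma> \<Longrightarrow> t \<in> {0..1} \<Longrightarrow> \<forall>\<^sub>F \<epsilon> in at_right 0. \<gamma> t + of_real \<epsilon> * (\<i> * ?D \<gamma> t) \<in> G"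
    using assms(7) unfolding positively_oriented_C1_Holder_boundary_def by auto
  have "C1_Jordan_domain G \<Gamma> ?D"
    by (rule C1_Jordan_domain.intro)
       (use assms(1-3) bd closed_C1_Holder_curve_imp_C1_Jordan_curve[OF _ assms(5)] in blast)+
  moreover have "point_singular_density G a \<beta> (CF + (CA * Mg + CB * Mg)) h"
    by unfold_locales (use assms(1-4) \<beta> \<beta>1 h_meas h_bound in auto)
  then have "weak_dbar_solution G a \<beta> (CF + (CA * Mg + CB * Mg)) h V"
    by (rule weak_dbar_solution.intro) (unfold_locales, use VcG weak V_loc in auto)
  ultimately interpret dbar_boundary_problem G \<Gamma> ?D a \<beta> "CF + (CA * Mg + CB * Mg)" h V
    using Vc by (intro dbar_boundary_problem.intro dbar_boundary_problem_axioms.intro)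
  \<comment> \<open>\<open>F\<close> and \<open>fs\<close> separately have singular order
    \<open>\<beta>\<close> at \<open>a\<close>, so both Cauchy integrals converge and
    \<open>T_op\<close> of their difference splits.\<close>
  have F: "integrable (?M) (\<lambda>\<zeta>. F \<zeta> / (\<zeta> - z))" for z
    by (rule point_singular_density.integrable_Cauchy_kernel[of G a \<beta> CF])
       (unfold_locales, use assms(1-4) \<beta> \<beta>1 meas F_bound in auto)
  have fs: "integrable (?M) (\<lambda>\<zeta>. fs \<zeta> / (\<zeta> - z))" for z
    by (rule point_singular_density.integrable_Cauchy_kernel[of G a \<beta> "CA * Mg + CB * Mg"])
       (unfold_locales, use assms(1-4) \<beta> \<beta>1 fs_meas fs_bound in auto)
  have T: "T_op G h z = T_op G F z - T_op G fs z" for z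
    unfolding T_op_def h_def diff_divide_distrib Bochner_Integration.integral_diff[OF F fs] by (rule right_diff_distrib)
  show ?thesis
  proof
    fix z assume z: "z \<in> G"
    \<comment> \<open>The formula at \<open>a\<close> has the left-hand side \<open>V a = 0\<close>,
      so subtracting it changes only the right-hand side and produces the normalised
      operators.\<close>
    have "V z = (K_op \<Gamma> V z + T_op G h z) - (K_op \<Gamma> V a + T_op G h a)"
      using Cauchy_Pompeiu[OF z] Cauchy_Pompeiu[OF assms(4)] Va by simp
    then show "V z = - P_op_at A B G a V z + K_op_at \<Gamma> a V z + T_op_at G a F z"
      unfolding P_op_at_def K_op_at_def T_op_at_def T fs_def[abs_def] by (simp add: algebra_simps)
  qed
qed


end
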